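(* Let $R$ be a non-discrete irreducible, continuous ring. If $a\in\mathrm{GL}(R)$ is locally algebraic, then $a\in\Delta(\mathrm{GL}(R),d_R)$.
   Context: All rings are unital. A ring $R$ is regular if for every $a \in R$ there is $b \in R$ with $aba=a$. For a regular ring $R$, the set $L(R)=\{aR : a\in R\}$, ordered by inclusion, is a complemented modular lattice. A continuous ring is a regular ring $R$ such that the lattice $L(R)$ is complete and satisfies $I\wedge\bigvee C=\bigvee\{I\wedge J : J\in C\}$ and $I\vee\bigwedge C=\bigwedge\{I\vee J : J\in C\}$ for every chain $C\subseteq L(R)$ and every $I\in L(R)$. A ring is irreducible if it is non-zero and not isomorphic to a direct product of two non-zero rings. A rank function on a regular ring $R$ is a map $\rho\colon R\to[0,1]$ with $\rho(1)=1$, $\rho(ab)\le\min\{\rho(a),\rho(b)\}$ for all $a,b \in R$, $\rho(e+f)=\rho(e)+\rho(f)$ for any idempotents $e,f$ with $ef=fe=0$, and $\rho(a)=0$ only if $a=0$. Every irreducible, continuous ring $R$ has a unique rank function, denoted $\mathrm{rk}_R$; the rank metric $d_R(a,b)=\mathrm{rk}_R(a-b)$ is complete, and the topology it generates is the rank topology. $R$ is non-discrete if its rank topology is not discrete. The center $Z(R)$ is a field; $\mathrm{GL}(R)$ denotes the group of units of $R$, and the restriction of $d_R$ to it is a bi-invariant metric. $A(R)$ is the set of $a\in R$ for which there is a non-zero $p\in Z(R)[X]$ with $p(a)=0$. For a non-zero idempotent $e\in R$, the ring $eRe=\{exe:x\in R\}$ (with identity $e$) is again an irreducible, continuous ring,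 with center $Z(R)e\cong Z(R)$. Idempotents $e,f$ are orthogonal if $ef=fe=0$. An element $a\in R$ is locally algebraic if there exist a (necessarily countable) set $E$ of pairwise orthogonal non-zero idempotents of $R$ and $(a_e)_{e\in E}\in\prod_{e\in E}A(eRe)$ such that $a=\sum_{e\in E}a_e$, where $\sum_{e\in E}a_e$ is the limit, in the rank topology, of the net of finite partial sums $\sum_{e\in F}a_e$ over the finite subsets $F\subseteq E$ directed by inclusion (this limit always exists). A geodesic in a metric space $(X,d)$ from $x$ to $y$ is an isometric map $\varphi\colon[0,d(x,y)]\to X$ with $\varphi(0)=x$ and $\varphi(d(x,y))=y$. For a group $G$ with bi-invariant metric $d$, $\Delta(G,d)$ is the set of all $g\in G$ such that there exists a geodesic in $(G,d)$ from the neutral element $1$ to $g$. *)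

theory Defs
  imports "HOL-Algebra.Algebra" "HOL-Analysis.Analysis"
begin

section \<open>Irreducible continuous rings\<close>

definition regular_ring :: "('a, 'm) ring_scheme \<Rightarrow> bool" where
  "regular_ring R \<longleftrightarrow>
     ring R \<and> (\<forall>a \<in> carrier R. \<exists>b \<in> carrier R. a \<otimes>\<^bsub>R\<^esub> b \<otimes>\<^bsub>R\<^esub> a = a)"

definition principal_right_ideals :: "('a, 'm) ring_scheme \<Rightarrow> 'a set set" where
  "principal_right_ideals R = {a <#\<^bsub>R\<^esub> carrier R | a. a \<in> carrier R}"

definition ideal_lattice :: "('a, 'm) ring_scheme \<Rightarrow> 'a set gorder" where
  "ideal_lattice R = \<lparr>carrier = principal_right_ideals R, eq = (=), le = (\<subseteq>)\<rparr>"

definition continuous_ring :: "('a, 'm) ring_scheme \<Rightarrow> bool" where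
  "continuous_ring R \<longleftrightarrow>
     regular_ring R \<and>
     complete_lattice (ideal_lattice R) \<and>
     (\<forall>C I. subset.chain (principal_right_ideals R) C \<longrightarrow> I \<in> principal_right_ideals R \<longrightarrow>
        I \<sqinter>\<^bsub>ideal_lattice R\<^esub> (\<Squnion>\<^bsub>ideal_lattice R\<^esub> C)
          = \<Squnion>\<^bsub>ideal_lattice R\<^esub> ((\<lambda>J. I \<sqinter>\<^bsub>ideal_lattice R\<^esub> J) ` C) \<and>
        I \<squnion>\<^bsub>ideal_lattice R\<^esub> (\<Sqinter>\<^bsub>ideal_lattice R\<^esub> C)
          = \<Sqinter>\<^bsub>ideal_lattice R\<^esub> ((\<lambda>J. I \<squnion>\<^bsub>ideal_lattice R\<^esub> J) ` C))"

text \<open>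
  Letting the factors range over rings on the element type of \<open>R\<close> loses no generality: in a
  decomposition of \<open>R\<close> as a product of two rings on arbitrary types, each factor is isomorphic to
  the image in \<open>R\<close> of the corresponding axis of the product.
\<close>

definition irreducible_ring :: "('a, 'm) ring_scheme \<Rightarrow> bool" where
  "irreducible_ring R \<longleftrightarrow>
     ring R \<and> carrier R \<noteq> {\<zero>\<^bsub>R\<^esub>} \<and>
     \<not> (\<exists>(S :: 'a ring) (T :: 'a ring). ring S \<and> ring T \<and>
          carrier S \<noteq> {\<zero>\<^bsub>S\<^esub>} \<and> carrier T \<noteq> {\<zero>\<^bsub>T\<^esub>} \<and> R \<simeq> RDirProd S T)"

section \<open>Rank functions and the rank topology\<close>

definition idempotents :: "('a, 'm) ring_scheme \<Rightarrow> 'a set" where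
  "idempotents R = {e \<in> carrier R. e \<otimes>\<^bsub>R\<^esub> e = e}"

definition orthogonal_elems :: "('a, 'm) ring_scheme \<Rightarrow> 'a \<Rightarrow> 'a \<Rightarrow> bool" where
  "orthogonal_elems R e f \<longleftrightarrow> e \<otimes>\<^bsub>R\<^esub> f = \<zero>\<^bsub>R\<^esub> \<and> f \<otimes>\<^bsub>R\<^esub> e = \<zero>\<^bsub>R\<^esub>"

text \<open>
  An irreducible continuous ring has exactly one rank function on its carrier (von Neumann). The
  notions below therefore take it as a parameter \<open>\<rho>\<close>, specified by \<open>rank_function R \<rho>\<close>.
\<close>

definition rank_function :: "('a, 'm) ring_scheme \<Rightarrow> ('a \<Rightarrow> real) \<Rightarrow> bool" where
  "rank_function R \<rho> \<longleftrightarrow>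
     \<rho> \<in> carrier R \<rightarrow> {0..1} \<and>
     \<rho> \<one>\<^bsub>R\<^esub> = 1 \<and>
     (\<forall>a \<in> carrier R. \<forall>b \<in> carrier R. \<rho> (a \<otimes>\<^bsub>R\<^esub> b) \<le> min (\<rho> a) (\<rho> b)) \<and>
     (\<forall>e \<in> idempotents R. \<forall>f \<in> idempotents R.
        orthogonal_elems R e f \<longrightarrow> \<rho> (e \<oplus>\<^bsub>R\<^esub> f) = \<rho> e + \<rho> f) \<and>
     (\<forall>a \<in> carrier R. \<rho> a = 0 \<longrightarrow> a = \<zero>\<^bsub>R\<^esub>)"

text \<open>
  The value 0 outside the carrier is there because the locale \<open>Metric_space\<close> demands non-negativity
  and symmetry on the whole type.
\<close>

definition rank_dist :: "('a, 'm) ring_scheme \<Rightarrow> ('a \<Rightarrow> real) \<Rightarrow> 'a \<Rightarrow> 'a \<Rightarrow> real" where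
  "rank_dist R \<rho> a b =
     (if a \<in> carrier R \<and> b \<in> carrier R then \<rho> (a \<ominus>\<^bsub>R\<^esub> b) else 0)"

definition rank_topology :: "('a, 'm) ring_scheme \<Rightarrow> ('a \<Rightarrow> real) \<Rightarrow> 'a topology" where
  "rank_topology R \<rho> = Metric_space.mtopology (carrier R) (rank_dist R \<rho>)"

section \<open>Locally algebraic elements\<close>

definition ring_center :: "('a, 'm) ring_scheme \<Rightarrow> 'a set" where
  "ring_center R = {z \<in> carrier R. \<forall>x \<in> carrier R. z \<otimes>\<^bsub>R\<^esub> x = x \<otimes>\<^bsub>R\<^esub> z}"

definition algebraic_elems :: "('a, 'm) ring_scheme \<Rightarrow> 'a set" where
  "algebraic_elems R =
     {a \<in> carrier R.
        \<exists>p \<in> carrier (univ_poly R (ring_center R)).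
          p \<noteq> \<zero>\<^bsub>univ_poly R (ring_center R)\<^esub> \<and> ring.eval R p a = \<zero>\<^bsub>R\<^esub>}"

definition corner_ring :: "('a, 'm) ring_scheme \<Rightarrow> 'a \<Rightarrow> ('a, 'm) ring_scheme" where
  "corner_ring R e =
     R\<lparr>carrier := {e \<otimes>\<^bsub>R\<^esub> x \<otimes>\<^bsub>R\<^esub> e | x. x \<in> carrier R}, one := e\<rparr>"

definition locally_algebraic :: "('a, 'm) ring_scheme \<Rightarrow> ('a \<Rightarrow> real) \<Rightarrow> 'a \<Rightarrow> bool" where
  "locally_algebraic R \<rho> a \<longleftrightarrow>
     (\<exists>E b. E \<subseteq> idempotents R - {\<zero>\<^bsub>R\<^esub>} \<and>
            pairwise (orthogonal_elems R) E \<and>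
            (\<forall>e \<in> E. b e \<in> algebraic_elems (corner_ring R e)) \<and>
            limitin (rank_topology R \<rho>) (\<lambda>F. \<Oplus>\<^bsub>R\<^esub>e \<in> F. b e) a (finite_subsets_at_top E))"

section \<open>Geodesics\<close>

definition geodesic :: "'a set \<Rightarrow> ('a \<Rightarrow> 'a \<Rightarrow> real) \<Rightarrow> 'a \<Rightarrow> 'a \<Rightarrow> (real \<Rightarrow> 'a) \<Rightarrow> bool" where
  "geodesic M d x y \<gamma> \<longleftrightarrow>
     \<gamma> \<in> {0..d x y} \<rightarrow> M \<and>
     (\<forall>s \<in> {0..d x y}. \<forall>t \<in> {0..d x y}. d (\<gamma> s) (\<gamma> t) = \<bar>s - t\<bar>) \<and>
     \<gamma> 0 = x \<and> \<gamma> (d x y) = y"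

definition geodesic_elems :: "('a, 'm) monoid_scheme \<Rightarrow> ('a \<Rightarrow> 'a \<Rightarrow> real) \<Rightarrow> 'a set" where
  "geodesic_elems G d = {g \<in> carrier G. \<exists>\<gamma>. geodesic (carrier G) d \<one>\<^bsub>G\<^esub> g \<gamma>}"

end

theory Submission
  imports Defs
begin

text \<open>
  If \<open>g t\<close>, for \<open>t\<close> in \<open>[0, 1]\<close>, is an increasing family of idempotents of rank \<open>t\<close> commuting with the
  unit \<open>a\<close>, then \<open>a (g t) + (1 - g t)\<close> runs from \<open>1\<close> to \<open>a\<close> through units and is a geodesic up to
  reparametrisation. Such a family is a maximal chain of idempotents commuting with \<open>a\<close> and with the
  given orthogonal family \<open>E\<close>. The chain has no gaps because the rank is continuous along monotone
  sequences of idempotents and because every non-zero idempotent \<open>h\<close> commuting with \<open>a\<close> and \<open>E\<close> has a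
  proper non-zero subidempotent commuting with them. Indeed one may assume that \<open>h\<close> lies below some
  member of \<open>E\<close>, so that \<open>a\<close> is algebraic on \<open>h\<close>. A vector \<open>x\<close> of very small rank then generates an
  \<open>a\<close>-invariant right ideal that is free over the algebra \<open>K[a] h\<close>, \<open>K\<close> being the centre; since this
  algebra is Frobenius, the right ideal is the range of a projection commuting with \<open>a\<close>.
\<close>

section \<open>Von Neumann regular rings\<close>

text \<open>Two obstacles shape the proof. The rank is additive only on finite orthogonal families,
  so its continuity has to be extracted from upper and lower continuity of the lattice, by means of
  comparability of orthogonal idempotents; limits are therefore taken in the lattice and not in the
  metric. Secondly, a right ideal has no basis, and a dependence among \<open>x\<close>,
  \<open>a x\<close>, \<open>a^2 x\<close>, ... has coefficients in \<open>R\<close>. If every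
  vector has one, the coefficient maps preserve all principal subideals, which makes them scalars
  from the centre; so a vector with \<open>d\<close> independent powers exists, where
  \<open>d\<close> is the least degree for which some monic polynomial \<open>q(a)\<close> has a
  kernel. When \<open>h\<close> cannot be split, \<open>N = q(a)\<close> is nilpotent on
  \<open>h\<close> by Fitting's lemma, and the \<open>N^l a^i\<close> with \<open>i < d\<close>
  serve as a basis of the algebra. The Frobenius form is the top coefficient in this basis.
  Averaging over the nilpotency index of \<open>N\<close> and over \<open>d\<close> powers of
  \<open>a\<close> multiplies the rank by at most the product of these two numbers, which decides
  how small the vector must be.\<close>

context ring
begin

lemma r_minus_distr:
  assumes "x \<in> carrier R" "y \<in> carrier R" "z \<in> carrier R"
  shows "x \<otimes> (y \<ominus> z) = x \<otimes> y \<ominus> x \<otimes> z"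
  using assms by (simp add: a_minus_def r_distr r_minus)

lemma l_minus_distr:
  assumes "x \<in> carrier R" "y \<in> carrier R" "z \<in> carrier R"
  shows "(y \<ominus> z) \<otimes> x = y \<otimes> x \<ominus> z \<otimes> x"
  using assms by (simp add: a_minus_def l_distr l_minus)

lemma minus_self [simp]: "x \<in> carrier R \<Longrightarrow> x \<ominus> x = \<zero>"
  by (simp add: a_minus_def r_neg)

lemma minus_zero_right [simp]: "x \<in> carrier R \<Longrightarrow> x \<ominus> \<zero> = x"
  by (simp add: a_minus_def)

lemma eq_iff_minus_zero:
  "x \<in> carrier R \<Longrightarrow> y \<in> carrier R \<Longrightarrow> x = y \<longleftrightarrow> x \<ominus> y = \<zero>"
  by simp

lemma mult_eq_assoc:
  assumes "x \<otimes> y = z" "x \<in> carrier R" "y \<in> carrier R" "t \<in> carrier R"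
  shows "x \<otimes> (y \<otimes> t) = z \<otimes> t"
  using assms m_assoc by metis

lemma idemD: "e \<in> idempotents R \<Longrightarrow> e \<in> carrier R" "e \<in> idempotents R \<Longrightarrow> e \<otimes> e = e"
  by (auto simp: idempotents_def)

lemma idemI: "e \<in> carrier R \<Longrightarrow> e \<otimes> e = e \<Longrightarrow> e \<in> idempotents R"
  by (auto simp: idempotents_def)

lemma one_idem [simp, intro]: "\<one> \<in> idempotents R"
  and zero_idem [simp, intro]: "\<zero> \<in> idempotents R"
  by (auto simp: idempotents_def)

lemma idem_carrier [simp, intro]: "e \<in> idempotents R \<Longrightarrow> e \<in> carrier R"
  by (auto simp: idempotents_def)

lemma idem_minus:
  assumes "e \<in> idempotents R" "f \<in> idempotents R" "e \<otimes> f = f" "f \<otimes> e = f"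
  shows "e \<ominus> f \<in> idempotents R"
  using assms by (intro idemI) (auto simp: r_minus_distr l_minus_distr idemD)

lemma idem_compl: "e \<in> idempotents R \<Longrightarrow> \<one> \<ominus> e \<in> idempotents R"
  by (rule idem_minus) auto

lemma idem_plus:
  assumes "e \<in> idempotents R" "f \<in> idempotents R" "e \<otimes> f = \<zero>" "f \<otimes> e = \<zero>"
  shows "e \<oplus> f \<in> idempotents R"
  using assms by (intro idemI) (auto simp: r_distr l_distr idemD)

end

locale von_neumann_regular = ring +
  assumes regular: "a \<in> carrier R \<Longrightarrow> \<exists>b\<in>carrier R. a \<otimes> b \<otimes> a = a"
begin

text \<open>Any inner inverse \<open>v\<close> becomes reflexive as \<open>v x v\<close>, and
  cutting it by \<open>e\<close> and \<open>f\<close> costs nothing since \<open>x = f x e\<close>.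
  Landing in \<open>e R f\<close> lets inverses of maps between corners be combined without cross
  terms.\<close>

lemma quasi_inverse:
  assumes "x \<in> carrier R" "e \<in> idempotents R" "f \<in> idempotents R" "f \<otimes> x = x" "x \<otimes> e = x"
  obtains w where "w \<in> carrier R" "x \<otimes> w \<otimes> x = x" "w \<otimes> x \<otimes> w = w" "e \<otimes> w = w" "w \<otimes> f = w"
    "x \<otimes> w \<in> idempotents R" "w \<otimes> x \<in> idempotents R"
proof -
  obtain v where v: "v \<in> carrier R" "x \<otimes> v \<otimes> x = x"
    using regular assms by blast
  define w where "w = e \<otimes> (v \<otimes> x \<otimes> v) \<otimes> f"
  note c = assms(1) v(1) idemD(1)[OF assms(2)] idemD(1)[OF assms(3)]
  have xe: "x \<otimes> (e \<otimes> t) = x \<otimes> t" if "t \<in> carrier R" for t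
    using mult_eq_assoc[OF assms(5)] c that by simp
  have xvx: "x \<otimes> (v \<otimes> (x \<otimes> t)) = x \<otimes> t" if "t \<in> carrier R" for t
    using v c that by (metis m_assoc m_closed)
  have xvx': "x \<otimes> (v \<otimes> x) = x"
    using v c by (simp add: m_assoc)
  have fx: "f \<otimes> (x \<otimes> t) = x \<otimes> t" if "t \<in> carrier R" for t
    using mult_eq_assoc[OF assms(4)] c that by simp
  have ee: "e \<otimes> (e \<otimes> t) = e \<otimes> t" if "t \<in> carrier R" for t
    using mult_eq_assoc[OF idemD(2)[OF assms(2)]] c that by simp
  have w: "w \<in> carrier R" "e \<otimes> w = w" "w \<otimes> f = w" "x \<otimes> w \<otimes> x = x" "w \<otimes> x \<otimes> w = w"
    using c assms by (simp_all add: w_def m_assoc xe xvx fx ee xvx' idemD)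
  moreover have "x \<otimes> w \<in> idempotents R" "w \<otimes> x \<in> idempotents R"
    using w c by (auto intro!: idemI) (metis m_assoc m_closed)+
  ultimately show thesis using that by blast
qed

lemma quasi_inverse':
  assumes "x \<in> carrier R"
  obtains w where "w \<in> carrier R" "x \<otimes> w \<otimes> x = x" "w \<otimes> x \<otimes> w = w"
    "x \<otimes> w \<in> idempotents R" "w \<otimes> x \<in> idempotents R"
  by (rule quasi_inverse[of x \<one> \<one>]) (use assms in auto)

text \<open>\<open>x (1 - w x) = 0\<close> for a quasi-inverse \<open>w\<close>, so injectivity on
  \<open>e R\<close> gives \<open>e = w x\<close>. This turns an injective map between right ideals
  into an \<open>embeds\<close> witness.\<close>

lemma left_inverse_of_injective:
  assumes "x \<in> carrier R" "e \<in> idempotents R" "f \<in> idempotents R" "f \<otimes> x = x" "x \<otimes> e = x"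
    and inj: "\<And>s. s \<in> carrier R \<Longrightarrow> x \<otimes> s = \<zero> \<Longrightarrow> e \<otimes> s = \<zero>"
  obtains w where "w \<in> carrier R" "e \<otimes> w = w" "w \<otimes> f = w" "w \<otimes> x = e"
proof -
  obtain w where w: "w \<in> carrier R" "x \<otimes> w \<otimes> x = x" "w \<otimes> x \<otimes> w = w" "e \<otimes> w = w" "w \<otimes> f = w"
    using quasi_inverse[OF assms(1-5)] by metis
  note c = assms(1) w(1) idemD(1)[OF assms(2)] idemD(1)[OF assms(3)]
  have "x \<otimes> (\<one> \<ominus> w \<otimes> x) = \<zero>"
    using w(2) c by (simp add: r_minus_distr m_assoc)
  then have "e \<otimes> (\<one> \<ominus> w \<otimes> x) = \<zero>"
    using c by (intro inj) auto
  moreover have "e \<otimes> (w \<otimes> x) = w \<otimes> x"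
    using w c by (simp add: m_assoc[symmetric])
  ultimately have "w \<otimes> x = e"
    using c by (simp add: r_minus_distr)
  then show thesis using that w by blast
qed

text \<open>A Gram-Schmidt step: the part \<open>c = (1 - e) b\<close> of \<open>b\<close> is
  adjoined as the idempotent \<open>c w\<close>. Choosing \<open>w\<close> with
  \<open>w (1 - e) = w\<close> makes \<open>c w\<close> orthogonal to \<open>e\<close> on both
  sides, and the explicit form of \<open>f\<close> keeps \<open>e + f\<close> inside
  \<open>e R + b R\<close>.\<close>

lemma sum_idem:
  assumes e: "e \<in> idempotents R" and b: "b \<in> carrier R"
  obtains f t where "f \<in> idempotents R" "t \<in> carrier R" "e \<otimes> f = \<zero>" "f \<otimes> e = \<zero>"
    "(e \<oplus> f) \<otimes> b = b" "f = (b \<ominus> e \<otimes> b) \<otimes> t"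
proof -
  define c where "c = (\<one> \<ominus> e) \<otimes> b"
  have ce: "e \<in> carrier R" "c \<in> carrier R" using e b by (auto simp: c_def)
  have cb: "c = b \<ominus> e \<otimes> b" using e b by (simp add: c_def l_minus_distr)
  have ec: "(\<one> \<ominus> e) \<otimes> c = c" "e \<otimes> c = \<zero>"
    using e b mult_eq_assoc[OF idemD(2)[OF e]] by (simp_all add: c_def l_minus_distr r_minus_distr idemD)
  obtain w where w: "w \<in> carrier R" "c \<otimes> w \<otimes> c = c" "w \<otimes> (\<one> \<ominus> e) = w" "c \<otimes> w \<in> idempotents R"
    by (rule quasi_inverse[of c \<one> "\<one> \<ominus> e"]) (use ec ce idem_compl[OF e] in auto)
  have we: "w \<otimes> e = \<zero>"
  proof -
    have "w \<ominus> w \<otimes> e = w" using w(3) w(1) ce by (simp add: r_minus_distr)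
    moreover have "w \<otimes> e = w \<ominus> (w \<ominus> w \<otimes> e)" using w(1) ce by algebra
    ultimately show ?thesis using w(1) by simp
  qed
  have "e \<otimes> b \<in> carrier R" using e b by auto
  have "(e \<oplus> c \<otimes> w) \<otimes> b = e \<otimes> b \<oplus> c \<otimes> w \<otimes> b" using w ce b by (simp add: l_distr)
  also have "c \<otimes> w \<otimes> b = c \<otimes> w \<otimes> c"
    using w(1) we ce b mult_eq_assoc[OF we] by (simp add: cb r_minus_distr m_assoc) 
  also have "e \<otimes> b \<oplus> c \<otimes> w \<otimes> c = b" unfolding w(2) unfolding cb using ce(1) b by algebra
  finally have "(e \<oplus> c \<otimes> w) \<otimes> b = b" .
  moreover have "e \<otimes> (c \<otimes> w) = \<zero>" using ec ce w mult_eq_assoc[OF ec(2)] by simp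
  moreover have "c \<otimes> w \<otimes> e = \<zero>" using we ce w by (simp add: m_assoc)
  ultimately show thesis using that[of "c \<otimes> w" w] w(1,4) unfolding cb by blast
qed

text \<open>Iterates \<open>sum_idem\<close>: finitely generated right ideals are principal. The
  coefficients are recorded so that a vector of \<open>g R\<close> can be expanded in the
  \<open>B i\<close>.\<close>

lemma finite_sum_idem:
  assumes "finite I" "\<And>i. i \<in> I \<Longrightarrow> B i \<in> carrier R"
  shows "\<exists>g\<in>idempotents R. (\<forall>i\<in>I. g \<otimes> B i = B i) \<and> (\<exists>r\<in>I \<rightarrow> carrier R. g = (\<Oplus>i\<in>I. B i \<otimes> r i))"
  using assms
proof (induction I rule: finite_induct)
  case empty
  then show ?case by auto
next
  case (insert j I)
  then obtain g r where g: "g \<in> idempotents R" "\<forall>i\<in>I. g \<otimes> B i = B i" "r \<in> I \<rightarrow> carrier R"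
      "g = (\<Oplus>i\<in>I. B i \<otimes> r i)"
    by auto
  have Bj: "B j \<in> carrier R" "\<And>i. i \<in> I \<Longrightarrow> B i \<in> carrier R" using insert by auto
  obtain f t where f: "f \<in> idempotents R" "t \<in> carrier R" "g \<otimes> f = \<zero>" "f \<otimes> g = \<zero>"
    "(g \<oplus> f) \<otimes> B j = B j" "f = (B j \<ominus> g \<otimes> B j) \<otimes> t"
    using sum_idem[OF g(1) Bj(1)] by metis
  \<comment> \<open>Read off from \<open>g + f = g (1 - B j t) + B j t\<close>, which expands
    \<open>f = (B j - g B j) t\<close>.\<close>
  define r' where "r' i = (if i = j then t else r i \<ominus> r i \<otimes> (B j \<otimes> t))" for i
  have r: "\<And>i. i \<in> I \<Longrightarrow> r i \<in> carrier R" using g(3) by auto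
  have r': "r' \<in> insert j I \<rightarrow> carrier R" using f(2) Bj r by (auto simp: r'_def)
  have "(\<Oplus>i\<in>insert j I. B i \<otimes> r' i) = B j \<otimes> t \<oplus> (\<Oplus>i\<in>I. B i \<otimes> r' i)"
    using insert r r' Bj by (subst finsum_insert) (auto simp: r'_def)
  also have "(\<Oplus>i\<in>I. B i \<otimes> r' i) = (\<Oplus>i\<in>I. (B i \<otimes> r i) \<otimes> (\<one> \<ominus> B j \<otimes> t))"
    using insert r Bj f(2) by (intro finsum_cong') (auto simp: r'_def r_minus_distr m_assoc)
  also have "\<dots> = (\<Oplus>i\<in>I. B i \<otimes> r i) \<otimes> (\<one> \<ominus> B j \<otimes> t)"
    using insert r Bj f(2) by (subst finsum_ldistr) (auto simp: Pi_def)
  also have "\<dots> = g \<otimes> (\<one> \<ominus> B j \<otimes> t)" unfolding g(4)[symmetric] ..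
  also have "B j \<otimes> t \<oplus> g \<otimes> (\<one> \<ominus> B j \<otimes> t) = g \<oplus> f"
    unfolding f(6) using idemD(1)[OF g(1)] r_one[OF idemD(1)[OF g(1)]] Bj(1) f(2) by algebra
  finally have sum: "g \<oplus> f = (\<Oplus>i\<in>insert j I. B i \<otimes> r' i)" by simp
  have "(g \<oplus> f) \<otimes> B i = B i" if "i \<in> I" for i
  proof -
    have "(g \<oplus> f) \<otimes> B i = (g \<oplus> f) \<otimes> (g \<otimes> B i)" using g that by auto
    also have "\<dots> = ((g \<oplus> f) \<otimes> g) \<otimes> B i" using g f Bj that by (simp add: m_assoc)
    also have "(g \<oplus> f) \<otimes> g = g" using g f by (simp add: l_distr idemD)
    finally show ?thesis using g that by auto
  qed
  moreover have "g \<oplus> f \<in> idempotents R" using idem_plus[OF g(1) f(1) f(3) f(4)] .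
  ultimately show ?case using f(5) sum r' by (intro bexI[of _ "g \<oplus> f"]) auto
qed

end

section \<open>The lattice of principal right ideals\<close>

context von_neumann_regular
begin

text \<open>For an idempotent \<open>e\<close> this is \<open>e R\<close>; the fixed-point form
  turns membership and inclusion into equations.\<close>

definition fixed_set :: "'a \<Rightarrow> 'a set" where
  "fixed_set e = {y \<in> carrier R. e \<otimes> y = y}"

lemma fixed_set_coset: "e \<in> idempotents R \<Longrightarrow> fixed_set e = e <# carrier R"
  unfolding fixed_set_def l_coset_def using mult_eq_assoc[OF idemD(2)] by force

lemma principal_right_ideals_eq: "principal_right_ideals R = fixed_set ` idempotents R"
proof (intro equalityI subsetI)
  fix P assume "P \<in> principal_right_ideals R"
  then obtain a where a: "a \<in> carrier R" "P = a <# carrier R"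
    by (auto simp: principal_right_ideals_def)
  obtain w where w: "w \<in> carrier R" "a \<otimes> w \<otimes> a = a" "a \<otimes> w \<in> idempotents R"
    using quasi_inverse'[OF a(1)] by metis
  have "y \<in> fixed_set (a \<otimes> w) \<longleftrightarrow> (\<exists>x\<in>carrier R. y = a \<otimes> x)" for y
  proof
    assume "y \<in> fixed_set (a \<otimes> w)"
    then have "y \<in> carrier R" "y = a \<otimes> (w \<otimes> y)"
      using a w by (auto simp: fixed_set_def m_assoc)
    then show "\<exists>x\<in>carrier R. y = a \<otimes> x" using w(1) by blast
  next
    assume "\<exists>x\<in>carrier R. y = a \<otimes> x"
    then show "y \<in> fixed_set (a \<otimes> w)"
      using a w mult_eq_assoc[OF w(2)] by (auto simp: fixed_set_def)
  qed
  then have "P = fixed_set (a \<otimes> w)" by (auto simp: a(2) l_coset_def)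
  then show "P \<in> fixed_set ` idempotents R" using w(3) by blast
next
  fix P assume "P \<in> fixed_set ` idempotents R"
  then show "P \<in> principal_right_ideals R"
    unfolding principal_right_ideals_def using fixed_set_coset by blast
qed

lemma fixed_set_subset_iff:
  assumes "e \<in> idempotents R" "f \<in> idempotents R"
  shows "fixed_set e \<subseteq> fixed_set f \<longleftrightarrow> f \<otimes> e = e"
proof
  assume "fixed_set e \<subseteq> fixed_set f"
  moreover have "e \<in> fixed_set e" using assms by (auto simp: fixed_set_def idemD)
  ultimately show "f \<otimes> e = e" by (auto simp: fixed_set_def)
next
  assume fe: "f \<otimes> e = e"
  show "fixed_set e \<subseteq> fixed_set f"
  proof
    fix y assume y: "y \<in> fixed_set e"
    then have "f \<otimes> y = y" using mult_eq_assoc[OF fe, of y] assms by (simp add: fixed_set_def)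
    then show "y \<in> fixed_set f" using y by (auto simp: fixed_set_def)
  qed
qed

text \<open>With \<open>w\<close> an inner inverse of \<open>x\<close>, the idempotent
  \<open>1 - w x\<close> generates the right annihilator.\<close>

lemma annihilator_single:
  assumes "x \<in> carrier R"
  obtains f where "f \<in> idempotents R" "\<And>y. y \<in> carrier R \<Longrightarrow> f \<otimes> y = y \<longleftrightarrow> x \<otimes> y = \<zero>"
proof -
  obtain w where w: "w \<in> carrier R" "x \<otimes> w \<otimes> x = x" "w \<otimes> x \<in> idempotents R"
    using quasi_inverse'[OF assms] by metis
  have "(\<one> \<ominus> w \<otimes> x) \<otimes> y = y \<longleftrightarrow> x \<otimes> y = \<zero>" if y: "y \<in> carrier R" for y
  proof
    assume "(\<one> \<ominus> w \<otimes> x) \<otimes> y = y"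
    then have "x \<otimes> y = x \<otimes> ((\<one> \<ominus> w \<otimes> x) \<otimes> y)" by simp
    also have "\<dots> = (x \<ominus> x \<otimes> w \<otimes> x) \<otimes> y"
      using assms w(1) y by (simp add: r_minus_distr l_minus_distr m_assoc)
    finally show "x \<otimes> y = \<zero>" using w(2) assms y by simp
  next
    assume "x \<otimes> y = \<zero>"
    then show "(\<one> \<ominus> w \<otimes> x) \<otimes> y = y"
      using assms w(1) y by (simp add: l_minus_distr m_assoc)
  qed
  then show thesis using that idem_compl[OF w(3)] by blast
qed

end

section \<open>Annihilators, joins and meets in a continuous ring\<close>

locale continuous_regular_ring = von_neumann_regular +
  assumes continuous: "continuous_ring R"
begin

sublocale L: complete_lattice "ideal_lattice R"
  rewrites "carrier (ideal_lattice R) = fixed_set ` idempotents R"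
    and "(.=\<^bsub>ideal_lattice R\<^esub>) = (=)"
    and "le (ideal_lattice R) = (\<subseteq>)"
  using continuous
  by (auto simp: continuous_ring_def ideal_lattice_def principal_right_ideals_eq)

text \<open>Completeness of the lattice makes right annihilators of arbitrary sets principal: take
  the meet of the annihilators of the single elements.\<close>

lemma annihilator_idem:
  assumes B: "B \<subseteq> carrier R"
  obtains f where "f \<in> idempotents R"
    "\<And>y. y \<in> carrier R \<Longrightarrow> f \<otimes> y = y \<longleftrightarrow> (\<forall>x\<in>B. x \<otimes> y = \<zero>)"
proof -
  have "\<forall>x\<in>B. \<exists>f\<in>idempotents R. \<forall>y\<in>carrier R. f \<otimes> y = y \<longleftrightarrow> x \<otimes> y = \<zero>"
    using B annihilator_single by (metis subsetD)
  then obtain F where F: "\<And>x. x \<in> B \<Longrightarrow> F x \<in> idempotents R"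
    "\<And>x y. x \<in> B \<Longrightarrow> y \<in> carrier R \<Longrightarrow> F x \<otimes> y = y \<longleftrightarrow> x \<otimes> y = \<zero>"
    by metis
  define A where "A = (\<lambda>x. fixed_set (F x)) ` B"
  have A: "A \<subseteq> fixed_set ` idempotents R" using F(1) by (auto simp: A_def)
  have "\<Sqinter>\<^bsub>ideal_lattice R\<^esub> A \<in> fixed_set ` idempotents R"
    using L.inf_closed[OF A] .
  then obtain f where f: "f \<in> idempotents R" "\<Sqinter>\<^bsub>ideal_lattice R\<^esub> A = fixed_set f" by auto
  have "f \<otimes> y = y \<longleftrightarrow> (\<forall>x\<in>B. x \<otimes> y = \<zero>)" if y: "y \<in> carrier R" for y
  proof
    assume fy: "f \<otimes> y = y"
    show "\<forall>x\<in>B. x \<otimes> y = \<zero>"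
    proof
      fix x assume x: "x \<in> B"
      have "fixed_set f \<subseteq> fixed_set (F x)"
        using L.inf_lower[OF A, of "fixed_set (F x)"] x f(2) by (auto simp: A_def)
      then show "x \<otimes> y = \<zero>" using fy y F(2)[OF x y] by (auto simp: fixed_set_def)
    qed
  next
    assume ann: "\<forall>x\<in>B. x \<otimes> y = \<zero>"
    \<comment> \<open>A lattice meet is only a greatest lower bound, so membership of
      \<open>y\<close> is obtained by placing the principal right ideal \<open>y R = (y w) R\<close>
      below every member of \<open>A\<close>.\<close>
    obtain w where w: "w \<in> carrier R" "y \<otimes> w \<otimes> y = y" "y \<otimes> w \<in> idempotents R"
      using quasi_inverse'[OF y] by metis
    have "fixed_set (y \<otimes> w) \<subseteq> \<Sqinter>\<^bsub>ideal_lattice R\<^esub> A"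
    proof (rule L.inf_greatest[OF A])
      show "fixed_set (y \<otimes> w) \<in> fixed_set ` idempotents R" using w(3) by blast
      fix P assume "P \<in> A"
      then obtain x where x: "x \<in> B" "P = fixed_set (F x)" by (auto simp: A_def)
      have "x \<otimes> (y \<otimes> w) = \<zero>"
        using mult_eq_assoc[of x y \<zero> w] ann x(1) B y w(1) by auto
      then show "fixed_set (y \<otimes> w) \<subseteq> P"
        using fixed_set_subset_iff[OF w(3) F(1)[OF x(1)]] F(2)[OF x(1)] y w(1) x(2) by simp
    qed
    moreover have "y \<in> fixed_set (y \<otimes> w)" using w(2) y by (auto simp: fixed_set_def)
    ultimately show "f \<otimes> y = y" unfolding f(2) by (auto simp: fixed_set_def)
  qed
  with f(1) that show thesis by blast
qed

text \<open>Only the right ideals are compared, \<open>e e' = e'\<close> meaning that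
  \<open>e' R\<close> is contained in \<open>e R\<close>; the left ideals \<open>R e\<close> may be
  unrelated.\<close>

definition chain_idem :: "'a set \<Rightarrow> bool" where
  "chain_idem A \<longleftrightarrow> A \<subseteq> idempotents R \<and> (\<forall>e\<in>A. \<forall>e'\<in>A. e \<otimes> e' = e' \<or> e' \<otimes> e = e)"

lemma chain_idem_subset_chain:
  assumes "chain_idem A"
  shows "subset.chain (principal_right_ideals R) (fixed_set ` A)"
proof (rule subset.chainI)
  show "fixed_set ` A \<subseteq> principal_right_ideals R"
    using assms by (auto simp: chain_idem_def principal_right_ideals_eq)
  fix P Q assume "P \<in> fixed_set ` A" "Q \<in> fixed_set ` A"
  then obtain e f where ef: "e \<in> A" "f \<in> A" "P = fixed_set e" "Q = fixed_set f" by auto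
  then have "e \<otimes> f = f \<or> f \<otimes> e = e" "e \<in> idempotents R" "f \<in> idempotents R"
    using assms by (auto simp: chain_idem_def)
  then have "P \<subseteq> Q \<or> Q \<subseteq> P"
    using fixed_set_subset_iff ef by auto
  then show "(\<subset>)\<^sup>=\<^sup>= P Q \<or> (\<subset>)\<^sup>=\<^sup>= Q P" by auto
qed

lemma zero_fixed_set: "fixed_set \<zero> = {\<zero>}"
  by (auto simp: fixed_set_def)

lemma one_fixed_set: "fixed_set \<one> = carrier R"
  by (auto simp: fixed_set_def)

lemma right_ideal_span:
  assumes "e \<in> idempotents R" "y \<in> fixed_set e"
  obtains h where "h \<in> idempotents R" "fixed_set h \<subseteq> fixed_set e" "y \<in> fixed_set h"
    "\<And>g. g \<in> idempotents R \<Longrightarrow> y \<in> fixed_set g \<Longrightarrow> fixed_set h \<subseteq> fixed_set g"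
proof -
  have y: "y \<in> carrier R" using assms by (auto simp: fixed_set_def)
  obtain w where w: "w \<in> carrier R" "y \<otimes> w \<otimes> y = y" "y \<otimes> w \<in> idempotents R"
    using quasi_inverse'[OF y] by metis
  have "fixed_set (y \<otimes> w) \<subseteq> fixed_set g" if "g \<in> idempotents R" "y \<in> fixed_set g" for g
    using that y w fixed_set_subset_iff[OF w(3) that(1)] mult_eq_assoc[of g y y w]
    by (auto simp: fixed_set_def)
  moreover have "y \<in> fixed_set (y \<otimes> w)" using w y by (auto simp: fixed_set_def)
  ultimately show thesis using that w(3) assms by blast
qed

text \<open>The last clause is upper continuity: joining a chain preserves trivial intersection with a
  fixed right ideal.\<close>

definition is_join :: "'a set \<Rightarrow> 'a \<Rightarrow> bool" where
  "is_join A f \<longleftrightarrow> f \<in> idempotents R \<and> (\<forall>e\<in>A. f \<otimes> e = e) \<and>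
     (\<forall>x\<in>carrier R. (\<forall>e\<in>A. x \<otimes> e = \<zero>) \<longrightarrow> x \<otimes> f = \<zero>) \<and>
     (chain_idem A \<longrightarrow> (\<forall>g\<in>idempotents R.
       (\<forall>e\<in>A. \<forall>y\<in>carrier R. e \<otimes> y = y \<longrightarrow> g \<otimes> y = y \<longrightarrow> y = \<zero>) \<longrightarrow>
       (\<forall>y\<in>carrier R. f \<otimes> y = y \<longrightarrow> g \<otimes> y = y \<longrightarrow> y = \<zero>)))"

text \<open>The annihilator clause of \<open>is_join\<close> is leastness of the supremum, tested on
  the principal right annihilator of \<open>x\<close>; it allows identities on \<open>f R\<close> to
  be checked on \<open>A\<close>.\<close>

lemma join_exists:
  assumes A: "A \<subseteq> idempotents R"
  shows "\<exists>f. is_join A f"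
proof -
  let ?J = "\<Squnion>\<^bsub>ideal_lattice R\<^esub> (fixed_set ` A)"
  have A': "fixed_set ` A \<subseteq> fixed_set ` idempotents R" using A by auto
  have "?J \<in> fixed_set ` idempotents R" using L.sup_closed[OF A'] .
  then obtain f where f: "f \<in> idempotents R" "?J = fixed_set f" by auto
  have "is_join A f"
    unfolding is_join_def
  proof (intro conjI f(1) ballI impI)
    fix e assume "e \<in> A"
    then show "f \<otimes> e = e"
      using L.sup_upper[OF A', of "fixed_set e"] fixed_set_subset_iff[of e f] A f by auto
  next
    fix x assume x: "x \<in> carrier R" "\<forall>e\<in>A. x \<otimes> e = \<zero>"
    obtain g where g: "g \<in> idempotents R"
        "\<And>y. y \<in> carrier R \<Longrightarrow> g \<otimes> y = y \<longleftrightarrow> x \<otimes> y = \<zero>"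
      using annihilator_single[OF x(1)] by metis
    have "?J \<subseteq> fixed_set g"
    proof (rule L.sup_least[OF A'])
      show "fixed_set g \<in> fixed_set ` idempotents R" using g by blast
      fix P assume "P \<in> fixed_set ` A"
      then obtain e where e: "e \<in> A" "P = fixed_set e" by auto
      then have "g \<otimes> e = e" using g(2)[of e] x(2) A by auto
      then show "P \<subseteq> fixed_set g" using fixed_set_subset_iff[of e g] e A g by auto
    qed
    then have "g \<otimes> f = f" using fixed_set_subset_iff f g by auto
    then show "x \<otimes> f = \<zero>" using g f by auto
  next
    fix g y assume ch: "chain_idem A" and g: "g \<in> idempotents R"
      and triv: "\<forall>e\<in>A. \<forall>y\<in>carrier R. e \<otimes> y = y \<longrightarrow> g \<otimes> y = y \<longrightarrow> y = \<zero>"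
      and y: "y \<in> carrier R" "f \<otimes> y = y" "g \<otimes> y = y"
    have gP: "fixed_set g \<in> fixed_set ` idempotents R" using g by auto
    have "fixed_set g \<sqinter>\<^bsub>ideal_lattice R\<^esub> J \<subseteq> {\<zero>}" if J: "J \<in> fixed_set ` A" for J
    proof -
      have J': "J \<in> fixed_set ` idempotents R" using J A by auto
      have "fixed_set g \<inter> J \<subseteq> {\<zero>}" using triv J by (auto simp: fixed_set_def)
      then show ?thesis using L.meet_left[OF gP J'] L.meet_right[OF gP J'] by blast
    qed
    then have "\<Squnion>\<^bsub>ideal_lattice R\<^esub> ((\<lambda>J. fixed_set g \<sqinter>\<^bsub>ideal_lattice R\<^esub> J) ` (fixed_set ` A)) \<subseteq> {\<zero>}"
    proof (intro L.sup_least image_subsetI)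
      show "fixed_set g \<sqinter>\<^bsub>ideal_lattice R\<^esub> J \<in> fixed_set ` idempotents R"
        if "J \<in> fixed_set ` A" for J
        using L.meet_closed[OF gP, of J] A' that by blast
      show "{\<zero>} \<in> fixed_set ` idempotents R"
        using zero_fixed_set by (metis imageI zero_idem)
    qed auto
    moreover have "fixed_set g \<sqinter>\<^bsub>ideal_lattice R\<^esub> ?J =
        \<Squnion>\<^bsub>ideal_lattice R\<^esub> ((\<lambda>J. fixed_set g \<sqinter>\<^bsub>ideal_lattice R\<^esub> J) ` (fixed_set ` A))"
      using continuous chain_idem_subset_chain[OF ch] gP
      unfolding continuous_ring_def principal_right_ideals_eq by blast
    ultimately have le: "fixed_set g \<sqinter>\<^bsub>ideal_lattice R\<^esub> fixed_set f \<subseteq> {\<zero>}"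
      using f(2) by simp
    have yg: "y \<in> fixed_set g" "y \<in> fixed_set f" using y by (auto simp: fixed_set_def)
    \<comment> \<open>The lattice meet has not been identified with the intersection, so
      \<open>y\<close> is reached through the principal right ideal that it generates.\<close>
    obtain h where h: "h \<in> idempotents R" "fixed_set h \<subseteq> fixed_set g" "y \<in> fixed_set h"
        "fixed_set h \<subseteq> fixed_set f"
      using right_ideal_span[OF g yg(1)] f(1) yg(2) by metis
    have "fixed_set h \<subseteq> fixed_set g \<sqinter>\<^bsub>ideal_lattice R\<^esub> fixed_set f"
      using h g f by (intro L.meet_le) auto
    then show "y = \<zero>" using le h(3) by auto
  qed
  then show ?thesis by blast
qed

text \<open>The last clause is lower continuity, dual to the last clause of \<open>is_join\<close>;
  that two right ideals together span \<open>R\<close> is expressed by a decomposition of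
  \<open>\<one>\<close>.\<close>

definition is_meet :: "'a set \<Rightarrow> 'a \<Rightarrow> bool" where
  "is_meet A m \<longleftrightarrow> m \<in> idempotents R \<and>
     (\<forall>y\<in>carrier R. m \<otimes> y = y \<longleftrightarrow> (\<forall>e\<in>A. e \<otimes> y = y)) \<and>
     (chain_idem A \<longrightarrow> (\<forall>g\<in>idempotents R.
       (\<forall>e\<in>A. \<exists>s\<in>carrier R. \<exists>t\<in>carrier R. g \<otimes> s \<oplus> e \<otimes> t = \<one>) \<longrightarrow>
       (\<exists>s\<in>carrier R. \<exists>t\<in>carrier R. g \<otimes> s \<oplus> m \<otimes> t = \<one>)))"

lemma meet_exists:
  assumes A: "A \<subseteq> idempotents R"
  shows "\<exists>m. is_meet A m"
proof -
  let ?M = "\<Sqinter>\<^bsub>ideal_lattice R\<^esub> (fixed_set ` A)"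
  have A': "fixed_set ` A \<subseteq> fixed_set ` idempotents R" using A by auto
  have "?M \<in> fixed_set ` idempotents R" using L.inf_closed[OF A'] .
  then obtain m where m: "m \<in> idempotents R" "?M = fixed_set m" by auto
  have "is_meet A m"
    unfolding is_meet_def
  proof (intro conjI m(1) ballI impI)
    fix y assume y: "y \<in> carrier R"
    show "m \<otimes> y = y \<longleftrightarrow> (\<forall>e\<in>A. e \<otimes> y = y)"
    proof
      assume "m \<otimes> y = y"
      then have "y \<in> ?M" using y m(2) by (auto simp: fixed_set_def)
      then show "\<forall>e\<in>A. e \<otimes> y = y"
        using L.inf_lower[OF A'] by (auto simp: fixed_set_def)
    next
      assume "\<forall>e\<in>A. e \<otimes> y = y"
      then have ye: "\<And>e. e \<in> A \<Longrightarrow> y \<in> fixed_set e" using y by (auto simp: fixed_set_def)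
      obtain h where h: "h \<in> idempotents R" "y \<in> fixed_set h"
          "\<And>g. g \<in> idempotents R \<Longrightarrow> y \<in> fixed_set g \<Longrightarrow> fixed_set h \<subseteq> fixed_set g"
        using right_ideal_span[OF one_idem, of y] y one_fixed_set by metis
      have "fixed_set h \<subseteq> ?M"
        using h ye A by (intro L.inf_greatest[OF A']) auto
      then show "m \<otimes> y = y" using h(2) m(2) by (auto simp: fixed_set_def)
    qed
  next
    fix g assume ch: "chain_idem A" and g: "g \<in> idempotents R"
      and cov: "\<forall>e\<in>A. \<exists>s\<in>carrier R. \<exists>t\<in>carrier R. g \<otimes> s \<oplus> e \<otimes> t = \<one>"
    have gP: "fixed_set g \<in> fixed_set ` idempotents R" using g by auto
    have top: "fixed_set h = carrier R"
      if hyps: "fixed_set g \<subseteq> fixed_set h" "fixed_set e \<subseteq> fixed_set h" "e \<in> A" "h \<in> idempotents R" for e h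
    proof -
      obtain s t where st: "s \<in> carrier R" "t \<in> carrier R" "g \<otimes> s \<oplus> e \<otimes> t = \<one>" using cov hyps(3) by blast
      have e: "e \<in> idempotents R" using that A by auto
      have he: "h \<otimes> g = g" "h \<otimes> e = e"
        using fixed_set_subset_iff[OF g that(4)] fixed_set_subset_iff[OF e that(4)] that(1,2) by auto
      have "h = h \<otimes> (g \<otimes> s \<oplus> e \<otimes> t)" unfolding st(3) using hyps(4) by simp
      also have "\<dots> = g \<otimes> s \<oplus> e \<otimes> t"
        using mult_eq_assoc[OF he(1)] mult_eq_assoc[OF he(2)] st(1,2) hyps(4) g e
        by (simp add: r_distr del: st(3))
      finally have "h = \<one>" unfolding st(3) .
      then show ?thesis using one_fixed_set by simp
    qed
    have "carrier R \<subseteq> fixed_set g \<squnion>\<^bsub>ideal_lattice R\<^esub> J" if J: "J \<in> fixed_set ` A" for J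
    proof -
      have J': "J \<in> fixed_set ` idempotents R" using J A by auto
      have "fixed_set g \<squnion>\<^bsub>ideal_lattice R\<^esub> J \<in> fixed_set ` idempotents R"
        using L.join_closed[OF gP J'] .
      then obtain h where h: "h \<in> idempotents R" "fixed_set g \<squnion>\<^bsub>ideal_lattice R\<^esub> J = fixed_set h" by auto
      then show ?thesis
        using L.join_left[OF gP J'] L.join_right[OF gP J'] J top by auto
    qed
    then have "carrier R \<subseteq> \<Sqinter>\<^bsub>ideal_lattice R\<^esub> ((\<lambda>J. fixed_set g \<squnion>\<^bsub>ideal_lattice R\<^esub> J) ` (fixed_set ` A))"
    proof (intro L.inf_greatest image_subsetI)
      show "fixed_set g \<squnion>\<^bsub>ideal_lattice R\<^esub> J \<in> fixed_set ` idempotents R"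
        if "J \<in> fixed_set ` A" for J
        using L.join_closed[OF gP, of J] A' that by blast
      show "carrier R \<in> fixed_set ` idempotents R"
        using one_fixed_set by (metis imageI one_idem)
    qed auto
    moreover have "fixed_set g \<squnion>\<^bsub>ideal_lattice R\<^esub> ?M =
        \<Sqinter>\<^bsub>ideal_lattice R\<^esub> ((\<lambda>J. fixed_set g \<squnion>\<^bsub>ideal_lattice R\<^esub> J) ` (fixed_set ` A))"
      using continuous chain_idem_subset_chain[OF ch] gP
      unfolding continuous_ring_def principal_right_ideals_eq by blast
    ultimately have le: "carrier R \<subseteq> fixed_set g \<squnion>\<^bsub>ideal_lattice R\<^esub> fixed_set m"
      using m(2) by simp
    \<comment> \<open>\<open>sum_idem\<close> exhibits \<open>g R + m R\<close> as a principal right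
      ideal, so the lattice join is contained in the algebraic sum and \<open>\<one>\<close> gets an
      explicit decomposition.\<close>
    obtain f t where f: "f \<in> idempotents R" "t \<in> carrier R" "g \<otimes> f = \<zero>" "f \<otimes> g = \<zero>"
      "(g \<oplus> f) \<otimes> m = m" "f = (m \<ominus> g \<otimes> m) \<otimes> t"
      using sum_idem[OF g idem_carrier[OF m(1)]] by metis
    have gf: "g \<oplus> f \<in> idempotents R" using idem_plus[OF g f(1,3,4)] .
    have "(g \<oplus> f) \<otimes> g = g" using f g by (simp add: l_distr idemD)
    then have "fixed_set g \<squnion>\<^bsub>ideal_lattice R\<^esub> fixed_set m \<subseteq> fixed_set (g \<oplus> f)"
      using gf g m f(5) by (intro L.join_le) (auto simp: fixed_set_subset_iff)
    then have "\<one> \<in> fixed_set (g \<oplus> f)" using le by auto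
    then have "\<one> = g \<oplus> f" using gf by (auto simp: fixed_set_def)
    also have "g \<oplus> f = g \<otimes> (\<one> \<ominus> m \<otimes> t) \<oplus> m \<otimes> t"
      unfolding f(6) using idemD(1)[OF g] r_one[OF idemD(1)[OF g]] idemD(1)[OF m(1)] f(2) by algebra
    finally show "\<exists>s\<in>carrier R. \<exists>t\<in>carrier R. g \<otimes> s \<oplus> m \<otimes> t = \<one>"
      using m g f(2) by (intro bexI[of _ "\<one> \<ominus> m \<otimes> t"] bexI[of _ t]) auto
  qed
  then show ?thesis by blast
qed

end

section \<open>Irreducibility\<close>

text \<open>For a central idempotent \<open>e\<close> this is the ring \<open>e R\<close>. The
  extension field of the scheme is dropped because \<open>irreducible_ring\<close> quantifies over
  factors of type \<open>'a ring\<close>.\<close>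

definition summand_ring :: "('a, 'm) ring_scheme \<Rightarrow> 'a \<Rightarrow> 'a ring" where
  "summand_ring R e = \<lparr>carrier = {y \<in> carrier R. e \<otimes>\<^bsub>R\<^esub> y = y}, monoid.mult = monoid.mult R, one = e,
     ring.zero = \<zero>\<^bsub>R\<^esub>, ring.add = ring.add R\<rparr>"

lemma (in ring) summand_ring_ring:
  assumes e: "e \<in> idempotents R" and c: "\<And>x. x \<in> carrier R \<Longrightarrow> e \<otimes> x = x \<otimes> e"
  shows "ring (summand_ring R e)"
proof (rule ringI)
  have neg: "e \<otimes> (\<ominus> x) = \<ominus> x" if "x \<in> carrier R" "e \<otimes> x = x" for x
    using that e by (simp add: r_minus)
  show "abelian_group (summand_ring R e)"
  proof (rule abelian_groupI)
    fix x assume "x \<in> carrier (summand_ring R e)"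
    then show "\<exists>y\<in>carrier (summand_ring R e). y \<oplus>\<^bsub>summand_ring R e\<^esub> x = \<zero>\<^bsub>summand_ring R e\<^esub>"
      using neg by (intro bexI[of _ "\<ominus> x"]) (auto simp: summand_ring_def l_neg)
  next
    fix x y assume "x \<in> carrier (summand_ring R e)" "y \<in> carrier (summand_ring R e)"
    then show "x \<oplus>\<^bsub>summand_ring R e\<^esub> y = y \<oplus>\<^bsub>summand_ring R e\<^esub> x"
      using a_comm by (auto simp: summand_ring_def)
  qed (use e in \<open>auto simp: summand_ring_def r_distr a_assoc\<close>)
  have "x \<otimes> e = x" if "x \<in> carrier R" "e \<otimes> x = x" for x
    using c[OF that(1)] that by simp
  then show "monoid (summand_ring R e)"
    using idem_carrier[OF e] idemD(2)[OF e] mult_eq_assoc[of e]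
    by (intro monoidI) (simp_all add: summand_ring_def m_assoc)
qed (auto simp: summand_ring_def l_distr r_distr)

text \<open>A central idempotent splits \<open>R\<close> as the product of \<open>e R\<close> and
  \<open>(1 - e) R\<close>, with addition as the inverse of the two projections; irreducibility
  makes one factor zero.\<close>

lemma (in ring) central_idem_trivial:
  assumes irr: "irreducible_ring R" and e: "e \<in> idempotents R"
    and c: "\<And>x. x \<in> carrier R \<Longrightarrow> e \<otimes> x = x \<otimes> e"
  shows "e = \<zero> \<or> e = \<one>"
proof (rule ccontr)
  assume ne: "\<not> (e = \<zero> \<or> e = \<one>)"
  define f where "f = \<one> \<ominus> e"
  have f: "f \<in> idempotents R" and cf: "f \<otimes> x = x \<otimes> f" if "x \<in> carrier R" for x
    using idem_compl[OF e] that e c by (auto simp: f_def l_minus_distr r_minus_distr)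
  note f = f[OF one_closed]
  have ec: "e \<in> carrier R" "f \<in> carrier R" using e f by auto
  have ef: "e \<otimes> f = \<zero>" "f \<otimes> e = \<zero>" "e \<oplus> f = \<one>"
    using e by (auto simp: f_def r_minus_distr l_minus_distr idemD) (use ec in algebra)
  have "f \<noteq> \<zero>" using ne ef(3) ec by auto
  let ?S = "summand_ring R e" and ?T = "summand_ring R f"
  have "ring ?S" "ring ?T" using summand_ring_ring e f c cf by auto
  moreover have "carrier ?S \<noteq> {\<zero>\<^bsub>?S\<^esub>}" "carrier ?T \<noteq> {\<zero>\<^bsub>?T\<^esub>}"
    using ne \<open>f \<noteq> \<zero>\<close> e f idemD by (auto simp: summand_ring_def)
  moreover have "(\<lambda>x. (e \<otimes> x, f \<otimes> x)) \<in> ring_iso R (RDirProd ?S ?T)"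
  proof -
    have ee: "e \<otimes> (e \<otimes> x) = e \<otimes> x" "f \<otimes> (f \<otimes> x) = f \<otimes> x"
      "e \<otimes> (f \<otimes> x) = \<zero>" "f \<otimes> (e \<otimes> x) = \<zero>" if "x \<in> carrier R" for x
      using mult_eq_assoc[OF idemD(2)[OF e]] mult_eq_assoc[OF idemD(2)[OF f]]
        mult_eq_assoc[OF ef(1)] mult_eq_assoc[OF ef(2)] ec that by auto
    have mm: "e \<otimes> (x \<otimes> y) = e \<otimes> x \<otimes> (e \<otimes> y)" "f \<otimes> (x \<otimes> y) = f \<otimes> x \<otimes> (f \<otimes> y)"
      if "x \<in> carrier R" "y \<in> carrier R" for x y
    proof -
      have "e \<otimes> x \<otimes> (e \<otimes> y) = e \<otimes> (x \<otimes> e) \<otimes> y" using that ec by (simp add: m_assoc)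
      also have "\<dots> = e \<otimes> (e \<otimes> x) \<otimes> y" using c that by simp
      finally show "e \<otimes> (x \<otimes> y) = e \<otimes> x \<otimes> (e \<otimes> y)" using ee that ec by (simp add: m_assoc)
      have "f \<otimes> x \<otimes> (f \<otimes> y) = f \<otimes> (x \<otimes> f) \<otimes> y" using that ec by (simp add: m_assoc)
      also have "\<dots> = f \<otimes> (f \<otimes> x) \<otimes> y" using cf that by simp
      finally show "f \<otimes> (x \<otimes> y) = f \<otimes> x \<otimes> (f \<otimes> y)" using ee that ec by (simp add: m_assoc)
    qed
    have sum: "e \<otimes> x \<oplus> f \<otimes> x = x" if "x \<in> carrier R" for x
      using that ec ef(3) by (simp add: l_distr[symmetric])
    have "(\<lambda>x. (e \<otimes> x, f \<otimes> x)) \<in> ring_hom R (RDirProd ?S ?T)"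
      using ec ee mm by (intro ring_hom_memI)
        (auto simp: RDirProd_def DirProd_def monoid.defs summand_ring_def r_distr)
    moreover have "bij_betw (\<lambda>x. (e \<otimes> x, f \<otimes> x)) (carrier R) (carrier (RDirProd ?S ?T))"
    proof (rule bij_betwI[where g = "\<lambda>(x, y). x \<oplus> y"])
      show "(\<lambda>x. (e \<otimes> x, f \<otimes> x)) \<in> carrier R \<rightarrow> carrier (RDirProd ?S ?T)"
        using ec ee by (auto simp: RDirProd_carrier summand_ring_def)
      show "(\<lambda>(x, y). x \<oplus> y) \<in> carrier (RDirProd ?S ?T) \<rightarrow> carrier R"
        by (auto simp: RDirProd_carrier summand_ring_def)
      show "(\<lambda>(x, y). x \<oplus> y) (e \<otimes> x, f \<otimes> x) = x" if "x \<in> carrier R" for x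
        using sum that by simp
      fix p assume "p \<in> carrier (RDirProd ?S ?T)"
      then obtain x y where p: "p = (x, y)" "x \<in> carrier R" "y \<in> carrier R" "e \<otimes> x = x" "f \<otimes> y = y"
        by (auto simp: RDirProd_carrier summand_ring_def)
      have "e \<otimes> y = \<zero>" "f \<otimes> x = \<zero>" using ee(3)[OF p(3)] ee(4)[OF p(2)] p by auto
      then show "(\<lambda>x. (e \<otimes> x, f \<otimes> x)) ((\<lambda>(x, y). x \<oplus> y) p) = p"
        using p ec by (auto simp: r_distr)
    qed
    ultimately show ?thesis by (auto simp: ring_iso_def)
  qed
  then have "R \<simeq> RDirProd ?S ?T" by (auto simp: is_ring_iso_def)
  ultimately show False using irr unfolding irreducible_ring_def by blast
qed

locale irreducible_continuous_ring = continuous_regular_ring +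
  assumes irreducible: "irreducible_ring R"
begin

text \<open>The right annihilator of \<open>x R\<close> is a two-sided ideal \<open>f R\<close>. A
  regular ring has no non-zero \<open>z\<close> with \<open>z R z = 0\<close>, so
  \<open>f r (1 - f)\<close> vanishes and \<open>f\<close> is central, hence \<open>0\<close> or
  \<open>1\<close>.\<close>

lemma prime:
  assumes x: "x \<in> carrier R" "x \<noteq> \<zero>" and y: "y \<in> carrier R" "y \<noteq> \<zero>"
  obtains r where "r \<in> carrier R" "x \<otimes> r \<otimes> y \<noteq> \<zero>"
proof (rule ccontr)
  assume no: "\<not> thesis"
  have zero: "\<forall>r\<in>carrier R. x \<otimes> r \<otimes> y = \<zero>" using no that by blast
  have "(\<lambda>r. x \<otimes> r) ` carrier R \<subseteq> carrier R" using x by auto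
  then obtain f where f: "f \<in> idempotents R"
    "\<And>z. z \<in> carrier R \<Longrightarrow> f \<otimes> z = z \<longleftrightarrow> (\<forall>u\<in>(\<lambda>r. x \<otimes> r) ` carrier R. u \<otimes> z = \<zero>)"
    using annihilator_idem by metis
  have fc: "f \<in> carrier R" using f by auto
  have xf: "x \<otimes> r \<otimes> f = \<zero>" if "r \<in> carrier R" for r
    using f(2)[OF fc] idemD(2)[OF f(1)] that by auto
  have frf: "f \<otimes> (r \<otimes> f) = r \<otimes> f" if r: "r \<in> carrier R" for r
  proof -
    have "x \<otimes> u \<otimes> (r \<otimes> f) = \<zero>" if "u \<in> carrier R" for u
      using xf[of "u \<otimes> r"] r fc x that by (simp add: m_assoc)
    then show ?thesis using f(2)[of "r \<otimes> f"] r fc by auto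
  qed
  have "f \<otimes> r = r \<otimes> f" if r: "r \<in> carrier R" for r
  proof -
    define z where "z = f \<otimes> r \<otimes> (\<one> \<ominus> f)"
    have z: "z \<in> carrier R" using r fc by (auto simp: z_def)
    obtain s where s: "s \<in> carrier R" "z \<otimes> s \<otimes> z = z" using regular[OF z] by blast
    have "(\<one> \<ominus> f) \<otimes> (s \<otimes> f) = \<zero>" using frf[OF s(1)] fc s(1) by (simp add: l_minus_distr)
    then have "(\<one> \<ominus> f) \<otimes> (s \<otimes> (f \<otimes> t)) = \<zero>" if "t \<in> carrier R" for t
      using mult_eq_assoc[of "\<one> \<ominus> f" "s \<otimes> f" \<zero> t] fc s(1) that by (simp add: m_assoc)
    then have "z \<otimes> s \<otimes> z = \<zero>" using fc r s(1) by (simp add: z_def m_assoc)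
    then have "z = \<zero>" using s by simp
    then have "f \<otimes> r = f \<otimes> r \<otimes> f" using fc r by (simp add: z_def r_minus_distr)
    then show ?thesis using frf[OF r] fc r by (simp add: m_assoc)
  qed
  then have "f = \<zero> \<or> f = \<one>" using central_idem_trivial[OF irreducible f(1)] by blast
  then show False
  proof
    assume "f = \<zero>"
    then show False using f(2)[OF y(1)] zero y by auto
  next
    assume "f = \<one>"
    then show False using xf[OF one_closed] x by simp
  qed
qed

end

section \<open>Rank functions\<close>

locale rank_ring = von_neumann_regular +
  fixes rk :: "'a \<Rightarrow> real"
  assumes rank: "rank_function R rk"
begin

lemma rk_nonneg: "x \<in> carrier R \<Longrightarrow> 0 \<le> rk x"
  and rk_le_one: "x \<in> carrier R \<Longrightarrow> rk x \<le> 1"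
  using rank by (auto simp: rank_function_def Pi_def)

lemma rk_one: "rk \<one> = 1"
  using rank by (simp add: rank_function_def)

lemma rk_mult_left: "x \<in> carrier R \<Longrightarrow> y \<in> carrier R \<Longrightarrow> rk (x \<otimes> y) \<le> rk x"
  and rk_mult_right: "x \<in> carrier R \<Longrightarrow> y \<in> carrier R \<Longrightarrow> rk (x \<otimes> y) \<le> rk y"
  using rank by (auto simp: rank_function_def)

lemma rk_idem_plus:
  "e \<in> idempotents R \<Longrightarrow> f \<in> idempotents R \<Longrightarrow> e \<otimes> f = \<zero> \<Longrightarrow> f \<otimes> e = \<zero> \<Longrightarrow> rk (e \<oplus> f) = rk e + rk f"
  using rank by (auto simp: rank_function_def orthogonal_elems_def)

lemma rk_zero [simp]: "rk \<zero> = 0"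
  using rk_idem_plus[of \<zero> \<zero>] by simp

lemma rk_eq_zero_iff: "x \<in> carrier R \<Longrightarrow> rk x = 0 \<longleftrightarrow> x = \<zero>"
  using rank by (auto simp: rank_function_def)

lemma rk_pos: "x \<in> carrier R \<Longrightarrow> x \<noteq> \<zero> \<Longrightarrow> 0 < rk x"
  using rk_nonneg[of x] rk_eq_zero_iff[of x] by linarith

lemma rk_quasi_inverse:
  assumes "x \<in> carrier R" "w \<in> carrier R" "x \<otimes> w \<otimes> x = x"
  shows "rk (x \<otimes> w) = rk x"
  using rk_mult_left[of x w] rk_mult_left[of "x \<otimes> w" x] assms by simp

text \<open>Additivity is postulated only for orthogonal idempotents, so \<open>a\<close> and
  \<open>b\<close> are first covered by such: \<open>e R = a R\<close>, and \<open>f\<close> has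
  rank at most \<open>rk b\<close> because \<open>f = (1 - e) b t\<close>.\<close>

lemma rk_plus_le:
  assumes "a \<in> carrier R" "b \<in> carrier R"
  shows "rk (a \<oplus> b) \<le> rk a + rk b"
proof -
  obtain w where w: "w \<in> carrier R" "a \<otimes> w \<otimes> a = a" "a \<otimes> w \<in> idempotents R"
    using quasi_inverse'[OF assms(1)] by metis
  let ?e = "a \<otimes> w"
  obtain f t where f: "f \<in> idempotents R" "t \<in> carrier R" "?e \<otimes> f = \<zero>" "f \<otimes> ?e = \<zero>"
    "(?e \<oplus> f) \<otimes> b = b" "f = (b \<ominus> ?e \<otimes> b) \<otimes> t"
    using sum_idem[OF w(3) assms(2)] by metis
  have fc: "f \<in> carrier R" using f by auto
  have "f \<otimes> a = f \<otimes> (?e \<otimes> a)" using w by simp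
  also have "\<dots> = \<zero>" using mult_eq_assoc[OF f(4)] assms w(1) fc by simp
  finally have "(?e \<oplus> f) \<otimes> (a \<oplus> b) = a \<oplus> b"
    using f(5) w assms fc by (simp add: r_distr l_distr[of _ _ a])
  then have "rk (a \<oplus> b) \<le> rk (?e \<oplus> f)"
    using rk_mult_left[of "?e \<oplus> f" "a \<oplus> b"] assms w(1) fc by simp
  also have "\<dots> = rk ?e + rk f" using rk_idem_plus[OF w(3) f(1,3,4)] .
  also have "rk ?e \<le> rk a" using rk_mult_left assms w(1) by simp
  also have "rk f \<le> rk b"
  proof -
    have "f = (\<one> \<ominus> ?e) \<otimes> b \<otimes> t" using f(6) assms w(1) by (simp add: l_minus_distr)
    then have "rk f \<le> rk ((\<one> \<ominus> ?e) \<otimes> b)" using rk_mult_left[of "(\<one> \<ominus> ?e) \<otimes> b" t] assms w(1) f(2) by simp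
    also have "\<dots> \<le> rk b" using rk_mult_right assms w(1) by simp
    finally show ?thesis .
  qed
  finally show ?thesis by simp
qed

lemma rk_uminus: "x \<in> carrier R \<Longrightarrow> rk (\<ominus> x) = rk x"
proof -
  have le: "rk (\<ominus> x) \<le> rk x" if "x \<in> carrier R" for x
    using rk_mult_right[of "\<ominus> \<one>" x] that by (simp add: l_minus)
  assume "x \<in> carrier R"
  then show ?thesis using le[of x] le[of "\<ominus> x"] by simp
qed

lemma rk_minus_commute: "a \<in> carrier R \<Longrightarrow> b \<in> carrier R \<Longrightarrow> rk (a \<ominus> b) = rk (b \<ominus> a)"
  using rk_uminus[of "a \<ominus> b"] by (simp add: a_minus_def minus_add a_comm)

text \<open>Quasi-inverses taken inside the two corners have no cross terms, so \<open>x + y\<close>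
  has the rank of the orthogonal sum \<open>x v + y w\<close>.\<close>

lemma rk_orthogonal_plus:
  assumes e: "e \<in> idempotents R" and f: "f \<in> idempotents R" and ef: "e \<otimes> f = \<zero>" "f \<otimes> e = \<zero>"
    and x: "x \<in> carrier R" "e \<otimes> x = x" "x \<otimes> e = x" and y: "y \<in> carrier R" "f \<otimes> y = y" "y \<otimes> f = y"
  shows "rk (x \<oplus> y) = rk x + rk y"
proof -
  have ec: "e \<in> carrier R" "f \<in> carrier R" using e f by auto
  obtain v where v: "v \<in> carrier R" "x \<otimes> v \<otimes> x = x" "v \<otimes> e = v" "e \<otimes> v = v" "x \<otimes> v \<in> idempotents R"
    using quasi_inverse[OF x(1) e e x(2,3)] by metis
  obtain w where w: "w \<in> carrier R" "y \<otimes> w \<otimes> y = y" "w \<otimes> f = w" "f \<otimes> w = w" "y \<otimes> w \<in> idempotents R"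
    using quasi_inverse[OF y(1) f f y(2,3)] by metis
  have zero: "p \<otimes> q = \<zero>"
    if "p \<in> carrier R" "q \<in> carrier R" "g \<in> carrier R" "h \<in> carrier R" "p \<otimes> g = p" "h \<otimes> q = q" "g \<otimes> h = \<zero>" for p q g h
  proof -
    have "p \<otimes> q = p \<otimes> g \<otimes> (h \<otimes> q)" using that by simp
    also have "\<dots> = p \<otimes> (g \<otimes> h) \<otimes> q" using that(1-4) by (simp add: m_assoc)
    finally show ?thesis using that by simp
  qed
  have z: "x \<otimes> w = \<zero>" "y \<otimes> v = \<zero>" "v \<otimes> y = \<zero>" "w \<otimes> x = \<zero>" "v \<otimes> w = \<zero>" "w \<otimes> v = \<zero>" "x \<otimes> y = \<zero>" "y \<otimes> x = \<zero>"
    using zero[OF x(1) w(1) ec x(3) w(4) ef(1)] zero[OF y(1) v(1) ec(2,1) y(3) v(4) ef(2)]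
      zero[OF v(1) y(1) ec v(3) y(2) ef(1)] zero[OF w(1) x(1) ec(2,1) w(3) x(2) ef(2)]
      zero[OF v(1) w(1) ec v(3) w(4) ef(1)] zero[OF w(1) v(1) ec(2,1) w(3) v(4) ef(2)]
      zero[OF x(1) y(1) ec x(3) y(2) ef(1)] zero[OF y(1) x(1) ec(2,1) y(3) x(2) ef(2)] by blast+
  have z': "v \<otimes> (y \<otimes> t) = \<zero>" "w \<otimes> (x \<otimes> t) = \<zero>" if "t \<in> carrier R" for t
    using mult_eq_assoc[OF z(3)] mult_eq_assoc[OF z(4)] that x y v w by auto
  have orth: "(x \<otimes> v) \<otimes> (y \<otimes> w) = \<zero>" "(y \<otimes> w) \<otimes> (x \<otimes> v) = \<zero>"
    using z' x(1) y(1) v(1) w(1) by (simp_all add: m_assoc)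
  have "(x \<otimes> v \<oplus> y \<otimes> w) \<otimes> (x \<oplus> y) = x \<oplus> y"
    using x(1) y(1) v(1,2) w(1,2) z by (simp add: r_distr l_distr m_assoc)
  moreover have "(x \<oplus> y) \<otimes> (v \<oplus> w) = x \<otimes> v \<oplus> y \<otimes> w"
    using x(1) y(1) v(1) w(1) z by (simp add: r_distr l_distr)
  ultimately have "rk (x \<oplus> y) = rk (x \<otimes> v \<oplus> y \<otimes> w)"
    using rk_mult_left[of "x \<otimes> v \<oplus> y \<otimes> w" "x \<oplus> y"] rk_mult_left[of "x \<oplus> y" "v \<oplus> w"] x(1) y(1) v(1) w(1)
    by simp
  also have "\<dots> = rk (x \<otimes> v) + rk (y \<otimes> w)" using rk_idem_plus[OF v(5) w(5) orth] .
  finally show ?thesis using rk_quasi_inverse x(1) y(1) v(1,2) w(1,2) by simp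
qed

text \<open>Applied to \<open>x = c \<otimes> G t\<close> and \<open>e = G s\<close>, this is the
  additivity that makes the final path a geodesic.\<close>

lemma rk_split:
  assumes e: "e \<in> idempotents R" and x: "x \<in> carrier R" "e \<otimes> x = x \<otimes> e"
  shows "rk x = rk (x \<otimes> e) + rk (x \<otimes> (\<one> \<ominus> e))"
proof -
  have ec: "e \<in> carrier R" using e by auto
  have ee: "e \<otimes> e = e" using e by (rule idemD)
  have xe: "e \<otimes> (x \<otimes> t) = x \<otimes> (e \<otimes> t)" if "t \<in> carrier R" for t
    using mult_eq_assoc[OF x(2)] x(1) ec that by (simp add: m_assoc)
  have "rk (x \<otimes> e \<oplus> x \<otimes> (\<one> \<ominus> e)) = rk (x \<otimes> e) + rk (x \<otimes> (\<one> \<ominus> e))"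
    by (rule rk_orthogonal_plus[OF e idem_compl[OF e]])
      (use x(1) ec ee in \<open>simp_all add: r_minus_distr l_minus_distr m_assoc xe x(2)\<close>)
  moreover have "x \<otimes> e \<oplus> x \<otimes> (\<one> \<ominus> e) = x" using x(1) ec r_one[OF x(1)] by algebra
  ultimately show ?thesis by simp
qed

lemma rk_idem_minus:
  assumes "e \<in> idempotents R" "f \<in> idempotents R" "e \<otimes> f = f" "f \<otimes> e = f"
  shows "rk (e \<ominus> f) = rk e - rk f"
proof -
  have "rk e = rk (e \<otimes> f) + rk (e \<otimes> (\<one> \<ominus> f))" using assms by (intro rk_split) auto
  then show ?thesis using assms by (simp add: r_minus_distr)
qed

lemma rk_idem_less:
  assumes "e \<in> idempotents R" "f \<in> idempotents R" "e \<otimes> f = f" "f \<otimes> e = f" "e \<noteq> f"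
  shows "rk f < rk e"
  using rk_idem_minus[OF assms(1-4)] rk_pos[of "e \<ominus> f"] assms by simp

lemma rank_dist_metric: "Metric_space (carrier R) (rank_dist R rk)"
proof
  fix x y z
  show "0 \<le> rank_dist R rk x y" using rk_nonneg by (simp add: rank_dist_def)
  show "rank_dist R rk x y = rank_dist R rk y x" using rk_minus_commute by (simp add: rank_dist_def)
  assume "x \<in> carrier R" "y \<in> carrier R"
  then show "rank_dist R rk x y = 0 \<longleftrightarrow> x = y" using rk_eq_zero_iff by (simp add: rank_dist_def)
  assume "z \<in> carrier R"
  have "x \<ominus> z = (x \<ominus> y) \<oplus> (y \<ominus> z)"
    using \<open>x \<in> carrier R\<close> \<open>y \<in> carrier R\<close> \<open>z \<in> carrier R\<close> by algebra
  then show "rank_dist R rk x z \<le> rank_dist R rk x y + rank_dist R rk y z"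
    using rk_plus_le[of "x \<ominus> y" "y \<ominus> z"] \<open>x \<in> carrier R\<close> \<open>y \<in> carrier R\<close> \<open>z \<in> carrier R\<close>
    by (simp add: rank_dist_def)
qed

end

section \<open>Comparability of orthogonal idempotents\<close>

context von_neumann_regular
begin

text \<open>Subequivalence of idempotents: \<open>x\<close> maps \<open>e R\<close> isomorphically
  onto a right ideal inside \<open>f R\<close>, and \<open>w\<close> is a retraction.\<close>

definition embeds :: "'a \<Rightarrow> 'a \<Rightarrow> bool" where
  "embeds e f \<longleftrightarrow> (\<exists>x\<in>carrier R. \<exists>w\<in>carrier R.
     f \<otimes> x = x \<and> x \<otimes> e = x \<and> e \<otimes> w = w \<and> w \<otimes> f = w \<and> w \<otimes> x = e)"

text \<open>An injective right-linear map from \<open>e R\<close> to \<open>f R\<close> is read off a right ideal \<open>g R\<close> with trivial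
  intersection with \<open>f R\<close> whose projection to \<open>e R\<close> is onto, provided \<open>g R\<close> also meets \<open>e R\<close> trivially.\<close>

lemma embeds_of_graph:
  assumes e: "e \<in> idempotents R" and f: "f \<in> idempotents R" and ef: "e \<otimes> f = \<zero>" "f \<otimes> e = \<zero>"
    and g: "g \<in> idempotents R" "(e \<oplus> f) \<otimes> g = g"
    and triv: "\<And>y. y \<in> carrier R \<Longrightarrow> g \<otimes> y = y \<Longrightarrow> e \<otimes> y = y \<Longrightarrow> y = \<zero>"
    and onto: "w \<in> carrier R" "e \<otimes> g \<otimes> w = e"
  shows "embeds e f"
proof -
  \<comment> \<open>An element of \<open>e R\<close> is lifted along \<open>w\<close> to
    \<open>g R\<close> and then projected to \<open>f R\<close>.\<close>
  define x where "x = f \<otimes> (g \<otimes> (w \<otimes> e))"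
  have c: "e \<in> carrier R" "f \<in> carrier R" "g \<in> carrier R" using e f g by auto
  have x: "x \<in> carrier R" "f \<otimes> x = x" "x \<otimes> e = x"
    using c onto(1) mult_eq_assoc[OF idemD(2)[OF f]] idemD(2)[OF e] by (auto simp: x_def m_assoc)
  have inj: "e \<otimes> s = \<zero>" if s: "s \<in> carrier R" "x \<otimes> s = \<zero>" for s
  proof -
    define v where "v = g \<otimes> (w \<otimes> (e \<otimes> s))"
    have v: "v \<in> carrier R" "g \<otimes> v = v"
      using c s(1) onto(1) mult_eq_assoc[OF idemD(2)[OF g(1)]] by (auto simp: v_def)
    have fv: "f \<otimes> v = \<zero>" using s c onto(1) by (simp add: v_def x_def m_assoc)
    have ev: "e \<otimes> v = e \<otimes> s"
    proof -
      have "e \<otimes> v = e \<otimes> g \<otimes> w \<otimes> (e \<otimes> s)" using c s(1) onto(1) by (simp add: v_def m_assoc)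
      then show ?thesis using onto(2) c s(1) mult_eq_assoc[OF idemD(2)[OF e]] by simp
    qed
    have "v = (e \<oplus> f) \<otimes> v" using mult_eq_assoc[OF g(2), of v] v c by simp
    then have "v = e \<otimes> v" using c v(1) fv by (simp add: l_distr)
    then have "v = \<zero>" using triv[OF v] by simp
    then show ?thesis using ev c by simp
  qed
  obtain u where "u \<in> carrier R" "e \<otimes> u = u" "u \<otimes> f = u" "u \<otimes> x = e"
    using left_inverse_of_injective[OF x(1) e f x(2,3) inj] by metis
  then show ?thesis using x unfolding embeds_def by blast
qed

text \<open>\<open>f R\<close> complements in \<open>e R\<close> the projection \<open>e g R\<close>
  of \<open>g R\<close>, so \<open>f = 0\<close> says that this projection is onto
  \<open>e R\<close>.\<close>

lemma image_complement:
  assumes e: "e \<in> idempotents R" and g: "g \<in> carrier R"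
  shows "\<exists>v\<in>carrier R. \<exists>f\<in>idempotents R. f = e \<ominus> e \<otimes> g \<otimes> v \<and>
    f \<otimes> (e \<otimes> g) = \<zero> \<and> e \<otimes> f = f \<and> f \<otimes> e = f"
proof -
  have c: "e \<in> carrier R" using e by auto
  note ee = mult_eq_assoc[OF idemD(2)[OF e]]
  obtain v where v: "v \<in> carrier R" "e \<otimes> g \<otimes> v \<otimes> (e \<otimes> g) = e \<otimes> g" "v \<otimes> e = v"
    by (rule quasi_inverse[of "e \<otimes> g" \<one> e]) (use c g e ee in auto)
  define f where "f = e \<ominus> e \<otimes> g \<otimes> v"
  have fc: "f \<in> carrier R" using c g v by (simp add: f_def)
  have 1: "f \<otimes> (e \<otimes> g) = \<zero>" unfolding f_def using c g v ee by (simp add: l_minus_distr)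
  have 2: "e \<otimes> f = f" unfolding f_def using c g v(1) ee
    by (simp add: r_minus_distr m_assoc idemD[OF e])
  have 3: "f \<otimes> e = f" unfolding f_def using c g v(1,3)
    by (simp add: l_minus_distr m_assoc idemD[OF e])
  have "f \<otimes> (e \<ominus> e \<otimes> g \<otimes> v) = f \<otimes> e \<ominus> f \<otimes> (e \<otimes> g) \<otimes> v"
    using c g v(1) fc by (simp add: r_minus_distr m_assoc)
  then have "f \<otimes> f = f \<otimes> e \<ominus> f \<otimes> (e \<otimes> g) \<otimes> v" unfolding f_def[symmetric] .
  then have "f \<in> idempotents R" using 1 3 fc v(1) by (auto intro: idemI)
  then show ?thesis using v(1) 1 2 3 f_def by blast
qed

end

lemma (in rank_ring) embeds_rk:
  assumes "embeds e f" "e \<in> idempotents R" "f \<in> idempotents R"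
  shows "rk e \<le> rk f"
proof -
  obtain x w where xw: "x \<in> carrier R" "w \<in> carrier R" "f \<otimes> x = x" "w \<otimes> x = e"
    using assms(1) by (auto simp: embeds_def)
  have "rk e \<le> rk x" using rk_mult_right[of w x] xw by simp
  also have "\<dots> \<le> rk f" using rk_mult_left[of f x] xw assms by auto
  finally show ?thesis .
qed

text \<open>\<open>P g\<close> says that \<open>g R\<close> is the graph of an isomorphism between
  subideals of \<open>e R\<close> and \<open>f R\<close>. Joins of chains stay graphs by upper
  continuity. If a maximal graph misses a part \<open>e'\<close> of \<open>e\<close> and a part
  \<open>f'\<close> of \<open>f\<close>, primeness gives a non-zero map between these parts, and
  adding the graph of a restriction of it contradicts maximality. So one side is exhausted and the
  graph is an embedding.\<close>

lemma (in irreducible_continuous_ring) comparability: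
  assumes e: "e \<in> idempotents R" and f: "f \<in> idempotents R" and ef: "e \<otimes> f = \<zero>" "f \<otimes> e = \<zero>"
  shows "embeds e f \<or> embeds f e"
proof -
  define P where "P g \<longleftrightarrow> g \<in> idempotents R \<and> (e \<oplus> f) \<otimes> g = g \<and>
    (\<forall>y\<in>carrier R. g \<otimes> y = y \<longrightarrow> e \<otimes> y = y \<longrightarrow> y = \<zero>) \<and>
    (\<forall>y\<in>carrier R. g \<otimes> y = y \<longrightarrow> f \<otimes> y = y \<longrightarrow> y = \<zero>)" for g
  have c: "e \<in> carrier R" "f \<in> carrier R" using e f by auto
  \<comment> \<open>Zorn is applied to right ideals, since different idempotents may generate the
    same one and the relation between idempotents is only a preorder.\<close>
  have "\<exists>M\<in>fixed_set ` Collect P. \<forall>V\<in>fixed_set ` Collect P. M \<subseteq> V \<longrightarrow> V = M"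
  proof (rule subset_Zorn)
    fix C assume C: "subset.chain (fixed_set ` Collect P) C"
    define A where "A = {g. P g \<and> fixed_set g \<in> C}"
    have AP: "P g" if "g \<in> A" for g using that by (auto simp: A_def)
    have A: "A \<subseteq> idempotents R" using AP by (auto simp: P_def)
    have "chain_idem A"
      unfolding chain_idem_def
    proof (intro conjI A ballI)
      fix g g' assume g: "g \<in> A" "g' \<in> A"
      then have "fixed_set g \<in> C" "fixed_set g' \<in> C" by (auto simp: A_def)
      then have "fixed_set g \<subseteq> fixed_set g' \<or> fixed_set g' \<subseteq> fixed_set g"
        using C by (auto simp: subset_chain_def)
      then show "g \<otimes> g' = g' \<or> g' \<otimes> g = g" using fixed_set_subset_iff g A by auto
    qed
    obtain j where "is_join A j" using join_exists[OF A] by blast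
    then have j: "j \<in> idempotents R" "\<And>e. e \<in> A \<Longrightarrow> j \<otimes> e = e"
      "\<And>x. x \<in> carrier R \<Longrightarrow> (\<forall>e\<in>A. x \<otimes> e = \<zero>) \<Longrightarrow> x \<otimes> j = \<zero>"
      "\<And>g y. g \<in> idempotents R \<Longrightarrow>
        (\<forall>e\<in>A. \<forall>y\<in>carrier R. e \<otimes> y = y \<longrightarrow> g \<otimes> y = y \<longrightarrow> y = \<zero>) \<Longrightarrow>
        y \<in> carrier R \<Longrightarrow> j \<otimes> y = y \<Longrightarrow> g \<otimes> y = y \<Longrightarrow> y = \<zero>"
      using \<open>chain_idem A\<close> unfolding is_join_def by blast+
    have "(\<one> \<ominus> (e \<oplus> f)) \<otimes> j = \<zero>"
    proof (rule j(3), safe)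
      fix g assume "g \<in> A"
      then have "(e \<oplus> f) \<otimes> g = g" "g \<in> carrier R" using AP A by (auto simp: P_def)
      then show "(\<one> \<ominus> (e \<oplus> f)) \<otimes> g = \<zero>" using c by (simp add: l_minus_distr)
    qed (use c in auto)
    then have "(e \<oplus> f) \<otimes> j = j" using c j(1) by (simp add: l_minus_distr)
    moreover have "y = \<zero>" if "y \<in> carrier R" "j \<otimes> y = y" "e \<otimes> y = y" for y
      by (rule j(4)[OF e _ that]) (use AP in \<open>auto simp: P_def\<close>)
    moreover have "y = \<zero>" if "y \<in> carrier R" "j \<otimes> y = y" "f \<otimes> y = y" for y
      by (rule j(4)[OF f _ that]) (use AP in \<open>auto simp: P_def\<close>)
    ultimately have "P j" using j(1) by (auto simp: P_def)
    moreover have "V \<subseteq> fixed_set j" if VC: "V \<in> C" for V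
    proof -
      obtain g where g: "P g" "V = fixed_set g" using C VC by (auto simp: subset_chain_def)
      then have "g \<in> A" using VC by (auto simp: A_def)
      then show ?thesis using j(1,2) g A fixed_set_subset_iff[of g j] by blast
    qed
    ultimately show "\<exists>U\<in>fixed_set ` Collect P. \<forall>V\<in>C. V \<subseteq> U" by blast
  qed
  then obtain g where g: "P g" "\<And>g'. P g' \<Longrightarrow> fixed_set g \<subseteq> fixed_set g' \<Longrightarrow> fixed_set g' = fixed_set g"
    by auto
  have gi: "g \<in> idempotents R" "(e \<oplus> f) \<otimes> g = g"
    and ge: "\<And>y. y \<in> carrier R \<Longrightarrow> g \<otimes> y = y \<Longrightarrow> e \<otimes> y = y \<Longrightarrow> y = \<zero>"
    and gf: "\<And>y. y \<in> carrier R \<Longrightarrow> g \<otimes> y = y \<Longrightarrow> f \<otimes> y = y \<Longrightarrow> y = \<zero>"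
    using g(1) by (auto simp: P_def)
  have gc: "g \<in> carrier R" using gi by auto
  obtain v e' where v: "v \<in> carrier R" "e' = e \<ominus> e \<otimes> g \<otimes> v"
    and e'g: "e' \<otimes> (e \<otimes> g) = \<zero>" "e \<otimes> e' = e'" "e' \<otimes> e = e'" "e' \<in> idempotents R"
    using image_complement[OF e gc] by metis
  obtain w f' where w: "w \<in> carrier R" "f' = f \<ominus> f \<otimes> g \<otimes> w"
    and f'g: "f' \<otimes> (f \<otimes> g) = \<zero>" "f \<otimes> f' = f'" "f' \<otimes> f = f'" "f' \<in> idempotents R"
    using image_complement[OF f gc] by metis
  have c': "e' \<in> carrier R" "f' \<in> carrier R" using e'g f'g by auto
  have "e' = \<zero> \<or> f' = \<zero>"
  proof (rule ccontr)
    assume ne: "\<not> (e' = \<zero> \<or> f' = \<zero>)"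
    then obtain r where r: "r \<in> carrier R" "f' \<otimes> r \<otimes> e' \<noteq> \<zero>" using prime c' by metis
    define u where "u = f' \<otimes> r \<otimes> e'"
    have u: "u \<in> carrier R" "f' \<otimes> u = u" "u \<otimes> e' = u" "u \<noteq> \<zero>"
      using r c' mult_eq_assoc[OF idemD(2)[OF f'g(4)]] idemD(2)[OF e'g(4)] by (auto simp: u_def m_assoc)
    obtain z where z: "z \<in> carrier R" "u \<otimes> z \<otimes> u = u" "e' \<otimes> z = z" "z \<otimes> u \<in> idempotents R"
      using quasi_inverse[OF u(1) e'g(4) f'g(4) u(2,3)] by metis
    \<comment> \<open>\<open>t\<close> is the initial projection of \<open>u\<close>: it lies in
      \<open>e' R\<close>, and \<open>t s = 0\<close> exactly when \<open>u s = 0\<close>, so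
      \<open>t + u\<close> generates the graph of an isomorphism from \<open>t R\<close> to
      \<open>u R\<close>.\<close>
    define t where "t = z \<otimes> u"
    have t: "t \<in> carrier R" "e' \<otimes> t = t" "u \<otimes> t = u" "t \<noteq> \<zero>"
      using u z mult_eq_assoc[OF z(3)] c' by (auto simp: t_def m_assoc)
    have us: "t \<otimes> s = \<zero>" if "s \<in> carrier R" "u \<otimes> s = \<zero>" for s
      using that z(1) u(1) by (simp add: t_def m_assoc)
    have eu: "e \<otimes> u = \<zero>" "f \<otimes> u = u" "e \<otimes> t = t" "f \<otimes> t = \<zero>" "f' \<otimes> t = \<zero>" "e' \<otimes> u = \<zero>"
    proof -
      show fu: "f \<otimes> u = u" using mult_eq_assoc[OF f'g(2), of u] u c c' by simp
      show et: "e \<otimes> t = t" using mult_eq_assoc[OF e'g(2), of t] t c c' by simp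
      show eu: "e \<otimes> u = \<zero>" using mult_eq_assoc[OF ef(1), of u] fu u(1) c by simp
      show ft: "f \<otimes> t = \<zero>" using mult_eq_assoc[OF ef(2), of t] et t(1) c by simp
      show "f' \<otimes> t = \<zero>" using mult_eq_assoc[OF f'g(3), of t] ft t(1) c c' by simp
      show "e' \<otimes> u = \<zero>" using mult_eq_assoc[OF e'g(3), of u] eu u(1) c c' by simp
    qed
    have tu: "t \<oplus> u \<in> carrier R" using t u by simp
    obtain h s where h: "h \<in> idempotents R" "s \<in> carrier R" "g \<otimes> h = \<zero>" "h \<otimes> g = \<zero>"
      "(g \<oplus> h) \<otimes> (t \<oplus> u) = t \<oplus> u" "h = ((t \<oplus> u) \<ominus> g \<otimes> (t \<oplus> u)) \<otimes> s"
      using sum_idem[OF gi(1) tu] by metis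
    have hc: "h \<in> carrier R" using h by auto
    \<comment> \<open>In this form, projecting by \<open>e\<close> or \<open>f\<close> and then
      applying \<open>e'\<close> or \<open>f'\<close> kills the old part \<open>g y1\<close> and
      isolates the contribution of \<open>y2\<close>.\<close>
    have form: "\<exists>y1\<in>carrier R. \<exists>y2\<in>carrier R. y = g \<otimes> y1 \<oplus> (t \<oplus> u) \<otimes> y2"
      if y: "y \<in> carrier R" "(g \<oplus> h) \<otimes> y = y" for y
    proof -
      have "y = g \<otimes> (y \<ominus> (t \<oplus> u) \<otimes> s \<otimes> y) \<oplus> (t \<oplus> u) \<otimes> (s \<otimes> y)"
      proof -
        have "(g \<oplus> h) \<otimes> y = g \<otimes> (y \<ominus> (t \<oplus> u) \<otimes> s \<otimes> y) \<oplus> (t \<oplus> u) \<otimes> (s \<otimes> y)"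
          unfolding h(6) using tu gc h(2) y(1) t(1) u(1) by algebra
        then show ?thesis using y(2) by simp
      qed
      then show ?thesis using y h(2) tu by (metis m_closed minus_closed)
    qed
    have "P (g \<oplus> h)"
      unfolding P_def
    proof (intro conjI ballI impI)
      show "g \<oplus> h \<in> idempotents R" using idem_plus[OF gi(1) h(1,3,4)] .
      have "(e \<oplus> f) \<otimes> (t \<oplus> u) = t \<oplus> u" using c t(1) u(1) eu by (simp add: r_distr l_distr)
      then have "(e \<oplus> f) \<otimes> h = h"
        unfolding h(6) using c gc tu h(2) gi(2) mult_eq_assoc[OF gi(2)] mult_eq_assoc[of "e \<oplus> f" "t \<oplus> u" "t \<oplus> u"]
        by (simp add: m_assoc[symmetric] r_minus_distr del: r_distr l_distr)
      then show "(e \<oplus> f) \<otimes> (g \<oplus> h) = g \<oplus> h" using gi(2) c gc hc by (simp add: r_distr)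
    next
      fix y assume y: "y \<in> carrier R" "(g \<oplus> h) \<otimes> y = y" "e \<otimes> y = y"
      obtain y1 y2 where yy: "y1 \<in> carrier R" "y2 \<in> carrier R" "y = g \<otimes> y1 \<oplus> (t \<oplus> u) \<otimes> y2"
        using form y by blast
      have "f \<otimes> y = \<zero>" using mult_eq_assoc[OF ef(2), of y] y(1,3) c by simp
      then have "f \<otimes> (g \<otimes> y1) \<oplus> u \<otimes> y2 = \<zero>"
        using yy c gc t(1) u(1) mult_eq_assoc[OF eu(2)] mult_eq_assoc[OF eu(4)]
        by (simp add: r_distr l_distr)
      then have "f' \<otimes> (f \<otimes> (g \<otimes> y1) \<oplus> u \<otimes> y2) = \<zero>" using c' by simp
      then have "u \<otimes> y2 = \<zero>"
        using yy c c' gc u(1) mult_eq_assoc[OF f'g(1)] mult_eq_assoc[OF u(2)]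
        by (simp add: r_distr m_assoc)
      then have "y = g \<otimes> y1" using yy us gc t(1) u(1) by (simp add: l_distr)
      then show "y = \<zero>" using ge[OF y(1) _ y(3)] mult_eq_assoc[OF idemD(2)[OF gi(1)]] gc yy by simp
    next
      fix y assume y: "y \<in> carrier R" "(g \<oplus> h) \<otimes> y = y" "f \<otimes> y = y"
      obtain y1 y2 where yy: "y1 \<in> carrier R" "y2 \<in> carrier R" "y = g \<otimes> y1 \<oplus> (t \<oplus> u) \<otimes> y2"
        using form y by blast
      have "e \<otimes> y = \<zero>" using mult_eq_assoc[OF ef(1), of y] y(1,3) c by simp
      then have "e \<otimes> (g \<otimes> y1) \<oplus> t \<otimes> y2 = \<zero>"
        using yy c gc t(1) u(1) mult_eq_assoc[OF eu(1)] mult_eq_assoc[OF eu(3)]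
        by (simp add: r_distr l_distr)
      then have "e' \<otimes> (e \<otimes> (g \<otimes> y1) \<oplus> t \<otimes> y2) = \<zero>" using c' by simp
      then have ty: "t \<otimes> y2 = \<zero>"
        using yy c c' gc t(1) mult_eq_assoc[OF e'g(1)] mult_eq_assoc[OF t(2)]
        by (simp add: r_distr m_assoc)
      then have "u \<otimes> y2 = \<zero>" using mult_eq_assoc[OF t(3), of y2] t(1) u(1) yy by simp
      then have "y = g \<otimes> y1" using yy ty gc t(1) u(1) by (simp add: l_distr)
      then show "y = \<zero>" using gf[OF y(1) _ y(3)] mult_eq_assoc[OF idemD(2)[OF gi(1)]] gc yy by simp
    qed
    moreover have "fixed_set g \<subseteq> fixed_set (g \<oplus> h)"
      using fixed_set_subset_iff[OF gi(1), of "g \<oplus> h"] h gi idem_plus[OF gi(1) h(1,3,4)] gc hc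
      by (simp add: l_distr idemD)
    \<comment> \<open>Maximality puts \<open>t + u\<close> into \<open>g R\<close>, but
      \<open>e'\<close> kills \<open>e g R\<close> and sends \<open>t + u\<close> to
      \<open>t\<close>.\<close>
    ultimately have "fixed_set (g \<oplus> h) = fixed_set g" using g(2) by blast
    then have "g \<otimes> (t \<oplus> u) = t \<oplus> u" using tu h(5) by (auto simp: fixed_set_def)
    then have "e' \<otimes> (t \<oplus> u) = e' \<otimes> (e \<otimes> (g \<otimes> (t \<oplus> u)))"
      using mult_eq_assoc[OF e'g(3)] c c' tu by (simp del: r_distr)
    also have "\<dots> = \<zero>" using mult_eq_assoc[OF e'g(1), of "t \<oplus> u"] c c' gc tu by (simp add: m_assoc)
    finally have "t = \<zero>" using t(1,2) u(1) eu(6) c' by (simp add: r_distr)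
    then show False using t by simp
  qed
  then show ?thesis
  proof
    assume "e' = \<zero>"
    then have "e \<otimes> g \<otimes> v = e" using v(2) c gc v(1) by simp
    then show ?thesis using embeds_of_graph[OF e f ef gi ge v(1)] by blast
  next
    assume "f' = \<zero>"
    then have "f \<otimes> g \<otimes> w = f" using w(2) c gc w(1) by simp
    moreover have "(f \<oplus> e) \<otimes> g = g" using gi(2) c by (simp add: a_comm)
    ultimately show ?thesis using embeds_of_graph[OF f e ef(2,1) gi(1) _ gf w(1)] by blast
  qed
qed

section \<open>The centre of a corner\<close>

text \<open>A relation instead of a map, because an element has many expressions as a sum of terms
  \<open>v g u\<close>; \<open>lift_pair_swap\<close> stands in for well-definedness.\<close>

inductive (in ring) lift_pair :: "'a \<Rightarrow> 'a \<Rightarrow> 'a \<Rightarrow> 'a \<Rightarrow> bool" for g \<mu> where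
  base: "v \<in> carrier R \<Longrightarrow> u \<in> carrier R \<Longrightarrow> lift_pair g \<mu> (v \<otimes> g \<otimes> u) (v \<otimes> \<mu> \<otimes> u)"
| plus: "lift_pair g \<mu> y z \<Longrightarrow> lift_pair g \<mu> y' z' \<Longrightarrow> lift_pair g \<mu> (y \<oplus> y') (z \<oplus> z')"

lemma (in ring) lift_pair_carrier:
  assumes "lift_pair g \<mu> y z" "g \<in> carrier R" "\<mu> \<in> carrier R"
  shows "y \<in> carrier R \<and> z \<in> carrier R"
  using assms(1) by induction (use assms(2,3) in auto)

text \<open>On generators, \<open>\<mu>\<close> is moved across \<open>g (u r v') g\<close>, with
  which it commutes. For \<open>y = y' = 1\<close> the identity says that the lift of
  \<open>1\<close> is central.\<close>

lemma (in ring) lift_pair_swap: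
  assumes yz: "lift_pair g \<mu> y z" and yz': "lift_pair g \<mu> y' z'" and r: "r \<in> carrier R"
    and g: "g \<in> carrier R" "\<mu> \<in> carrier R" "g \<otimes> \<mu> = \<mu>" "\<mu> \<otimes> g = \<mu>"
    and comm: "\<And>r. r \<in> carrier R \<Longrightarrow> \<mu> \<otimes> (g \<otimes> r \<otimes> g) = (g \<otimes> r \<otimes> g) \<otimes> \<mu>"
  shows "y \<otimes> r \<otimes> z' = z \<otimes> r \<otimes> y'"
  using yz
proof induction
  case (base v u)
  show ?case
    using yz'
  proof induction
    case (base v' u')
    let ?s = "u \<otimes> r \<otimes> v'"
    have c: "?s \<in> carrier R" using base r \<open>u \<in> carrier R\<close> by simp
    have "v \<otimes> g \<otimes> u \<otimes> r \<otimes> (v' \<otimes> \<mu> \<otimes> u') = v \<otimes> (g \<otimes> ?s \<otimes> (g \<otimes> \<mu>)) \<otimes> u'"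
      unfolding g(3) using base \<open>u \<in> carrier R\<close> \<open>v \<in> carrier R\<close> r g(1,2) by (simp add: m_assoc)
    also have "g \<otimes> ?s \<otimes> (g \<otimes> \<mu>) = g \<otimes> ?s \<otimes> g \<otimes> \<mu>" using c g(1,2) by (simp add: m_assoc)
    also have "\<dots> = \<mu> \<otimes> (g \<otimes> ?s \<otimes> g)" using comm[OF c] by simp
    also have "\<dots> = (\<mu> \<otimes> g) \<otimes> ?s \<otimes> g" using c g(1,2) by (simp add: m_assoc)
    also have "v \<otimes> ((\<mu> \<otimes> g) \<otimes> ?s \<otimes> g) \<otimes> u' = v \<otimes> \<mu> \<otimes> u \<otimes> r \<otimes> (v' \<otimes> g \<otimes> u')"
      unfolding g(4) using base \<open>u \<in> carrier R\<close> \<open>v \<in> carrier R\<close> r g(1,2) by (simp add: m_assoc)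
    finally show ?case .
  next
    case (plus y z y' z')
    then show ?case
      using lift_pair_carrier[OF plus(1) g(1,2)] lift_pair_carrier[OF plus(2) g(1,2)] base r g(1,2)
      by (simp add: r_distr)
  qed
next
  case (plus y z y'' z'')
  then show ?case
    using lift_pair_carrier[OF plus(1) g(1,2)] lift_pair_carrier[OF plus(2) g(1,2)]
      lift_pair_carrier[OF yz' g(1,2)] r
    by (simp add: l_distr)
qed

section \<open>Non-discreteness: small idempotents and the lifting of central elements\<close>

locale nondiscrete_continuous_ring = irreducible_continuous_ring + rank_ring +
  assumes nondiscrete: "0 < \<epsilon> \<Longrightarrow> \<exists>x\<in>carrier R. x \<noteq> \<zero> \<and> rk x < \<epsilon>"
begin

text \<open>Primeness carries an element of small rank to a non-zero \<open>u\<close> of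
  \<open>e R e\<close> whose rank is no larger, and \<open>u w\<close> is the required
  idempotent.\<close>

lemma small_idem:
  assumes e: "e \<in> idempotents R" "e \<noteq> \<zero>" and "0 < \<epsilon>"
  obtains g where "g \<in> idempotents R" "e \<otimes> g = g" "g \<otimes> e = g" "g \<noteq> \<zero>" "rk g < \<epsilon>"
proof -
  obtain x where x: "x \<in> carrier R" "x \<noteq> \<zero>" "rk x < \<epsilon>" using nondiscrete[OF \<open>0 < \<epsilon>\<close>] by blast
  have ec: "e \<in> carrier R" using e by auto
  obtain r where r: "r \<in> carrier R" "e \<otimes> r \<otimes> x \<noteq> \<zero>" using prime[OF ec e(2) x(1,2)] by metis
  obtain s where s: "s \<in> carrier R" "e \<otimes> r \<otimes> x \<otimes> s \<otimes> e \<noteq> \<zero>"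
    using prime[of "e \<otimes> r \<otimes> x" e] r x e ec by (metis m_closed)
  define u where "u = e \<otimes> r \<otimes> x \<otimes> s \<otimes> e"
  have u: "u \<in> carrier R" "e \<otimes> u = u" "u \<otimes> e = u" "u \<noteq> \<zero>"
    using r s x(1) ec mult_eq_assoc[OF idemD(2)[OF e(1)]] idemD(2)[OF e(1)] by (auto simp: u_def m_assoc)
  obtain w where w: "w \<in> carrier R" "u \<otimes> w \<otimes> u = u" "w \<otimes> e = w" "u \<otimes> w \<in> idempotents R"
    using quasi_inverse[OF u(1) e(1) e(1) u(2,3)] by metis
  have "u = (e \<otimes> r) \<otimes> (x \<otimes> (s \<otimes> e))" using ec r s x by (simp add: u_def m_assoc)
  then have "rk u \<le> rk (x \<otimes> (s \<otimes> e))" using rk_mult_right[of "e \<otimes> r"] ec r s x by simp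
  also have "\<dots> \<le> rk x" using rk_mult_left ec s x by simp
  finally have "rk (u \<otimes> w) < \<epsilon>" using x rk_mult_left[OF u(1) w(1)] by simp
  moreover have "e \<otimes> (u \<otimes> w) = u \<otimes> w" using mult_eq_assoc[OF u(2)] ec u w by simp
  moreover have "u \<otimes> w \<otimes> e = u \<otimes> w" using u w ec by (simp add: m_assoc)
  moreover have "u \<otimes> w \<noteq> \<zero>" using u w by auto
  ultimately show thesis using that w(4) by blast
qed

text \<open>Induction on a bound \<open>n\<close> for the number of copies of \<open>g\<close> that
  fit into \<open>r\<close>. By comparability either \<open>r\<close> embeds in \<open>g\<close>,
  and one term \<open>w g x\<close> suffices, or a copy \<open>p = x g w\<close> of \<open>g\<close>
  splits off from \<open>r\<close> and lowers its rank by at least \<open>rk g\<close>.\<close>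

lemma lift_pair_orthogonal:
  assumes g: "g \<in> idempotents R" "g \<noteq> \<zero>"
    and r: "r \<in> idempotents R" "r \<otimes> g = \<zero>" "g \<otimes> r = \<zero>" and "rk r < real n * rk g"
  shows "\<exists>z. lift_pair g \<mu> r z"
  using r \<open>rk r < _\<close>
proof (induction n arbitrary: r)
  case 0
  then show ?case using rk_nonneg[of r] by simp
next
  case (Suc n)
  have c: "g \<in> carrier R" "r \<in> carrier R" using g Suc.prems by auto
  consider "embeds r g" | "embeds g r" using comparability[OF g(1) Suc.prems(1,3,2)] by blast
  then show ?case
  proof cases
    case 1
    then obtain x w where xw: "x \<in> carrier R" "w \<in> carrier R" "g \<otimes> x = x" "w \<otimes> x = r"
      unfolding embeds_def by blast
    then have "w \<otimes> g \<otimes> x = r" using c by (simp add: m_assoc)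
    then show ?thesis using base[OF xw(2,1)] by metis
  next
    case 2
    then obtain x w where xw: "x \<in> carrier R" "w \<in> carrier R" "r \<otimes> x = x" "x \<otimes> g = x" "g \<otimes> w = w"
      "w \<otimes> r = w" "w \<otimes> x = g"
      unfolding embeds_def by blast
    define p where "p = x \<otimes> w"
    have pc: "p \<in> carrier R" using xw by (simp add: p_def)
    have "p \<otimes> p = x \<otimes> (w \<otimes> x) \<otimes> w" using xw(1,2) by (simp add: p_def m_assoc)
    then have p: "p \<in> idempotents R" using xw(1,2) pc by (auto intro!: idemI simp: xw(7,4) p_def)
    have rp: "r \<otimes> p = p" "p \<otimes> r = p"
      using mult_eq_assoc[OF xw(3)] xw(1,2,6) c by (simp_all add: p_def m_assoc)
    have "g \<otimes> x = \<zero>" "w \<otimes> g = \<zero>"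
      using mult_eq_assoc[OF Suc.prems(3), of x] xw(3) mult_eq_assoc[of w r w g] Suc.prems(2) xw c by auto
    then have "g \<otimes> p = \<zero>" "p \<otimes> g = \<zero>"
      using mult_eq_assoc[of g x \<zero> w] xw(1,2) c by (simp_all add: p_def m_assoc)
    then have orth: "(r \<ominus> p) \<otimes> g = \<zero>" "g \<otimes> (r \<ominus> p) = \<zero>"
      using Suc.prems(2,3) c pc by (simp_all add: l_minus_distr r_minus_distr)
    have "rk g \<le> rk p"
    proof -
      have "w \<otimes> p \<otimes> x = g" using xw c by (simp add: p_def m_assoc[symmetric] idemD[OF g(1)])
      then have "rk g \<le> rk (w \<otimes> p)" using rk_mult_left[of "w \<otimes> p" x] xw pc by simp
      also have "\<dots> \<le> rk p" using rk_mult_right xw pc by simp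
      finally show ?thesis .
    qed
    then have "rk (r \<ominus> p) < real n * rk g"
      using rk_idem_minus[OF Suc.prems(1) p rp] Suc.prems(4) by (simp add: algebra_simps)
    then obtain z where z: "lift_pair g \<mu> (r \<ominus> p) z"
      using Suc.IH[OF idem_minus[OF Suc.prems(1) p rp] orth] by blast
    have "lift_pair g \<mu> (x \<otimes> g \<otimes> w) (x \<otimes> \<mu> \<otimes> w)" using base xw by blast
    then have "lift_pair g \<mu> p (x \<otimes> \<mu> \<otimes> w)" by (simp add: xw(4) p_def)
    then have "lift_pair g \<mu> ((r \<ominus> p) \<oplus> p) (z \<oplus> x \<otimes> \<mu> \<otimes> w)" using plus[OF z] by blast
    moreover have "(r \<ominus> p) \<oplus> p = r" using c pc by algebra
    ultimately show ?thesis by metis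
  qed
qed

text \<open>Since \<open>R = R g R\<close>, a central \<open>\<mu>\<close> of \<open>g R g\<close> acts as \<open>\<Sum> v g u \<mapsto> \<Sum> v \<mu> u\<close>, a multiplication by a
  central element of \<open>R\<close>.\<close>

lemma center_lift:
  assumes g: "g \<in> idempotents R" "g \<noteq> \<zero>"
    and m: "\<mu> \<in> carrier R" "g \<otimes> \<mu> = \<mu>" "\<mu> \<otimes> g = \<mu>"
    and comm: "\<And>r. r \<in> carrier R \<Longrightarrow> \<mu> \<otimes> (g \<otimes> r \<otimes> g) = (g \<otimes> r \<otimes> g) \<otimes> \<mu>"
  obtains k where "k \<in> ring_center R" "k \<otimes> g = \<mu>"
proof -
  have c: "g \<in> carrier R" using g by auto
  have "0 < rk g" using rk_pos c g by blast
  then obtain n where "rk (\<one> \<ominus> g) < real n * rk g" using reals_Archimedean3 by blast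
  moreover have "(\<one> \<ominus> g) \<otimes> g = \<zero>" "g \<otimes> (\<one> \<ominus> g) = \<zero>"
    using c by (simp_all add: l_minus_distr r_minus_distr idemD[OF g(1)])
  ultimately obtain z where z: "lift_pair g \<mu> (\<one> \<ominus> g) z"
    using lift_pair_orthogonal[OF g idem_compl[OF g(1)]] by blast
  have gm: "lift_pair g \<mu> g \<mu>" using base[of \<one> \<one> g \<mu>] c m by simp
  define l where "l = z \<oplus> \<mu>"
  have "(\<one> \<ominus> g) \<oplus> g = \<one>" using c by algebra
  then have one: "lift_pair g \<mu> \<one> l" using plus[OF z gm] by (simp add: l_def)
  have lc: "l \<in> carrier R" using lift_pair_carrier[OF one c m(1)] by simp
  note sw = lift_pair_swap[OF one _ _ c m comm]
  have "l \<in> ring_center R" using sw[OF one] lc by (auto simp: ring_center_def)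
  moreover have "l \<otimes> g = \<mu>" using sw[OF gm one_closed] lc c m by simp
  ultimately show thesis using that by blast
qed

end

text \<open>For central \<open>z\<close> with inner inverse \<open>w\<close>,
  \<open>z r (1 - w z) = r (z - z w z) = 0\<close> for all \<open>r\<close>, so primeness yields
  \<open>w z = 1\<close>.\<close>

lemma (in irreducible_continuous_ring) center_inverse:
  assumes z: "z \<in> ring_center R" "z \<noteq> \<zero>"
  obtains w where "w \<in> ring_center R" "w \<otimes> z = \<one>" "z \<otimes> w = \<one>"
proof -
  have zc: "z \<in> carrier R" and comm: "\<And>x. x \<in> carrier R \<Longrightarrow> z \<otimes> x = x \<otimes> z"
    using z by (auto simp: ring_center_def)
  obtain w where w: "w \<in> carrier R" "z \<otimes> w \<otimes> z = z" using regular[OF zc] by blast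
  have "z \<otimes> r \<otimes> (\<one> \<ominus> w \<otimes> z) = \<zero>" if "r \<in> carrier R" for r
  proof -
    have "z \<otimes> r \<otimes> (\<one> \<ominus> w \<otimes> z) = r \<otimes> z \<ominus> r \<otimes> (z \<otimes> w \<otimes> z)"
      using comm[OF that] w zc that by (simp add: r_minus_distr m_assoc)
    then show ?thesis using w zc that by simp
  qed
  then have "\<one> \<ominus> w \<otimes> z = \<zero>" using prime[OF zc z(2), of "\<one> \<ominus> w \<otimes> z"] w zc by (metis m_closed minus_closed one_closed)
  then have wz: "w \<otimes> z = \<one>" "z \<otimes> w = \<one>" using w zc comm by auto
  have "w \<otimes> x = x \<otimes> w" if x: "x \<in> carrier R" for x
  proof -
    have "w \<otimes> x = w \<otimes> x \<otimes> (z \<otimes> w)" using wz w x by simp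
    also have "\<dots> = w \<otimes> (x \<otimes> z) \<otimes> w" using w zc x by (simp add: m_assoc)
    also have "\<dots> = w \<otimes> (z \<otimes> x) \<otimes> w" using comm x by simp
    also have "\<dots> = (w \<otimes> z) \<otimes> x \<otimes> w" using w zc x by (simp add: m_assoc)
    finally show ?thesis using wz x by simp
  qed
  then have "w \<in> ring_center R" using w by (auto simp: ring_center_def)
  then show thesis using that wz by blast
qed

section \<open>Limits of increasing sequences of idempotents\<close>

locale increasing_idems = continuous_regular_ring +
  fixes g :: "nat \<Rightarrow> 'a"
  assumes idem: "g n \<in> idempotents R"
    and step: "g (Suc n) \<otimes> g n = g n" "g n \<otimes> g (Suc n) = g n"
begin

lemma closed [simp]: "g n \<in> carrier R"
  using idem by auto

lemma mono: "m \<le> n \<Longrightarrow> g n \<otimes> g m = g m \<and> g m \<otimes> g n = g m"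
proof (induction n rule: dec_induct)
  case base
  then show ?case using idemD(2)[OF idem] by simp
next
  case (step n)
  have "g (Suc n) \<otimes> g m = g (Suc n) \<otimes> (g n \<otimes> g m)" using step by simp
  also have "\<dots> = g n \<otimes> g m"
    using mult_eq_assoc[OF increasing_idems.step(1)[OF increasing_idems_axioms]] closed by blast
  also have "\<dots> = g m" using step by simp
  finally have 1: "g (Suc n) \<otimes> g m = g m" .
  have "g m \<otimes> g (Suc n) = g m \<otimes> g n \<otimes> g (Suc n)" using step by simp
  also have "\<dots> = g m \<otimes> g n"
    using increasing_idems.step(2)[OF increasing_idems_axioms, of n] m_assoc[of "g m" "g n" "g (Suc n)"] closed
    by simp
  also have "\<dots> = g m" using step by simp
  finally show ?case using 1 by simp
qed

text \<open>The limit is described without the topology: the two annihilator clauses make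
  \<open>G\<close> the smallest idempotent above all \<open>g n\<close>. That the ranks converge is
  a separate fact, \<open>rk_limit\<close>.\<close>

definition is_limit :: "'a \<Rightarrow> bool" where
  "is_limit G \<longleftrightarrow> G \<in> idempotents R \<and> (\<forall>n. G \<otimes> g n = g n \<and> g n \<otimes> G = g n) \<and>
     (\<forall>x\<in>carrier R. (\<forall>n. x \<otimes> g n = \<zero>) \<longrightarrow> x \<otimes> G = \<zero>) \<and>
     (\<forall>x\<in>carrier R. (\<forall>n. g n \<otimes> x = \<zero>) \<longrightarrow> G \<otimes> x = \<zero>)"

text \<open>The join \<open>f R\<close> of all \<open>g n R\<close> and the meet \<open>m R\<close> of all \<open>(1 - g n) R\<close> are complementary by upper
  and lower continuity; the limit is the projection onto the former along the latter.\<close>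

lemma limit_exists: "\<exists>G. is_limit G"
proof -
  let ?A = "range g" and ?B = "range (\<lambda>n. \<one> \<ominus> g n)"
  have A: "?A \<subseteq> idempotents R" "?B \<subseteq> idempotents R" using idem idem_compl by auto
  have chA: "chain_idem ?A"
    unfolding chain_idem_def using A(1) mono by (auto simp: image_iff) (metis nat_le_linear)
  have compl: "(\<one> \<ominus> g m) \<otimes> (\<one> \<ominus> g n) = \<one> \<ominus> g n" if "m \<le> n" for m n
  proof -
    have "(\<one> \<ominus> g m) \<otimes> (\<one> \<ominus> g n) = \<one> \<ominus> g m \<ominus> (g n \<ominus> g m)"
      using mono[OF that] by (simp add: l_minus_distr r_minus_distr)
    also have "\<dots> = \<one> \<ominus> g n" using closed[of m] closed[of n] one_closed by algebra
    finally show ?thesis .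
  qed
  have chB: "chain_idem ?B"
    unfolding chain_idem_def using A(2) compl by (auto simp: image_iff) (metis nat_le_linear)
  obtain f m where f: "is_join ?A f" and m: "is_meet ?B m" using join_exists meet_exists A by metis
  have fi: "f \<in> idempotents R" "\<And>n. f \<otimes> g n = g n"
    "\<And>x. x \<in> carrier R \<Longrightarrow> (\<And>n. x \<otimes> g n = \<zero>) \<Longrightarrow> x \<otimes> f = \<zero>"
    using f unfolding is_join_def by auto
  have mi: "m \<in> idempotents R" "\<And>y. y \<in> carrier R \<Longrightarrow> m \<otimes> y = y \<longleftrightarrow> (\<forall>n. g n \<otimes> y = \<zero>)"
  proof -
    show "m \<in> idempotents R" using m by (simp add: is_meet_def)
    fix y assume y: "y \<in> carrier R"
    have "(\<one> \<ominus> g n) \<otimes> y = y \<longleftrightarrow> g n \<otimes> y = \<zero>" for n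
    proof
      assume "(\<one> \<ominus> g n) \<otimes> y = y"
      then have "g n \<otimes> ((\<one> \<ominus> g n) \<otimes> y) = g n \<otimes> y" by simp
      moreover have "g n \<otimes> (\<one> \<ominus> g n) = \<zero>" using idemD(2)[OF idem] by (simp add: r_minus_distr)
      ultimately show "g n \<otimes> y = \<zero>" using mult_eq_assoc[of "g n" "\<one> \<ominus> g n" \<zero> y] y by simp
    qed (use y in \<open>simp add: l_minus_distr\<close>)
    then show "m \<otimes> y = y \<longleftrightarrow> (\<forall>n. g n \<otimes> y = \<zero>)" using m y by (auto simp: is_meet_def)
  qed
  have c: "f \<in> carrier R" "m \<in> carrier R" using fi mi by auto
  \<comment> \<open>Upper continuity: each \<open>g n R\<close> meets \<open>m R\<close> trivially,
    hence so does their join \<open>f R\<close>.\<close>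
  have triv: "y = \<zero>" if y: "y \<in> carrier R" "f \<otimes> y = y" "m \<otimes> y = y" for y
  proof -
    have "\<forall>e\<in>?A. \<forall>y\<in>carrier R. e \<otimes> y = y \<longrightarrow> m \<otimes> y = y \<longrightarrow> y = \<zero>" using mi(2) by auto
    then show ?thesis using f chA mi(1) y unfolding is_join_def by blast
  qed
  \<comment> \<open>Lower continuity: each \<open>(1 - g n) R\<close> spans \<open>R\<close>
    together with \<open>f R\<close>, hence so does their meet \<open>m R\<close>.\<close>
  have "\<forall>e\<in>?B. \<exists>s\<in>carrier R. \<exists>t\<in>carrier R. f \<otimes> s \<oplus> e \<otimes> t = \<one>"
  proof
    fix e assume "e \<in> ?B"
    then obtain n where "e = \<one> \<ominus> g n" by auto
    moreover have "g n \<oplus> (\<one> \<ominus> g n) = \<one>" using closed[of n] one_closed by algebra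
    ultimately have "f \<otimes> g n \<oplus> e \<otimes> \<one> = \<one>" using fi(2)[of n] by simp
    then show "\<exists>s\<in>carrier R. \<exists>t\<in>carrier R. f \<otimes> s \<oplus> e \<otimes> t = \<one>" using closed one_closed by blast
  qed
  then obtain s t where st: "s \<in> carrier R" "t \<in> carrier R" "f \<otimes> s \<oplus> m \<otimes> t = \<one>"
    using m chB fi(1) unfolding is_meet_def by blast
  define G where "G = f \<otimes> s"
  have Gc: "G \<in> carrier R" "m \<otimes> t \<in> carrier R" using c st by (auto simp: G_def)
  have sum: "G \<oplus> m \<otimes> t = \<one>" using st by (simp add: G_def)
  have ff: "f \<otimes> (f \<otimes> y) = f \<otimes> y" "m \<otimes> (m \<otimes> y) = m \<otimes> y" if "y \<in> carrier R" for y
    using mult_eq_assoc[OF idemD(2)[OF fi(1)]] mult_eq_assoc[OF idemD(2)[OF mi(1)]] c that by auto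
  \<comment> \<open>\<open>f - G f = m t f\<close> lies in \<open>f R\<close> and in
    \<open>m R\<close>, hence is zero; \<open>G m = m - m t m\<close> vanishes for the same
    reason.\<close>
  have Gf: "G \<otimes> f = f"
  proof -
    have "f = (G \<oplus> m \<otimes> t) \<otimes> f" using sum c by simp
    also have "\<dots> = G \<otimes> f \<oplus> m \<otimes> t \<otimes> f" using Gc c by (simp add: l_distr)
    finally have eq: "f = G \<otimes> f \<oplus> m \<otimes> t \<otimes> f" .
    have "m \<otimes> t \<otimes> f = (G \<otimes> f \<oplus> m \<otimes> t \<otimes> f) \<ominus> G \<otimes> f" using Gc c by algebra
    then have "m \<otimes> t \<otimes> f = f \<ominus> G \<otimes> f" using eq by simp
    then have "f \<otimes> (m \<otimes> t \<otimes> f) = m \<otimes> t \<otimes> f"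
      using c st ff idemD(2)[OF fi(1)] by (simp add: G_def r_minus_distr m_assoc)
    moreover have "m \<otimes> (m \<otimes> t \<otimes> f) = m \<otimes> t \<otimes> f" using c st ff by (simp add: m_assoc)
    ultimately have "m \<otimes> t \<otimes> f = \<zero>" using triv c st by simp
    then show ?thesis using eq Gc c by simp
  qed
  have Gm: "G \<otimes> m = \<zero>"
  proof -
    have "m = (G \<oplus> m \<otimes> t) \<otimes> m" using sum c by simp
    also have "\<dots> = G \<otimes> m \<oplus> m \<otimes> t \<otimes> m" using Gc c by (simp add: l_distr)
    finally have eq: "m = G \<otimes> m \<oplus> m \<otimes> t \<otimes> m" .
    have "G \<otimes> m = (G \<otimes> m \<oplus> m \<otimes> t \<otimes> m) \<ominus> m \<otimes> t \<otimes> m" using Gc c by algebra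
    then have "G \<otimes> m = m \<ominus> m \<otimes> t \<otimes> m" using eq by simp
    then have "m \<otimes> (G \<otimes> m) = G \<otimes> m"
      using c st ff idemD(2)[OF mi(1)] by (simp add: r_minus_distr m_assoc)
    moreover have "f \<otimes> (G \<otimes> m) = G \<otimes> m" using c st ff by (simp add: G_def m_assoc)
    ultimately show ?thesis using triv c Gc by simp
  qed
  have "is_limit G"
    unfolding is_limit_def
  proof (intro conjI allI ballI impI)
    have "G \<otimes> G = G \<otimes> f \<otimes> s" using Gc c st by (simp add: G_def m_assoc)
    then show "G \<in> idempotents R" using Gc Gf by (auto intro: idemI simp: G_def)
    fix n
    show "G \<otimes> g n = g n"
      using mult_eq_assoc[OF Gf, of "g n"] fi(2) Gc c by simp
    have "g n \<otimes> m = \<zero>" using mi(2)[OF c(2)] idemD(2)[OF mi(1)] by simp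
    then have "g n \<otimes> (m \<otimes> t) = \<zero>" using mult_eq_assoc[of "g n" m \<zero> t] c st by simp
    moreover have "g n \<otimes> (G \<oplus> m \<otimes> t) = g n" using sum by simp
    ultimately show "g n \<otimes> G = g n" using Gc by (simp add: r_distr)
  next
    fix x assume "x \<in> carrier R" "\<forall>n. x \<otimes> g n = \<zero>"
    then show "x \<otimes> G = \<zero>" using fi(3)[of x] mult_eq_assoc[of x f \<zero> s] c st by (simp add: G_def)
  next
    fix x assume x: "x \<in> carrier R" "\<forall>n. g n \<otimes> x = \<zero>"
    then have "m \<otimes> x = x" using mi(2) by blast
    then show "G \<otimes> x = \<zero>" using mult_eq_assoc[OF Gm, of x] Gc c x by simp
  qed
  then show ?thesis by blast
qed

text \<open>\<open>(1 - G) x g n\<close> and \<open>g n x (1 - G)\<close> vanish for all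
  \<open>n\<close>, so the two annihilator clauses give \<open>x G = G x G = G x\<close>.\<close>

lemma limit_commute:
  assumes G: "is_limit G" and x: "x \<in> carrier R" "\<And>n. x \<otimes> g n = g n \<otimes> x"
  shows "x \<otimes> G = G \<otimes> x"
proof -
  have Gi: "G \<in> carrier R" "G \<otimes> G = G" "\<And>n. G \<otimes> g n = g n" "\<And>n. g n \<otimes> G = g n"
    using G idemD by (auto simp: is_limit_def)
  have "(\<one> \<ominus> G) \<otimes> x \<otimes> g n = \<zero>" "g n \<otimes> (x \<otimes> (\<one> \<ominus> G)) = \<zero>" for n
  proof -
    have "(\<one> \<ominus> G) \<otimes> x \<otimes> g n = ((\<one> \<ominus> G) \<otimes> g n) \<otimes> x"
      using Gi(1) x by (simp add: m_assoc)
    then show "(\<one> \<ominus> G) \<otimes> x \<otimes> g n = \<zero>" using Gi x by (simp add: l_minus_distr)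
    have "g n \<otimes> (x \<otimes> (\<one> \<ominus> G)) = x \<otimes> (g n \<otimes> (\<one> \<ominus> G))"
      using Gi(1) x mult_eq_assoc[OF x(2), of n "\<one> \<ominus> G"] by (simp add: m_assoc)
    then show "g n \<otimes> (x \<otimes> (\<one> \<ominus> G)) = \<zero>" using Gi x by (simp add: r_minus_distr)
  qed
  then have "(\<one> \<ominus> G) \<otimes> x \<otimes> G = \<zero>" "G \<otimes> (x \<otimes> (\<one> \<ominus> G)) = \<zero>"
    using G Gi(1) x(1) unfolding is_limit_def by auto
  then have "x \<otimes> G = G \<otimes> x \<otimes> G" "G \<otimes> x = G \<otimes> (x \<otimes> G)"
    using Gi(1) x(1) by (simp_all add: l_minus_distr r_minus_distr)
  then show ?thesis using m_assoc[OF Gi(1) x(1) Gi(1)] by simp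
qed

end

locale nondiscrete_increasing_idems = nondiscrete_continuous_ring + increasing_idems
begin

text \<open>Otherwise the differences \<open>h = G - g N\<close> have rank bounded below, while the total rank of the
  increments after \<open>N\<close> is less than that of some small idempotent \<open>k\<close> orthogonal to \<open>h\<close>. Embedding the
  increments one after another into \<open>k\<close> and joining the graphs embeds \<open>h\<close> into \<open>k\<close>.\<close>

lemma rk_limit:
  assumes G: "is_limit G" and eps: "0 < \<epsilon>"
  shows "\<exists>N. rk G - rk (g N) < \<epsilon>"
proof (rule ccontr)
  assume "\<not> ?thesis"
  then have far: "\<epsilon> \<le> rk G - rk (g n)" for n by (metis not_le)
  have Gi: "G \<in> idempotents R" "\<And>n. G \<otimes> g n = g n" "\<And>n. g n \<otimes> G = g n"
    and Gzero: "\<And>x. x \<in> carrier R \<Longrightarrow> (\<And>n. x \<otimes> g n = \<zero>) \<Longrightarrow> x \<otimes> G = \<zero>"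
    using G by (auto simp: is_limit_def)
  have Gc: "G \<in> carrier R" using Gi by auto
  obtain n0 where n0: "g n0 \<noteq> \<zero>"
  proof (rule ccontr)
    assume "\<not> thesis"
    then have "g n = \<zero>" for n using that by blast
    then have "\<one> \<otimes> G = \<zero>" by (intro Gzero) auto
    then show False using far[of 0] eps rk_nonneg[of "g 0"] Gc by simp
  qed
  \<comment> \<open>\<open>k\<close> is taken below \<open>g n0\<close> so that it is orthogonal to
    all later increments.\<close>
  obtain k where k: "k \<in> idempotents R" "g n0 \<otimes> k = k" "k \<otimes> g n0 = k" "k \<noteq> \<zero>" "rk k < \<epsilon>"
    using small_idem[OF idem n0 eps] by metis
  have kc: "k \<in> carrier R" using k by auto
  have mono_rk: "rk (g m) \<le> rk (g n)" if "m \<le> n" for m n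
    using mono[OF that] rk_mult_left[of "g n" "g m"] by simp
  \<comment> \<open>The ranks increase and are bounded, so from some index on the remaining increase
    is less than \<open>rk k\<close>.\<close>
  obtain N1 where N1: "rk (g n) - rk (g N1) < rk k" for n
  proof -
    let ?S = "SUP n. rk (g n)"
    have bdd: "bdd_above (range (\<lambda>n. rk (g n)))" using rk_le_one by (auto intro: bdd_aboveI[of _ 1])
    have "?S - rk k < ?S" using rk_pos kc k(4) by simp
    then obtain N where "?S - rk k < rk (g N)"
      using less_cSUP_iff[OF _ bdd, of "?S - rk k"] by auto
    moreover have "rk (g n) \<le> ?S" for n using cSUP_upper[OF _ bdd, of n] by simp
    ultimately have "rk (g n) - rk (g N) < rk k" for n by (smt (verit))
    then show thesis using that by blast
  qed
  define N where "N = max n0 N1"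
  have gap: "rk (g n) - rk (g N) < rk k" for n
    using N1[of n] mono_rk[of N1 N] by (simp add: N_def)
  have kg: "k \<otimes> g n = k" "g n \<otimes> k = k" if "N \<le> n" for n
  proof -
    have "n0 \<le> n" using that by (simp add: N_def)
    note m = mono[OF this]
    have "k \<otimes> g n = k \<otimes> (g n0 \<otimes> g n)" using mult_eq_assoc[OF k(3), of "g n"] kc by simp
    then show "k \<otimes> g n = k" using m k by simp
    have "g n \<otimes> k = g n \<otimes> (g n0 \<otimes> k)" using k by simp
    also have "\<dots> = g n0 \<otimes> k" using mult_eq_assoc[of "g n" "g n0" "g n0" k] m kc by simp
    finally show "g n \<otimes> k = k" using k by simp
  qed
  define D where "D n = g (N + n) \<ominus> g N" for n
  have D: "D n \<in> idempotents R" for n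
    unfolding D_def using mono[of N "N + n"] by (intro idem_minus idem) auto
  have Dc [simp]: "D n \<in> carrier R" for n using D by auto
  have kD: "k \<otimes> D n = \<zero>" "D n \<otimes> k = \<zero>" for n
    using kg[of N] kg[of "N + n"] kc by (simp_all add: D_def r_minus_distr l_minus_distr)
  have DD: "D n \<otimes> D m = D m" "D m \<otimes> D n = D m" if "m \<le> n" for m n
    using mono[of "N + m" "N + n"] mono[of N "N + m"] mono[of N "N + n"] mono[of N N] that
    by (simp_all add: D_def r_minus_distr l_minus_distr)
  have rkD: "rk (D n) = rk (g (N + n)) - rk (g N)" for n
    unfolding D_def using mono[of N "N + n"] by (intro rk_idem_minus idem) auto
  \<comment> \<open>\<open>Q n x\<close> makes left multiplication by \<open>x\<close> an injective
    map from \<open>D n R\<close> to \<open>k R\<close>; the condition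
    \<open>f (Suc n) \<otimes> D n = f n\<close> below makes each map extend the previous
    one.\<close>
  define Q where "Q n x \<longleftrightarrow> x \<in> carrier R \<and> k \<otimes> x = x \<and> x \<otimes> D n = x \<and> (\<exists>w\<in>carrier R. w \<otimes> x = D n)" for n x
  have "\<exists>f. \<forall>n. Q n (f n) \<and> f (Suc n) \<otimes> D n = f n"
  proof (rule dependent_nat_choice)
    have "D 0 = \<zero>" by (simp add: D_def)
    then have "Q 0 \<zero>" using kc by (auto simp: Q_def)
    then show "\<exists>x. Q 0 x" by blast
  next
    fix x n assume "Q n x"
    then obtain w0 where x: "x \<in> carrier R" "k \<otimes> x = x" "x \<otimes> D n = x" and w0: "w0 \<in> carrier R" "w0 \<otimes> x = D n"
      by (auto simp: Q_def)
    have inj: "D n \<otimes> s = \<zero>" if "s \<in> carrier R" "x \<otimes> s = \<zero>" for s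
      using mult_eq_assoc[OF w0(2), of s] that x w0 by simp
    obtain w where w: "w \<in> carrier R" "D n \<otimes> w = w" "w \<otimes> k = w" "w \<otimes> x = D n"
      using left_inverse_of_injective[OF x(1) D k(1) x(2,3) inj] by metis
    define p where "p = x \<otimes> w"
    define d where "d = D (Suc n) \<ominus> D n"
    have pc: "p \<in> carrier R" "d \<in> carrier R" using x w by (auto simp: p_def d_def)
    have d: "d \<in> idempotents R" unfolding d_def using DD[of n "Suc n"] by (intro idem_minus D) auto
    have Ddd: "D n \<oplus> d = D (Suc n)" unfolding d_def using Dc[of n] Dc[of "Suc n"] by algebra
    have kd: "k \<otimes> d = \<zero>" "d \<otimes> k = \<zero>" using kD kc by (simp_all add: d_def r_minus_distr l_minus_distr)
    have dD: "d \<otimes> D n = \<zero>" "d \<otimes> D (Suc n) = d"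
      using DD[of n "Suc n"] DD[of "Suc n" "Suc n"] DD[of n n] by (simp_all add: d_def l_minus_distr)
    have "p \<otimes> p = x \<otimes> (w \<otimes> x) \<otimes> w" using x(1) w(1) by (simp add: p_def m_assoc)
    then have p: "p \<in> idempotents R" using x w pc by (auto intro!: idemI simp: p_def)
    have pk: "k \<otimes> p = p" "p \<otimes> k = p"
      using mult_eq_assoc[OF x(2)] x(1) w(1,3) kc by (simp_all add: p_def m_assoc)
    have px: "p \<otimes> x = x" using x w by (simp add: p_def m_assoc)
    have pd: "p \<otimes> d = \<zero>" "d \<otimes> p = \<zero>"
    proof -
      have "p \<otimes> (k \<otimes> d) = p \<otimes> d" "d \<otimes> (k \<otimes> p) = \<zero> \<otimes> p"
        using mult_eq_assoc[OF pk(2)] mult_eq_assoc[OF kd(2)] pc kc by blast+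
      then show "p \<otimes> d = \<zero>" "d \<otimes> p = \<zero>"
        unfolding kd(1) pk(1) r_null[OF pc(1)] l_null[OF pc(1)] by simp_all
    qed
    define q where "q = k \<ominus> p"
    have q: "q \<in> idempotents R" unfolding q_def using idem_minus[OF k(1) p pk] .
    have qc: "q \<in> carrier R" using q by auto
    have qd: "q \<otimes> d = \<zero>" "d \<otimes> q = \<zero>"
      using kd pd kc pc by (simp_all add: q_def l_minus_distr r_minus_distr)
    have kq: "k \<otimes> q = q" "p \<otimes> q = \<zero>" "q \<otimes> x = \<zero>"
      using pk px idemD(2)[OF k(1)] idemD(2)[OF p] kc pc x by (simp_all add: q_def l_minus_distr r_minus_distr)
    have "\<not> embeds q d"
    proof
      assume "embeds q d"
      then have "rk q \<le> rk d" using embeds_rk q d by blast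
      moreover have "rk q = rk k - rk p" unfolding q_def using rk_idem_minus[OF k(1) p pk] .
      moreover have "rk p \<le> rk (D n)"
      proof -
        have "rk p \<le> rk w" using rk_mult_right x w by (simp add: p_def)
        also have "\<dots> \<le> rk (D n)" using rk_mult_left[OF Dc w(1), of n] w(2) by simp
        finally show ?thesis .
      qed
      moreover have "rk d = rk (D (Suc n)) - rk (D n)"
        unfolding d_def using DD[of n "Suc n"] by (intro rk_idem_minus D) auto
      moreover have "rk (D (Suc n)) < rk k" using rkD gap by simp
      ultimately show False by linarith
    qed
    then have "embeds d q" using comparability[OF d q qd(2,1)] by blast
    then obtain y v where y: "y \<in> carrier R" "q \<otimes> y = y" "y \<otimes> d = y" and v: "v \<in> carrier R" "v \<otimes> q = v" "v \<otimes> y = d"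
      unfolding embeds_def by blast
    have z: "w \<otimes> y = \<zero>" "v \<otimes> x = \<zero>" "k \<otimes> y = y" "x \<otimes> D (Suc n) = x" "y \<otimes> D (Suc n) = y" "y \<otimes> D n = \<zero>"
    proof -
      have "p \<otimes> y = \<zero>" using mult_eq_assoc[OF kq(2), of y] y pc qc by simp
      then have "x \<otimes> (w \<otimes> y) = \<zero>" using x w y by (simp add: p_def m_assoc)
      then have "D n \<otimes> (w \<otimes> y) = \<zero>" using mult_eq_assoc[OF w(4), of "w \<otimes> y"] x w y by simp
      then show "w \<otimes> y = \<zero>" using mult_eq_assoc[OF w(2), of y] w y by simp
      show "v \<otimes> x = \<zero>" using mult_eq_assoc[OF v(2), of x] kq v x qc by simp
      show "k \<otimes> y = y" using mult_eq_assoc[OF kq(1), of y] y kc qc by simp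
      show "x \<otimes> D (Suc n) = x" using mult_eq_assoc[OF x(3), of "D (Suc n)"] DD[of n "Suc n"] x by simp
      show "y \<otimes> D (Suc n) = y" "y \<otimes> D n = \<zero>"
        using mult_eq_assoc[OF y(3)] dD y pc by (metis Dc, metis Dc r_null)
    qed
    have "Q (Suc n) (x \<oplus> y)"
      unfolding Q_def
    proof (intro conjI bexI[of _ "w \<oplus> v"])
      show "(w \<oplus> v) \<otimes> (x \<oplus> y) = D (Suc n)"
        using z w v x y pc Ddd by (simp add: l_distr r_distr)
    qed (use x y z kc w v in \<open>simp_all add: l_distr r_distr\<close>)
    moreover have "(x \<oplus> y) \<otimes> D n = x" using x y z by (simp add: l_distr)
    ultimately show "\<exists>y. Q (Suc n) y \<and> y \<otimes> D n = x" by blast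
  qed
  then obtain X' where Q: "\<And>n. Q n (X' n)" and ext: "\<And>n. X' (Suc n) \<otimes> D n = X' n" by blast
  have Xc [simp]: "X' n \<in> carrier R" and X: "k \<otimes> X' n = X' n" "X' n \<otimes> D n = X' n" for n
    using Q[of n] by (auto simp: Q_def)
  have X_inj: "D n \<otimes> s = \<zero>" if "s \<in> carrier R" "X' n \<otimes> s = \<zero>" for n s
  proof -
    obtain w where "w \<in> carrier R" "w \<otimes> X' n = D n" using Q[of n] by (auto simp: Q_def)
    then show ?thesis using mult_eq_assoc[of w "X' n" "D n" s] that by simp
  qed
  have XD: "X' n \<otimes> D m = X' m" if "m \<le> n" for m n
    using that
  proof (induction n rule: dec_induct)
    case base
    then show ?case using X by simp
  next
    case (step n)
    have "X' (Suc n) \<otimes> D m = X' (Suc n) \<otimes> (D n \<otimes> D m)" using DD step by simp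
    also have "\<dots> = X' n \<otimes> D m" using mult_eq_assoc[OF ext[of n], of "D m"] by simp
    finally show ?case using step by simp
  qed
  have DX: "D n \<otimes> X' m = \<zero>" "X' n \<otimes> X' m = \<zero>" for m n
  proof -
    show DX: "D n \<otimes> X' m = \<zero>" for n m
      using mult_eq_assoc[OF kD(2)[of n], of "X' m"] X(1)[of m] kc by simp
    show "X' n \<otimes> X' m = \<zero>"
      using mult_eq_assoc[OF X(2)[of n], of "X' m"] DX[of n m] by simp
  qed
  \<comment> \<open>\<open>P n R\<close> is the graph of \<open>X' n\<close>; \<open>P n\<close> is
    idempotent because the \<open>X' m\<close> lie in \<open>k R\<close>, which all
    \<open>D n\<close> and \<open>X' n\<close> annihilate.\<close>
  define P where "P n = D n \<oplus> X' n" for n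
  have Pc [simp]: "P n \<in> carrier R" for n by (simp add: P_def)
  have PP: "P n \<otimes> P m = P m" if "m \<le> n" for m n
    using DX DD[OF that] XD[OF that] by (simp add: P_def l_distr r_distr)
  have P: "P n \<in> idempotents R" for n using PP[of n n] by (intro idemI) auto
  have ch: "chain_idem (range P)"
    unfolding chain_idem_def using P PP by (auto simp: image_iff) (metis nat_le_linear)
  obtain F where F: "is_join (range P) F" using join_exists P by (metis image_subsetI)
  have Fi: "F \<in> idempotents R" "\<And>n. F \<otimes> P n = P n"
    "\<And>x. x \<in> carrier R \<Longrightarrow> (\<And>n. x \<otimes> P n = \<zero>) \<Longrightarrow> x \<otimes> F = \<zero>"
    using F by (auto simp: is_join_def)
  have Fc: "F \<in> carrier R" using Fi by auto
  define H where "H = G \<ominus> g N"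
  have H: "H \<in> idempotents R" unfolding H_def using Gi by (intro idem_minus idem) auto
  have Hc: "H \<in> carrier R" using H by auto
  have Gk: "G \<otimes> k = k" "k \<otimes> G = k"
  proof -
    show "G \<otimes> k = k" using mult_eq_assoc[OF Gi(2)[of n0], of k] k Gc kc by simp
    show "k \<otimes> G = k" using mult_eq_assoc[OF k(3), of G] Gi(3) k Gc kc by simp
  qed
  have kH: "k \<otimes> H = \<zero>" "H \<otimes> k = \<zero>"
    using Gk kg[of N] Gc kc by (simp_all add: H_def l_minus_distr r_minus_distr)
  have HD: "H \<otimes> D n = D n" for n
    using Gi(2) mono[of N "N + n"] mono[of N N] Gc by (simp add: H_def D_def l_minus_distr r_minus_distr)
  have HX: "H \<otimes> X' n = \<zero>" for n
    using mult_eq_assoc[OF kH(2), of "X' n"] X(1)[of n] kc Hc by simp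
  have HP: "H \<otimes> P n = D n" for n using HD HX Hc by (simp add: P_def r_distr)
  have kP: "k \<otimes> P n = X' n" for n using kD X kc by (simp add: P_def r_distr)
  \<comment> \<open>The graph of an injective map contains no non-zero vector with vanishing
    \<open>k\<close>-component, so \<open>P n R\<close> meets \<open>H R\<close> trivially; upper
    continuity passes this to the join.\<close>
  have FH: "y = \<zero>" if y: "y \<in> carrier R" "F \<otimes> y = y" "H \<otimes> y = y" for y
  proof -
    have "y = \<zero>" if y: "y \<in> carrier R" "P n \<otimes> y = y" "H \<otimes> y = y" for n y
    proof -
      have "k \<otimes> y = \<zero>" using mult_eq_assoc[OF kH(1), of y] y kc Hc by simp
      then have "X' n \<otimes> y = \<zero>" using mult_eq_assoc[OF kP[of n], of y] y kc by simp
      moreover from this have "D n \<otimes> y = \<zero>" using X_inj y by blast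
      ultimately show ?thesis using y by (simp add: P_def l_distr)
    qed
    then have "\<forall>e\<in>range P. \<forall>y\<in>carrier R. e \<otimes> y = y \<longrightarrow> H \<otimes> y = y \<longrightarrow> y = \<zero>" by blast
    then show ?thesis using F ch H y unfolding is_join_def by blast
  qed
  \<comment> \<open>The join of the graphs projects onto \<open>H R\<close>: \<open>c\<close> kills
    \<open>H F\<close>, hence every \<open>D n\<close>, hence \<open>H\<close> by the defining
    property of the limit.\<close>
  obtain w where w: "w \<in> carrier R" "H \<otimes> F \<otimes> w \<otimes> (H \<otimes> F) = H \<otimes> F"
    using quasi_inverse'[of "H \<otimes> F"] Hc Fc by (metis m_closed)
  define c where "c = \<one> \<ominus> H \<otimes> F \<otimes> w"
  have cc: "c \<in> carrier R" using Hc Fc w by (simp add: c_def)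
  have cHF: "c \<otimes> (H \<otimes> F) = \<zero>" using Hc Fc w by (simp add: c_def l_minus_distr)
  have cD: "c \<otimes> D n = \<zero>" for n
  proof -
    have "c \<otimes> D n = c \<otimes> (H \<otimes> (F \<otimes> P n))" using HP Fi by simp
    also have "\<dots> = c \<otimes> (H \<otimes> F) \<otimes> P n" using cc Hc Fc by (simp add: m_assoc)
    finally show ?thesis using cHF by simp
  qed
  have "c \<otimes> (\<one> \<ominus> g N) \<otimes> g n = \<zero>" for n
  proof (cases "n \<le> N")
    case True
    then have "(\<one> \<ominus> g N) \<otimes> g n = \<zero>" using mono by (simp add: l_minus_distr)
    then show ?thesis using cc by (simp add: m_assoc)
  next
    case False
    then have "(\<one> \<ominus> g N) \<otimes> g n = D (n - N)" using mono[of N n] by (simp add: l_minus_distr D_def)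
    then show ?thesis using cc cD by (simp add: m_assoc)
  qed
  then have "c \<otimes> (\<one> \<ominus> g N) \<otimes> G = \<zero>" using cc by (intro Gzero) auto
  moreover have "(\<one> \<ominus> g N) \<otimes> G = H" using Gi Gc by (simp add: H_def l_minus_distr)
  ultimately have "c \<otimes> H = \<zero>" using cc Gc by (simp add: m_assoc)
  then have HH: "H \<otimes> F \<otimes> w \<otimes> H = H" using Hc Fc w by (simp add: c_def l_minus_distr)
  define x where "x = k \<otimes> (F \<otimes> (w \<otimes> H))"
  have x: "x \<in> carrier R" "k \<otimes> x = x" "x \<otimes> H = x"
    using mult_eq_assoc[OF idemD(2)[OF k(1)]] idemD(2)[OF H] kc Fc w Hc by (simp_all add: x_def m_assoc)
  have "H \<otimes> s = \<zero>" if s: "s \<in> carrier R" "x \<otimes> s = \<zero>" for s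
  proof -
    define v where "v = F \<otimes> (w \<otimes> (H \<otimes> s))"
    have v: "v \<in> carrier R" "F \<otimes> v = v"
      using mult_eq_assoc[OF idemD(2)[OF Fi(1)]] Fc w Hc s by (simp_all add: v_def)
    have kv: "k \<otimes> v = \<zero>" using s kc Fc w Hc by (simp add: v_def x_def m_assoc)
    have "(\<one> \<ominus> (H \<oplus> k)) \<otimes> F = \<zero>"
      by (rule Fi(3)) (use HP kP Hc kc in \<open>simp_all add: l_minus_distr l_distr P_def[symmetric]\<close>)
    then have "(H \<oplus> k) \<otimes> F = F" using Hc kc Fc by (simp add: l_minus_distr)
    then have "(H \<oplus> k) \<otimes> v = v" using mult_eq_assoc[of "H \<oplus> k" F F v] v Hc kc Fc by simp
    then have "H \<otimes> v = v" using kv v Hc kc by (simp add: l_distr)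
    then have "v = \<zero>" using FH v by blast
    have "H \<otimes> s = H \<otimes> F \<otimes> w \<otimes> H \<otimes> s" using HH by simp
    also have "\<dots> = H \<otimes> v" using Hc Fc w s by (simp add: v_def m_assoc)
    finally show ?thesis using \<open>v = \<zero>\<close> Hc by simp
  qed
  then obtain u where "u \<in> carrier R" "H \<otimes> u = u" "u \<otimes> k = u" "u \<otimes> x = H"
    using left_inverse_of_injective[OF x(1) H k(1) x(2,3)] by metis
  then have "embeds H k" using x unfolding embeds_def by blast
  then have "rk H \<le> rk k" using embeds_rk H k by blast
  moreover have "rk H = rk G - rk (g N)"
    unfolding H_def using Gi by (intro rk_idem_minus idem) auto
  ultimately show False using far[of N] k(5) by linarith
qed

end

section \<open>Polynomials over the centre\<close>

context ring
begin

lemma center_closed: "z \<in> ring_center R \<Longrightarrow> z \<in> carrier R"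
  by (simp add: ring_center_def)

lemma center_commute: "z \<in> ring_center R \<Longrightarrow> x \<in> carrier R \<Longrightarrow> x \<otimes> z = z \<otimes> x"
  by (simp add: ring_center_def)

lemma center_left_commute:
  assumes "z \<in> ring_center R" "x \<in> carrier R" "y \<in> carrier R"
  shows "x \<otimes> (z \<otimes> y) = z \<otimes> (x \<otimes> y)"
  using assms center_commute center_closed by (metis m_assoc)

lemma zero_center [simp]: "\<zero> \<in> ring_center R"
  and one_center [simp]: "\<one> \<in> ring_center R"
  by (auto simp: ring_center_def)

lemma uminus_center: "z \<in> ring_center R \<Longrightarrow> \<ominus> z \<in> ring_center R"
  by (auto simp: ring_center_def l_minus r_minus)

lemma subring_center: "subring (ring_center R) R"
proof (rule subringI)
  show "h1 \<otimes> h2 \<in> ring_center R" if "h1 \<in> ring_center R" "h2 \<in> ring_center R" for h1 h2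
  proof -
    note z = that
    have c: "h1 \<in> carrier R" "h2 \<in> carrier R" using that center_closed by auto
    have "h1 \<otimes> h2 \<otimes> x = x \<otimes> (h1 \<otimes> h2)" if "x \<in> carrier R" for x
      using c that center_commute[OF z(2) that] center_left_commute[OF z(1) that c(2)]
      by (simp add: m_assoc)
    then show ?thesis using c by (auto simp: ring_center_def)
  qed
  show "h1 \<oplus> h2 \<in> ring_center R" if "h1 \<in> ring_center R" "h2 \<in> ring_center R" for h1 h2
    using that by (auto simp: ring_center_def l_distr r_distr)
qed (auto simp: center_closed uminus_center)

lemma commute_mult:
  assumes "x \<in> carrier R" "y \<in> carrier R" "z \<in> carrier R" "x \<otimes> y = y \<otimes> x" "x \<otimes> z = z \<otimes> x"
  shows "x \<otimes> (y \<otimes> z) = y \<otimes> z \<otimes> x"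
  using assms by (metis m_assoc)

lemma commute_left:
  assumes "x \<in> carrier R" "y \<in> carrier R" "x \<otimes> y = y \<otimes> x" "t \<in> carrier R"
  shows "x \<otimes> (y \<otimes> t) = y \<otimes> (x \<otimes> t)"
  using assms by (metis m_assoc)

lemma commute_pow:
  assumes "x \<in> carrier R" "y \<in> carrier R" "x \<otimes> y = y \<otimes> x"
  shows "x \<otimes> y [^] (n::nat) = y [^] n \<otimes> x"
  by (induction n) (use assms commute_mult in simp_all)

lemma pow_mult_self: "x \<in> carrier R \<Longrightarrow> x [^] (n::nat) \<otimes> x = x \<otimes> x [^] n"
  using commute_pow[of x x n] by simp

lemma pow_Suc_apply:
  "x \<in> carrier R \<Longrightarrow> y \<in> carrier R \<Longrightarrow> x [^] Suc n \<otimes> y = x \<otimes> (x [^] n \<otimes> y)"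
  by (simp add: pow_mult_self m_assoc)

text \<open>The monic polynomial of degree \<open>d\<close> in \<open>a\<close> with lower coefficients \<open>q 0, \<dots>, q (d - 1)\<close>, listed
  from the highest power downwards.\<close>

primrec horner :: "'a \<Rightarrow> (nat \<Rightarrow> 'a) \<Rightarrow> nat \<Rightarrow> 'a" where
  "horner a q 0 = \<one>"
| "horner a q (Suc m) = a \<otimes> horner a q m \<oplus> q m"

text \<open>Divided-difference construction: it turns an arbitrary \<open>v\<close> into an element commuting with \<open>a\<close>, up
  to the commutator of \<open>v\<close> with the polynomial in \<open>a\<close>.\<close>

primrec casimir :: "'a \<Rightarrow> (nat \<Rightarrow> 'a) \<Rightarrow> 'a \<Rightarrow> nat \<Rightarrow> 'a" where
  "casimir a q v 0 = \<zero>"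
| "casimir a q v (Suc m) = a \<otimes> casimir a q v m \<oplus> v \<otimes> horner a q m"

lemma horner_closed [simp]:
  "a \<in> carrier R \<Longrightarrow> (\<And>j. q j \<in> ring_center R) \<Longrightarrow> horner a q m \<in> carrier R"
  by (induction m) (auto simp: center_closed)

lemma casimir_closed [simp]:
  "a \<in> carrier R \<Longrightarrow> (\<And>j. q j \<in> ring_center R) \<Longrightarrow> v \<in> carrier R \<Longrightarrow> casimir a q v m \<in> carrier R"
  by (induction m) auto

lemma horner_commute:
  assumes a: "a \<in> carrier R" "\<And>j. q j \<in> ring_center R" and x: "x \<in> carrier R" "x \<otimes> a = a \<otimes> x"
  shows "x \<otimes> horner a q m = horner a q m \<otimes> x"
proof (induction m)
  case (Suc m)
  show ?case
    using commute_mult[OF x(1) a(1) _ x(2) Suc] a x(1) center_commute[OF a(2)] center_closed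
    by (simp add: r_distr l_distr)
qed (use x in simp)

lemma horner_zero: "a \<in> carrier R \<Longrightarrow> horner a (\<lambda>_. \<zero>) m = a [^] m"
  by (induction m) (simp_all add: pow_mult_self)

text \<open>If \<open>u\<close> kills the lower terms, a monic polynomial acts as its leading power.
  Each inductive step moves one factor \<open>a\<close> into \<open>u\<close>, which is therefore
  generalised.\<close>

lemma horner_apply:
  assumes a: "a \<in> carrier R" "\<And>j. q j \<in> ring_center R" and x: "x \<in> carrier R" "u \<in> carrier R"
    and zero: "\<And>i. i < m \<Longrightarrow> u \<otimes> (a [^] i \<otimes> x) = \<zero>"
  shows "u \<otimes> (horner a q m \<otimes> x) = u \<otimes> (a [^] m \<otimes> x)"
  using x(2) zero
proof (induction m arbitrary: u)
  case (Suc m)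
  have qc: "q m \<in> carrier R" using a center_closed by blast
  have "u \<otimes> a \<otimes> (horner a q m \<otimes> x) = u \<otimes> a \<otimes> (a [^] m \<otimes> x)"
  proof (rule Suc.IH)
    show "u \<otimes> a \<otimes> (a [^] i \<otimes> x) = \<zero>" if "i < m" for i
      using Suc.prems(2)[of "Suc i"] that Suc.prems(1) a x pow_Suc_apply[of a x i]
      by (simp add: m_assoc del: nat_pow_Suc)
  qed (use Suc.prems a in auto)
  moreover have "u \<otimes> (q m \<otimes> x) = \<zero>"
    using Suc.prems(2)[of 0] center_left_commute[OF a(2) Suc.prems(1) x(1)] x qc by simp
  ultimately show ?case
    using Suc.prems(1) a x qc by (simp add: l_distr r_distr pow_mult_self m_assoc)
qed simp

lemma finsum_lessThan_Suc_shift: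
  assumes "f \<in> {..<Suc m} \<rightarrow> carrier R"
  shows "(\<Oplus>i\<in>{..<Suc m}. f i) = f 0 \<oplus> (\<Oplus>i\<in>{..<m}. f (Suc i))"
proof -
  have "(\<Oplus>i\<in>{..<Suc m}. f i) = f 0 \<oplus> (\<Oplus>i\<in>Suc ` {..<m}. f i)"
    unfolding lessThan_Suc_eq_insert_0 using assms by (subst finsum_insert) auto
  also have "(\<Oplus>i\<in>Suc ` {..<m}. f i) = (\<Oplus>i\<in>{..<m}. f (Suc i))"
    using assms by (intro finsum_reindex) auto
  finally show ?thesis .
qed

lemma finsum_lessThan_Suc:
  assumes "f \<in> {..<Suc m} \<rightarrow> carrier R"
  shows "(\<Oplus>i\<in>{..<Suc m}. f i) = f m \<oplus> (\<Oplus>i\<in>{..<m}. f i)"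
  unfolding lessThan_Suc using assms by (subst finsum_insert) auto

lemma horner_expand:
  assumes a: "a \<in> carrier R" "\<And>j. q j \<in> ring_center R"
  shows "horner a q m = a [^] m \<oplus> (\<Oplus>i\<in>{..<m}. q (m - 1 - i) \<otimes> a [^] i)"
proof (induction m)
  case (Suc m)
  have qc: "q j \<in> carrier R" for j using a center_closed by blast
  have "(\<Oplus>i\<in>{..<Suc m}. q (Suc m - 1 - i) \<otimes> a [^] i) =
      q m \<oplus> (\<Oplus>i\<in>{..<m}. q (m - 1 - i) \<otimes> a [^] Suc i)"
    using a qc by (subst finsum_lessThan_Suc_shift) auto
  also have "(\<Oplus>i\<in>{..<m}. q (m - 1 - i) \<otimes> a [^] Suc i) = (\<Oplus>i\<in>{..<m}. a \<otimes> (q (m - 1 - i) \<otimes> a [^] i))"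
    using a qc center_left_commute[OF a(2) a(1)]
    by (intro finsum_cong') (auto simp: pow_mult_self)
  also have "\<dots> = a \<otimes> (\<Oplus>i\<in>{..<m}. q (m - 1 - i) \<otimes> a [^] i)"
    using a qc by (subst finsum_rdistr) auto
  finally show ?case
    using Suc a qc by (simp add: r_distr pow_mult_self a_ac finsum_closed Pi_def)
qed (use a in simp)

text \<open>The sum telescopes because the coefficients are central. Hence
  \<open>casimir a q v m\<close> commutes with \<open>a\<close> as soon as \<open>v\<close> commutes
  with \<open>horner a q m\<close>.\<close>

lemma casimir_commute:
  assumes a: "a \<in> carrier R" "\<And>j. q j \<in> ring_center R" and v: "v \<in> carrier R"
  shows "a \<otimes> casimir a q v m \<ominus> casimir a q v m \<otimes> a = horner a q m \<otimes> v \<ominus> v \<otimes> horner a q m"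
proof (induction m)
  case (Suc m)
  let ?C = "casimir a q v m" and ?H = "horner a q m"
  have c: "?C \<in> carrier R" "?H \<in> carrier R" "q m \<in> carrier R" using a v center_closed by auto
  have aH: "a \<otimes> ?H = ?H \<otimes> a" by (rule horner_commute) (use a in auto)
  have qv: "v \<otimes> q m = q m \<otimes> v" using center_commute a v by blast
  have "a \<otimes> casimir a q v (Suc m) \<ominus> casimir a q v (Suc m) \<otimes> a =
      a \<otimes> (a \<otimes> ?C \<ominus> ?C \<otimes> a) \<oplus> (a \<otimes> (v \<otimes> ?H) \<ominus> v \<otimes> (?H \<otimes> a))"
    using a(1) v c by (simp, algebra)
  also have "\<dots> = a \<otimes> (?H \<otimes> v) \<ominus> v \<otimes> (?H \<otimes> a)"
    unfolding Suc using a(1) v c by algebra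
  also have "\<dots> = a \<otimes> ?H \<otimes> v \<ominus> v \<otimes> (a \<otimes> ?H)"
    unfolding aH using a(1) v c aH by (simp add: m_assoc[symmetric])
  also have "\<dots> = (a \<otimes> ?H \<oplus> q m) \<otimes> v \<ominus> v \<otimes> (a \<otimes> ?H \<oplus> q m)"
    using qv a(1) v c by algebra
  finally show ?case by simp
qed (use a v in simp)

text \<open>Besides confining the construction to a corner, this yields idempotency: an element
  built by \<open>casimir\<close> that commutes with \<open>a\<close> and fixes \<open>v\<close>
  fixes itself.\<close>

lemma casimir_left:
  assumes a: "a \<in> carrier R" "\<And>j. q j \<in> ring_center R" and v: "v \<in> carrier R"
    and x: "x \<in> carrier R" "x \<otimes> a = a \<otimes> x" "x \<otimes> v = v"
  shows "x \<otimes> casimir a q v m = casimir a q v m"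
proof (induction m)
  case (Suc m)
  then show ?case
    using a v x commute_left[OF x(1) a(1) x(2)] mult_eq_assoc[OF x(3)] by (simp add: r_distr)
qed (use x in simp)

lemma casimir_right:
  assumes a: "a \<in> carrier R" "\<And>j. q j \<in> ring_center R" and v: "v \<in> carrier R"
    and x: "x \<in> carrier R" "x \<otimes> a = a \<otimes> x" "v \<otimes> x = v"
  shows "casimir a q v m \<otimes> x = casimir a q v m"
proof (induction m)
  case (Suc m)
  have "v \<otimes> (horner a q m \<otimes> x) = v \<otimes> horner a q m"
    using horner_commute[of a q x m, OF a x(1,2), symmetric] mult_eq_assoc[OF x(3)] a v x(1) by simp
  then show ?case
    using Suc a v x(1) by (simp add: l_distr m_assoc)
qed (use x in simp)

end

text \<open>Each of the \<open>m\<close> summands has a factor \<open>v\<close>; this is what keeps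
  the averaged projection small.\<close>

lemma (in rank_ring) casimir_rk:
  assumes a: "a \<in> carrier R" "\<And>j. q j \<in> ring_center R" and v: "v \<in> carrier R"
  shows "rk (casimir a q v m) \<le> real m * rk v"
proof (induction m)
  case (Suc m)
  have "rk (casimir a q v (Suc m)) \<le> rk (a \<otimes> casimir a q v m) + rk (v \<otimes> horner a q m)"
    using rk_plus_le a v by simp
  also have "\<dots> \<le> rk (casimir a q v m) + rk v"
    using rk_mult_right[of a "casimir a q v m"] rk_mult_left[of v "horner a q m"] a v by simp
  finally show ?case using Suc by (simp add: algebra_simps)
qed simp

lemma (in irreducible_continuous_ring) subfield_center: "subfield (ring_center R) R"
proof (rule subfieldI)
  show "subcring (ring_center R) R"
    using subring_center center_commute center_closed by (intro subcringI) auto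
  have ne: "\<one> \<noteq> \<zero>"
    using irreducible one_zeroD unfolding irreducible_ring_def by blast
  show "Units (R\<lparr>carrier := ring_center R\<rparr>) = ring_center R - {\<zero>}"
  proof (intro equalityI subsetI)
    fix z assume "z \<in> Units (R\<lparr>carrier := ring_center R\<rparr>)"
    then obtain w where "z \<in> ring_center R" "w \<in> ring_center R" "w \<otimes> z = \<one>" by (auto simp: Units_def)
    then show "z \<in> ring_center R - {\<zero>}" using ne center_closed by (auto simp: r_null)
  next
    fix z assume "z \<in> ring_center R - {\<zero>}"
    then show "z \<in> Units (R\<lparr>carrier := ring_center R\<rparr>)"
      using center_inverse[of z] by (auto simp: Units_def)
  qed
qed

section \<open>Polynomials in an algebraic element\<close>

context irreducible_continuous_ring
begin

text \<open>Bounds the dimension of a span by the number of generators, in the form that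
  \<open>independent_length_le\<close> can use.\<close>

lemma independent_subfamily:
  assumes "set Us \<subseteq> carrier R"
  shows "\<exists>Ws. independent (ring_center R) Ws \<and>
    Span (ring_center R) Ws = Span (ring_center R) Us \<and> length Ws \<le> length Us"
  using assms
proof (induction Us)
  case Nil
  then show ?case by (intro exI[of _ "[]"]) auto
next
  case (Cons u Us)
  let ?K = "ring_center R"
  note K = subfield_center
  obtain Ws where Ws: "independent ?K Ws" "Span ?K Ws = Span ?K Us" "length Ws \<le> length Us"
    using Cons by auto
  have c: "u \<in> carrier R" "set Us \<subseteq> carrier R" using Cons by auto
  show ?case
  proof (cases "u \<in> Span ?K Us")
    case True
    have "Span ?K (u # Us) \<subseteq> Span ?K Us"
      using mono_Span_subset[OF K] True Span_base_incl[OF K c(2)] c(2) by (metis insert_subset list.simps(15))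
    then have "Span ?K (u # Us) = Span ?K Us" using mono_Span[OF K c(2,1)] by blast
    then show ?thesis using Ws by (metis le_SucI length_Cons)
  next
    case False
    then have "independent ?K (u # Ws)" using li_Cons[OF c(1) _ Ws(1)] Ws(2) by simp
    moreover have "Span ?K (u # Ws) = Span ?K (u # Us)" using Ws(2) by simp
    ultimately show ?thesis using Ws(3) by (metis Suc_le_mono length_Cons)
  qed
qed

text \<open>The relation \<open>horner a p n \<otimes> h = \<zero>\<close> rewrites
  \<open>a [^] n \<otimes> h\<close> through lower powers, so the finite-dimensional span is stable
  under \<open>a\<close> and under every polynomial in \<open>a\<close>.\<close>

lemma span_horner_closed:
  assumes a: "a \<in> carrier R" and h: "h \<in> carrier R"
    and p: "\<And>j. p j \<in> ring_center R" "horner a p n \<otimes> h = \<zero>"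
    and q: "\<And>j. q j \<in> ring_center R"
    and x: "x \<in> Span (ring_center R) (map (\<lambda>i. a [^] i \<otimes> h) [0..<n])"
  shows "horner a q d \<otimes> x \<in> Span (ring_center R) (map (\<lambda>i. a [^] i \<otimes> h) [0..<n])"
proof -
  let ?K = "ring_center R"
  let ?Us = "map (\<lambda>i. a [^] i \<otimes> h) [0..<n]"
  let ?E = "Span ?K ?Us"
  note K = subfield_center
  have Us: "set ?Us \<subseteq> carrier R" using a h by auto
  have Ec: "y \<in> carrier R" if "y \<in> ?E" for y using Span_in_carrier[OF _ Us] that center_closed by blast
  have sg: "subgroup ?E (add_monoid R)" using Span_subgroup_props[OF K Us] 
    by (intro add.subgroupI) (auto simp del: Span.simps)
  have smult: "k \<otimes> y \<in> ?E" if "k \<in> ?K" "y \<in> ?E" for k y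
    using Span_smult_closed[OF K Us] that by blast
  have Eplus: "y \<oplus> z \<in> ?E" if "y \<in> ?E" "z \<in> ?E" for y z
    using subgroup.m_closed[OF sg] that by simp
  have Einv: "\<ominus> y \<in> ?E" if "y \<in> ?E" for y
    using subgroup.m_inv_closed[OF sg] that Ec by (simp add: a_inv_def[symmetric] del: Span.simps)
  have Ezero: "\<zero> \<in> ?E" using subgroup.one_closed[OF sg] by simp
  have pow: "a [^] i \<otimes> h \<in> ?E" if "i \<le> n" for i
  proof (cases "i < n")
    case True
    then show ?thesis using Span_base_incl[OF K Us] by (auto simp del: Span.simps)
  next
    case False
    then have "i = n" using that by simp
    have small: "a [^] i \<otimes> h \<in> ?E" if "i < n" for i
      using that Span_base_incl[OF K Us] by (auto simp del: Span.simps)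
    have pc: "p j \<in> carrier R" for j using p center_closed by blast
    have "(\<Oplus>i\<in>A. p (n - 1 - i) \<otimes> (a [^] i \<otimes> h)) \<in> ?E" if "finite A" "A \<subseteq> {..<n}" for A
      using that
    proof (induction A rule: finite_induct)
      case (insert i A)
      then show ?case
        using pc a h smult[OF p(1) small] Eplus by (subst finsum_insert) (auto simp del: Span.simps)
    qed (use Ezero in simp)
    then have S: "(\<Oplus>i\<in>{..<n}. p (n - 1 - i) \<otimes> (a [^] i \<otimes> h)) \<in> ?E" by blast
    have "\<zero> = (a [^] n \<oplus> (\<Oplus>i\<in>{..<n}. p (n - 1 - i) \<otimes> a [^] i)) \<otimes> h"
      using p(2) horner_expand[of a p n, OF a p(1)] by simp
    also have "\<dots> = a [^] n \<otimes> h \<oplus> (\<Oplus>i\<in>{..<n}. p (n - 1 - i) \<otimes> a [^] i) \<otimes> h"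
      using a h pc by (simp add: l_distr finsum_closed Pi_def)
    also have "(\<Oplus>i\<in>{..<n}. p (n - 1 - i) \<otimes> a [^] i) \<otimes> h = (\<Oplus>i\<in>{..<n}. p (n - 1 - i) \<otimes> (a [^] i \<otimes> h))"
      using a h pc by (subst finsum_ldistr) (auto simp: m_assoc intro!: finsum_cong')
    finally have "a [^] n \<otimes> h = \<ominus> (\<Oplus>i\<in>{..<n}. p (n - 1 - i) \<otimes> (a [^] i \<otimes> h))"
      using a h Ec[OF S] by (metis minus_equality m_closed nat_pow_closed)
    then show ?thesis using Einv[OF S] \<open>i = n\<close> by simp
  qed
  have aE: "a \<otimes> y \<in> ?E" if "y \<in> ?E" for y
  proof -
    define E' where "E' = {y \<in> carrier R. a \<otimes> y \<in> ?E}"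
    have "subgroup E' (add_monoid R)"
      using a Eplus Einv Ezero by (intro add.subgroupI) (auto simp: E'_def r_distr r_minus simp del: Span.simps)
    moreover have "?K <#> set ?Us \<subseteq> E'"
    proof
      fix y assume "y \<in> ?K <#> set ?Us"
      then obtain k i where ki: "k \<in> ?K" "i < n" "y = k \<otimes> (a [^] i \<otimes> h)" by (auto simp: set_mult_def)
      have "a \<otimes> y = k \<otimes> (a [^] Suc i \<otimes> h)"
        using ki a h center_left_commute[OF ki(1) a] by (simp add: pow_mult_self m_assoc)
      also have "\<dots> \<in> ?E" using ki by (intro smult pow) auto
      finally show "y \<in> E'" using ki a h center_closed by (auto simp: E'_def simp del: Span.simps)
    qed
    ultimately have "?E \<subseteq> E'" using Span_min[OF K Us] by blast
    then show ?thesis using that by (auto simp: E'_def simp del: Span.simps)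
  qed
  show ?thesis
  proof (induction d)
    case (Suc d)
    have "horner a q (Suc d) \<otimes> x = a \<otimes> (horner a q d \<otimes> x) \<oplus> q d \<otimes> x"
      using a q Ec[OF x] center_closed by (simp add: l_distr m_assoc del: Span.simps)
    then show ?case using Eplus[OF aE[OF Suc] smult[OF q x]] by simp
  qed (use x Ec[OF x] in \<open>simp del: Span.simps\<close>)
qed

text \<open>\<open>s\<close> is a polynomial in \<open>N\<close>; what is kept of this is that it
  commutes with everything that commutes with \<open>N\<close>.\<close>

lemma combine_powers:
  assumes N: "N \<in> carrier R" and h: "h \<in> carrier R" and Ks: "set Ks \<subseteq> ring_center R"
  shows "\<exists>s\<in>carrier R. (\<forall>x\<in>carrier R. x \<otimes> N = N \<otimes> x \<longrightarrow> x \<otimes> s = s \<otimes> x) \<and>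
    combine Ks (map (\<lambda>j. N [^] j \<otimes> h) [l..<l+m]) = N [^] l \<otimes> (s \<otimes> h)"
  using Ks
proof (induction Ks arbitrary: l m)
  case Nil
  then show ?case using N h by (intro bexI[of _ \<zero>]) auto
next
  case (Cons k Ks)
  show ?case
  proof (cases m)
    case 0
    then show ?thesis using N h by (intro bexI[of _ \<zero>]) auto
  next
    case (Suc m')
    have k: "k \<in> ring_center R" "k \<in> carrier R" using Cons.prems center_closed by auto
    obtain s where s: "s \<in> carrier R" "\<forall>x\<in>carrier R. x \<otimes> N = N \<otimes> x \<longrightarrow> x \<otimes> s = s \<otimes> x"
      "combine Ks (map (\<lambda>j. N [^] j \<otimes> h) [Suc l..<Suc l+m']) = N [^] Suc l \<otimes> (s \<otimes> h)"
      using Cons.IH[of "Suc l" m'] Cons.prems by auto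
    have "[l..<l+m] = l # [Suc l..<Suc l+m']" using Suc by (simp add: upt_rec)
    then have "combine (k # Ks) (map (\<lambda>j. N [^] j \<otimes> h) [l..<l+m]) = k \<otimes> (N [^] l \<otimes> h) \<oplus> N [^] Suc l \<otimes> (s \<otimes> h)"
      using s(3) by simp
    also have "\<dots> = N [^] l \<otimes> ((k \<oplus> N \<otimes> s) \<otimes> h)"
      using N h k s(1) center_left_commute[OF k(1), of "N [^] l" h] by (simp add: l_distr r_distr m_assoc)
    finally have eq: "combine (k # Ks) (map (\<lambda>j. N [^] j \<otimes> h) [l..<l+m]) = N [^] l \<otimes> ((k \<oplus> N \<otimes> s) \<otimes> h)" .
    have "x \<otimes> (k \<oplus> N \<otimes> s) = (k \<oplus> N \<otimes> s) \<otimes> x" if "x \<in> carrier R" "x \<otimes> N = N \<otimes> x" for x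
    proof -
      have "x \<otimes> (N \<otimes> s) = N \<otimes> s \<otimes> x" using commute_mult[OF that(1) N s(1) that(2)] s(2) that by blast
      then show ?thesis using that(1) N k s(1) center_commute[OF k(1) that(1)] by (simp add: l_distr r_distr)
    qed
    then show ?thesis using eq k(2) N s(1) by (intro bexI[of _ "k \<oplus> N \<otimes> s"]) auto
  qed
qed

text \<open>The \<open>n + 1\<close> vectors \<open>N [^] j \<otimes> h\<close> lie in a space of
  dimension at most \<open>n\<close>. In a linear relation between them the first non-zero
  coefficient, at index \<open>j\<close>, is inverted, which expresses
  \<open>N [^] j \<otimes> h\<close> through higher powers.\<close>

lemma power_absorbs:
  assumes a: "a \<in> carrier R" and h: "h \<in> carrier R" "h \<noteq> \<zero>"
    and p: "\<And>j. p j \<in> ring_center R" "horner a p n \<otimes> h = \<zero>"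
    and q: "\<And>j. q j \<in> ring_center R" and N: "N = horner a q d"
  obtains j u where "u \<in> carrier R" "\<And>x. x \<in> carrier R \<Longrightarrow> x \<otimes> N = N \<otimes> x \<Longrightarrow> x \<otimes> u = u \<otimes> x"
    "N [^] j \<otimes> h = N [^] Suc j \<otimes> (u \<otimes> h)"
proof -
  let ?K = "ring_center R"
  let ?Us = "map (\<lambda>i. a [^] i \<otimes> h) [0..<n]"
  let ?Vs = "map (\<lambda>j. N [^] j \<otimes> h) [0..<Suc n]"
  note K = subfield_center
  have Nc: "N \<in> carrier R" using N a q by simp
  have Us: "set ?Us \<subseteq> carrier R" using a h by auto
  have "n \<noteq> 0" using p(2) h by (cases n) auto
  then have h0: "h \<in> Span ?K ?Us"
    using Span_base_incl[OF K Us] h(1) by (force simp del: Span.simps simp: image_iff)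
  have "N [^] j \<otimes> h \<in> Span ?K ?Us" for j :: nat
  proof (induction j)
    case (Suc j)
    have "N [^] Suc j \<otimes> h = horner a q d \<otimes> (N [^] j \<otimes> h)"
      using pow_Suc_apply[OF Nc h(1), of j] N by simp
    then show ?case using span_horner_closed[where p = p and q = q, OF a h(1) p q Suc] by simp
  qed (use h0 h(1) in \<open>simp del: Span.simps\<close>)
  then have sub: "set ?Vs \<subseteq> Span ?K ?Us" by auto
  have Vs: "set ?Vs \<subseteq> carrier R" using Nc h by auto
  have "\<not> independent ?K ?Vs"
  proof
    assume ind: "independent ?K ?Vs"
    obtain Ws where Ws: "independent ?K Ws" "Span ?K Ws = Span ?K ?Us" "length Ws \<le> length ?Us"
      using independent_subfamily[OF Us] by blast
    moreover have "length ?Vs \<le> length Ws" using independent_length_le[OF K ind Ws(1)] sub Ws(2) by blast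
    ultimately show False using Ws(3) by simp
  qed
  then obtain Ks where Ks: "set Ks \<subseteq> ?K" "combine Ks ?Vs = \<zero>" "\<not> set (take (length ?Vs) Ks) \<subseteq> {\<zero>}"
    using trivial_combine_imp_independent[OF K Vs] by blast
  \<comment> \<open>The offset \<open>l\<close> makes the statement inductive: leading zero
    coefficients are stripped one at a time.\<close>
  have "\<exists>j u. u \<in> carrier R \<and> (\<forall>x\<in>carrier R. x \<otimes> N = N \<otimes> x \<longrightarrow> x \<otimes> u = u \<otimes> x) \<and>
      N [^] j \<otimes> h = N [^] Suc j \<otimes> (u \<otimes> h)"
    if "set Ks \<subseteq> ?K" "combine Ks (map (\<lambda>j. N [^] j \<otimes> h) [l..<l+m]) = \<zero>" "\<not> set (take m Ks) \<subseteq> {\<zero>}" for Ks l m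
    using that
  proof (induction Ks arbitrary: l m)
    case (Cons k Ks)
    then obtain m' where m: "m = Suc m'" by (cases m) auto
    have k: "k \<in> ?K" "k \<in> carrier R" using Cons.prems center_closed by auto
    have upt: "[l..<l+m] = l # [Suc l..<Suc l+m']" using m by (simp add: upt_rec)
    show ?case
    proof (cases "k = \<zero>")
      case True
      have "set (map (\<lambda>j. N [^] j \<otimes> h) [Suc l..<Suc l+m']) \<subseteq> carrier R" using Nc h by auto
      then have "combine Ks (map (\<lambda>j. N [^] j \<otimes> h) [Suc l..<Suc l+m']) = \<zero>"
        using Cons.prems(1,2) upt True Nc h combine_in_carrier center_closed
        by (auto simp: subset_iff)
      then show ?thesis using Cons.IH[of "Suc l" m'] Cons.prems True m by auto
    next
      case False
      obtain s where s: "s \<in> carrier R" "\<forall>x\<in>carrier R. x \<otimes> N = N \<otimes> x \<longrightarrow> x \<otimes> s = s \<otimes> x"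
        "combine Ks (map (\<lambda>j. N [^] j \<otimes> h) [Suc l..<Suc l+m']) = N [^] Suc l \<otimes> (s \<otimes> h)"
        using combine_powers[OF Nc h(1), of Ks "Suc l" m'] Cons.prems(1) by auto
      obtain w where w: "w \<in> ?K" "w \<otimes> k = \<one>" using center_inverse[OF k(1) False] by metis
      have wc: "w \<in> carrier R" using w center_closed by auto
      have Nl: "N [^] l \<in> carrier R" "N [^] Suc l \<in> carrier R" using Nc by auto
      have "k \<otimes> (N [^] l \<otimes> h) \<oplus> N [^] Suc l \<otimes> (s \<otimes> h) = \<zero>"
        using Cons.prems(2) upt s(3) by simp
      then have "w \<otimes> (k \<otimes> (N [^] l \<otimes> h) \<oplus> N [^] Suc l \<otimes> (s \<otimes> h)) = \<zero>" using wc by simp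
      moreover have "w \<otimes> (k \<otimes> (N [^] l \<otimes> h)) = N [^] l \<otimes> h"
        using mult_eq_assoc[OF w(2)] wc k Nl h by simp
      moreover have "w \<otimes> (N [^] Suc l \<otimes> (s \<otimes> h)) = N [^] Suc l \<otimes> ((w \<otimes> s) \<otimes> h)"
        using center_left_commute[OF w(1) Nl(2), of "s \<otimes> h"] wc s(1) h by (simp add: m_assoc del: nat_pow_Suc)
      ultimately have "N [^] l \<otimes> h \<oplus> N [^] Suc l \<otimes> ((w \<otimes> s) \<otimes> h) = \<zero>"
        using wc k Nl s(1) h by (simp add: r_distr del: nat_pow_Suc)
      then have "N [^] l \<otimes> h = \<ominus> (N [^] Suc l \<otimes> ((w \<otimes> s) \<otimes> h))"
        using Nl wc s(1) h by (metis minus_equality m_closed)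
      then have "N [^] l \<otimes> h = N [^] Suc l \<otimes> ((\<ominus> (w \<otimes> s)) \<otimes> h)"
        using Nl wc s(1) h by (simp add: r_minus l_minus del: nat_pow_Suc)
      moreover have "x \<otimes> (\<ominus> (w \<otimes> s)) = \<ominus> (w \<otimes> s) \<otimes> x" if "x \<in> carrier R" "x \<otimes> N = N \<otimes> x" for x
        using commute_mult[OF that(1) wc s(1) center_commute[OF w(1) that(1)]] s(1,2) that wc
        by (simp add: r_minus l_minus)
      moreover have "\<ominus> (w \<otimes> s) \<in> carrier R" using wc s(1) by simp
      ultimately show ?thesis by (intro exI[of _ l] exI[of _ "\<ominus> (w \<otimes> s)"] conjI ballI impI)
    qed
  qed simp
  moreover have "combine Ks (map (\<lambda>j. N [^] j \<otimes> h) [0..<0 + Suc n]) = \<zero>"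
    using Ks(2) by (simp only: add_0)
  moreover have "\<not> set (take (Suc n) Ks) \<subseteq> {\<zero>}" using Ks(3) by simp
  ultimately have "\<exists>j u. u \<in> carrier R \<and> (\<forall>x\<in>carrier R. x \<otimes> N = N \<otimes> x \<longrightarrow> x \<otimes> u = u \<otimes> x) \<and>
      N [^] j \<otimes> h = N [^] Suc j \<otimes> (u \<otimes> h)"
    using Ks(1) by metis
  then show thesis using that by metis
qed

end

section \<open>Vectors with independent powers\<close>

context ring
begin

text \<open>The right ideals \<open>a^i y R\<close> form a direct sum and each is isomorphic to
  \<open>y R\<close>. The conclusion is \<open>y r = 0\<close> and not \<open>r = 0\<close>, as
  \<open>y\<close> may have a right annihilator.\<close>

definition indep_powers :: "'a \<Rightarrow> nat \<Rightarrow> 'a \<Rightarrow> bool" where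
  "indep_powers a m y \<longleftrightarrow> (\<forall>r\<in>{..<m} \<rightarrow> carrier R.
     (\<Oplus>i\<in>{..<m}. a [^] i \<otimes> (y \<otimes> r i)) = \<zero> \<longrightarrow> (\<forall>i<m. y \<otimes> r i = \<zero>))"

lemma indep_powersD:
  assumes "indep_powers a m y" "\<And>i. i < m \<Longrightarrow> r i \<in> carrier R"
    "(\<Oplus>i\<in>{..<m}. a [^] i \<otimes> (y \<otimes> r i)) = \<zero>" "i < m"
  shows "y \<otimes> r i = \<zero>"
  using assms unfolding indep_powers_def by (auto simp: Pi_iff)

lemma indep_powers_mult:
  assumes "indep_powers a m y" "a \<in> carrier R" "y \<in> carrier R" "w \<in> carrier R"
  shows "indep_powers a m (y \<otimes> w)"
  unfolding indep_powers_def
proof (intro ballI impI allI)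
  fix r i assume r: "r \<in> {..<m} \<rightarrow> carrier R" and s: "(\<Oplus>i\<in>{..<m}. a [^] i \<otimes> (y \<otimes> w \<otimes> r i)) = \<zero>" and i: "i < m"
  have rc: "\<And>i. i < m \<Longrightarrow> r i \<in> carrier R" using r by auto
  have "(\<Oplus>i\<in>{..<m}. a [^] i \<otimes> (y \<otimes> (w \<otimes> r i))) = (\<Oplus>i\<in>{..<m}. a [^] i \<otimes> (y \<otimes> w \<otimes> r i))"
    using assms rc by (intro finsum_cong') (auto simp: m_assoc)
  then have "y \<otimes> (w \<otimes> r i) = \<zero>"
    using s assms rc i by (intro indep_powersD[OF assms(1), of "\<lambda>i. w \<otimes> r i"]) auto
  then show "y \<otimes> w \<otimes> r i = \<zero>" using assms rc i by (simp add: m_assoc)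
qed

end

context nondiscrete_continuous_ring
begin

text \<open>The commutator with \<open>z\<close> vanishes on all idempotents of the corner, hence on \<open>g s (f - g)\<close>, which is
  a difference of two idempotents; primeness then handles \<open>g s g\<close>.\<close>

lemma central_of_idems:
  assumes f: "f \<in> idempotents R" "f \<noteq> \<zero>" and z: "z \<in> carrier R" "f \<otimes> z = z" "z \<otimes> f = z"
    and inv: "\<And>g. g \<in> idempotents R \<Longrightarrow> f \<otimes> g = g \<Longrightarrow> g \<otimes> f = g \<Longrightarrow> g \<otimes> (z \<otimes> g) = z \<otimes> g"
    and r: "r \<in> carrier R"
  shows "z \<otimes> (f \<otimes> r \<otimes> f) = (f \<otimes> r \<otimes> f) \<otimes> z"
proof -
  have fc: "f \<in> carrier R" using f by auto
  have comm: "z \<otimes> g = g \<otimes> z" if g: "g \<in> idempotents R" "f \<otimes> g = g" "g \<otimes> f = g" for g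
  proof -
    have gc: "g \<in> carrier R" using g by auto
    have i: "f \<ominus> g \<in> idempotents R" using idem_minus[OF f(1) g] .
    have "(f \<ominus> g) \<otimes> (z \<otimes> (f \<ominus> g)) = z \<otimes> (f \<ominus> g)"
      using i f g gc fc idemD(2)[OF f(1)] by (intro inv) (simp_all add: r_minus_distr l_minus_distr)
    moreover have "f \<otimes> (z \<otimes> (f \<ominus> g)) = z \<otimes> (f \<ominus> g)"
      using mult_eq_assoc[OF z(2), of "f \<ominus> g"] z fc gc by simp
    ultimately have "z \<otimes> (f \<ominus> g) \<ominus> g \<otimes> (z \<otimes> (f \<ominus> g)) = z \<otimes> (f \<ominus> g)"
      using z(1) fc gc by (simp add: l_minus_distr)
    moreover have "g \<otimes> (z \<otimes> (f \<ominus> g)) =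
        z \<otimes> (f \<ominus> g) \<ominus> (z \<otimes> (f \<ominus> g) \<ominus> g \<otimes> (z \<otimes> (f \<ominus> g)))"
      using z(1) fc gc by algebra
    ultimately have "g \<otimes> (z \<otimes> (f \<ominus> g)) = \<zero>" using z(1) fc gc by simp
    then have "g \<otimes> z = g \<otimes> (z \<otimes> g)" using z fc gc by (simp add: r_minus_distr)
    then show ?thesis using inv[OF g] by simp
  qed
  obtain g where g: "g \<in> idempotents R" "f \<otimes> g = g" "g \<otimes> f = g" "g \<noteq> \<zero>" "rk g < rk f"
    using small_idem[OF f] rk_pos[OF fc f(2)] by metis
  define c where "c = f \<ominus> g"
  have gc: "g \<in> carrier R" "c \<in> carrier R" using g fc by (auto simp: c_def)
  have "c \<noteq> \<zero>" using g(5) fc gc by (auto simp: c_def)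
  have c: "c \<in> idempotents R" "f \<otimes> c = c" "c \<otimes> f = c"
    using idem_minus[OF f(1) g(1-3)] g(2,3) idemD(2)[OF f(1)] fc gc
    by (simp_all add: c_def l_minus_distr r_minus_distr)
  have gcz: "g \<otimes> c = \<zero>" "c \<otimes> g = \<zero>"
    using g(2,3) idemD(2)[OF g(1)] fc gc by (simp_all add: c_def l_minus_distr r_minus_distr)
  have offdiag: "z \<otimes> (u \<otimes> s \<otimes> v) = (u \<otimes> s \<otimes> v) \<otimes> z"
    if u: "u \<in> idempotents R" "f \<otimes> u = u" "u \<otimes> f = u" and v: "v \<in> idempotents R" "f \<otimes> v = v" "v \<otimes> f = v"
      and uv: "v \<otimes> u = \<zero>" and s: "s \<in> carrier R" for u v s
  proof -
    have uc: "u \<in> carrier R" "v \<in> carrier R" using u v by auto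
    let ?x = "u \<otimes> s \<otimes> v"
    have x: "u \<otimes> ?x = ?x" "?x \<otimes> u = \<zero>" "?x \<otimes> ?x = \<zero>" "f \<otimes> ?x = ?x" "?x \<otimes> f = ?x"
      using uc s uv idemD(2)[OF u(1)] u v mult_eq_assoc[OF idemD(2)[OF u(1)]] mult_eq_assoc[OF uv]
        mult_eq_assoc[OF u(2)] fc by (simp_all add: m_assoc)
    have "z \<otimes> (u \<oplus> ?x) = (u \<oplus> ?x) \<otimes> z"
      by (rule comm) (use x uc s fc u idemD(2)[OF u(1)] in \<open>auto intro!: idemI simp: l_distr r_distr\<close>)
    then have "z \<otimes> u \<oplus> z \<otimes> ?x = u \<otimes> z \<oplus> ?x \<otimes> z" using z(1) uc s by (simp add: l_distr r_distr)
    then have "u \<otimes> z \<oplus> z \<otimes> ?x = u \<otimes> z \<oplus> ?x \<otimes> z" using comm[OF u] by simp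
    then show ?thesis using z(1) uc s by simp
  qed
  have diag: "z \<otimes> (u \<otimes> s \<otimes> u) = (u \<otimes> s \<otimes> u) \<otimes> z"
    if u: "u \<in> idempotents R" "f \<otimes> u = u" "u \<otimes> f = u" and v: "v \<in> idempotents R" "f \<otimes> v = v" "v \<otimes> f = v"
      and uv: "v \<otimes> u = \<zero>" and ne: "v \<noteq> \<zero>" and s: "s \<in> carrier R" for u v s
  proof -
    have uc: "u \<in> carrier R" "v \<in> carrier R" using u v by auto
    let ?x = "u \<otimes> s \<otimes> u"
    have xc: "?x \<in> carrier R" using uc s by simp
    have "(z \<otimes> ?x \<ominus> ?x \<otimes> z) \<otimes> t \<otimes> v = \<zero>" if t: "t \<in> carrier R" for t
    proof -
      have xu: "?x \<otimes> u = ?x" using uc s idemD(2)[OF u(1)] by (simp add: m_assoc)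
      have "z \<otimes> ?x \<otimes> t \<otimes> v = z \<otimes> (u \<otimes> (s \<otimes> u \<otimes> t) \<otimes> v)"
        using z(1) uc s t by (simp add: m_assoc)
      also have "\<dots> = u \<otimes> (s \<otimes> u \<otimes> t) \<otimes> v \<otimes> z" using offdiag[OF u v uv, of "s \<otimes> u \<otimes> t"] uc s t by simp
      also have "\<dots> = u \<otimes> s \<otimes> (u \<otimes> t \<otimes> v \<otimes> z)" using z(1) uc s t by (simp add: m_assoc)
      also have "u \<otimes> t \<otimes> v \<otimes> z = z \<otimes> (u \<otimes> t \<otimes> v)" using offdiag[OF u v uv t] by simp
      also have "u \<otimes> s \<otimes> (z \<otimes> (u \<otimes> t \<otimes> v)) = u \<otimes> s \<otimes> (z \<otimes> u) \<otimes> t \<otimes> v"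
        using z(1) uc s t by (simp add: m_assoc)
      also have "z \<otimes> u = u \<otimes> z" using comm[OF u] .
      also have "u \<otimes> s \<otimes> (u \<otimes> z) \<otimes> t \<otimes> v = ?x \<otimes> z \<otimes> t \<otimes> v"
        using z(1) uc s t by (simp add: m_assoc)
      finally show ?thesis using z(1) uc xc t by (simp add: l_minus_distr)
    qed
    then have "z \<otimes> ?x \<ominus> ?x \<otimes> z = \<zero>"
      using prime[of "z \<otimes> ?x \<ominus> ?x \<otimes> z" v] z(1) uc xc ne by (metis m_closed minus_closed)
    then show ?thesis using z(1) xc by simp
  qed
  have fgc: "f = g \<oplus> c" unfolding c_def using fc gc by algebra
  have "f \<otimes> r \<otimes> f = g \<otimes> r \<otimes> g \<oplus> g \<otimes> r \<otimes> c \<oplus> (c \<otimes> r \<otimes> g \<oplus> c \<otimes> r \<otimes> c)"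
    unfolding fgc using gc r by algebra
  then show ?thesis
    using diag[OF g(1-3) c gcz(2) \<open>c \<noteq> \<zero>\<close> r] diag[OF c g(1-3) gcz(1) g(4) r]
      offdiag[OF g(1-3) c gcz(2) r] offdiag[OF c g(1-3) gcz(1) r] gc z(1) r
    by (simp add: l_distr r_distr)
qed

text \<open>By \<open>inv\<close>, left multiplication by \<open>z\<close> maps every principal
  right subideal of \<open>f R\<close> into itself; such endomorphisms are scalars, as for vector
  spaces.\<close>

lemma center_choice:
  assumes f: "f \<in> idempotents R" "f \<noteq> \<zero>" and z: "z \<in> carrier R" "z \<otimes> f = z"
    and inv: "\<And>g. g \<in> idempotents R \<Longrightarrow> f \<otimes> g = g \<Longrightarrow> g \<otimes> (z \<otimes> g) = z \<otimes> g"
  shows "\<exists>k\<in>ring_center R. k \<otimes> f = z"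
proof -
  have fz: "f \<otimes> z = z" using inv[OF f(1)] z idemD(2)[OF f(1)] by simp
  have "z \<otimes> (f \<otimes> r \<otimes> f) = (f \<otimes> r \<otimes> f) \<otimes> z" if "r \<in> carrier R" for r
    using central_of_idems[OF f z(1) fz z(2) inv that] by blast
  then show ?thesis using center_lift[OF f z(1) fz z(2)] by metis
qed

text \<open>If the powers of \<open>y\<close> become dependent at some \<open>m < d\<close> for all vectors of \<open>V\<close>, the coefficients of the
  dependence relation are central, so a polynomial of degree \<open>m\<close> has a kernel.\<close>

lemma independent_powers_exist:
  assumes a: "a \<in> carrier R"
    and V: "V \<subseteq> carrier R" "\<And>v r. v \<in> V \<Longrightarrow> r \<in> carrier R \<Longrightarrow> v \<otimes> r \<in> V" "\<exists>v\<in>V. v \<noteq> \<zero>"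
    and minimal: "\<And>m q y. m < d \<Longrightarrow> (\<And>j. q j \<in> ring_center R) \<Longrightarrow> y \<in> V \<Longrightarrow> horner a q m \<otimes> y = \<zero> \<Longrightarrow> y = \<zero>"
    and "m \<le> d"
  shows "\<exists>y\<in>V. y \<noteq> \<zero> \<and> indep_powers a m y"
  using \<open>m \<le> d\<close>
proof (induction m)
  case 0
  then show ?case using V(3) by (auto simp: indep_powers_def)
next
  case (Suc m)
  then obtain y where y: "y \<in> V" "y \<noteq> \<zero>" "indep_powers a m y" by auto
  show ?case
  proof (rule ccontr)
    assume none: "\<not> ?thesis"
    have yc: "y \<in> carrier R" using y V by auto
    obtain w where w: "w \<in> carrier R" "y \<otimes> w \<otimes> y = y" "y \<otimes> w \<in> idempotents R"
      using quasi_inverse'[OF yc] by metis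
    define e where "e = y \<otimes> w"
    have e: "e \<in> idempotents R" "e \<in> V" "e \<noteq> \<zero>" "indep_powers a m e"
      using w y V(2) yc indep_powers_mult[OF y(3) a yc w(1)] by (auto simp: e_def)
    have ec: "e \<in> carrier R" using e by auto
    have eV: "z \<in> V" if "z \<in> carrier R" "e \<otimes> z = z" for z using V(2)[OF e(2) that(1)] that(2) by simp
    \<comment> \<open>The top coefficient cannot vanish, since the lower powers of \<open>z\<close>
      inherit independence from \<open>e\<close>.\<close>
    have dep: "\<exists>r t. (\<forall>i<m. r i \<in> carrier R) \<and> t \<in> carrier R \<and> z \<otimes> t \<noteq> \<zero> \<and>
        a [^] m \<otimes> (z \<otimes> t) \<oplus> (\<Oplus>i\<in>{..<m}. a [^] i \<otimes> (z \<otimes> r i)) = \<zero>"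
      if z: "z \<in> carrier R" "e \<otimes> z = z" "z \<noteq> \<zero>" for z
    proof -
      have "\<not> indep_powers a (Suc m) z" using none eV[OF z(1,2)] z(3) by blast
      then obtain r i where r: "r \<in> {..<Suc m} \<rightarrow> carrier R"
        "(\<Oplus>i\<in>{..<Suc m}. a [^] i \<otimes> (z \<otimes> r i)) = \<zero>" "i < Suc m" "z \<otimes> r i \<noteq> \<zero>"
        unfolding indep_powers_def by blast
      have rc: "r j \<in> carrier R" if "j < Suc m" for j using r(1) that by auto
      have sum: "a [^] m \<otimes> (z \<otimes> r m) \<oplus> (\<Oplus>i\<in>{..<m}. a [^] i \<otimes> (z \<otimes> r i)) = \<zero>"
        using r(2) finsum_lessThan_Suc[of "\<lambda>i. a [^] i \<otimes> (z \<otimes> r i)" m] rc a z(1) by simp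
      have "z \<otimes> r m \<noteq> \<zero>"
      proof
        assume zero: "z \<otimes> r m = \<zero>"
        have S: "(\<Oplus>i\<in>{..<m}. a [^] i \<otimes> (z \<otimes> r i)) \<in> carrier R"
          using rc a z(1) by (intro finsum_closed) auto
        have "(\<Oplus>i\<in>{..<m}. a [^] i \<otimes> (z \<otimes> r i)) = \<zero>" using sum zero a S by simp
        moreover have "indep_powers a m z" using indep_powers_mult[OF e(4) a ec z(1)] z(2) by simp
        ultimately have "z \<otimes> r i = \<zero>" if "i < m" using that rc by (intro indep_powersD[of a m z r]) auto
        then show False using r(3,4) zero by (cases "i = m") auto
      qed
      then show ?thesis using sum rc by (intro exI[of _ r] exI[of _ "r m"]) auto
    qed
    obtain r t where r: "\<And>i. i < m \<Longrightarrow> r i \<in> carrier R" and t: "t \<in> carrier R" "e \<otimes> t \<noteq> \<zero>"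
      "a [^] m \<otimes> (e \<otimes> t) \<oplus> (\<Oplus>i\<in>{..<m}. a [^] i \<otimes> (e \<otimes> r i)) = \<zero>"
      using dep[OF ec idemD(2)[OF e(1)] e(3)] by blast
    have etc: "e \<otimes> t \<in> carrier R" using ec t by simp
    obtain v where v: "v \<in> carrier R" "e \<otimes> t \<otimes> v \<otimes> (e \<otimes> t) = e \<otimes> t" "e \<otimes> t \<otimes> v \<in> idempotents R"
      using quasi_inverse'[OF etc] by metis
    \<comment> \<open>Multiplying by \<open>v\<close> normalises the relation: its leading term on
      \<open>f\<close> becomes \<open>a [^] m \<otimes> f\<close>, and the \<open>Z i\<close> are
      the coefficients that express it through lower powers.\<close>
    define f where "f = e \<otimes> t \<otimes> v"
    have f: "f \<in> idempotents R" "f \<noteq> \<zero>" using v t etc by (auto simp: f_def)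
    have fc: "f \<in> carrier R" using f by auto
    have ef: "e \<otimes> f = f"
      using mult_eq_assoc[OF idemD(2)[OF e(1)]] ec t(1) v(1) by (simp add: f_def m_assoc)
    define Z where "Z i = \<ominus> (e \<otimes> (r i \<otimes> (v \<otimes> f)))" for i
    have Z: "Z i \<in> carrier R" "e \<otimes> Z i = Z i" "Z i \<otimes> f = Z i" if "i < m" for i
      using r[OF that] ec v(1) fc idemD(2)[OF f(1)] mult_eq_assoc[OF idemD(2)[OF e(1)]]
      by (simp_all add: Z_def r_minus l_minus m_assoc)
    have ee: "e \<otimes> (e \<otimes> x) = e \<otimes> x" if "x \<in> carrier R" for x
      using mult_eq_assoc[OF idemD(2)[OF e(1)]] ec that by simp
    have amf: "a [^] m \<otimes> f = (\<Oplus>i\<in>{..<m}. a [^] i \<otimes> Z i)"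
    proof -
      have S: "(\<Oplus>i\<in>{..<m}. a [^] i \<otimes> (e \<otimes> r i)) \<in> carrier R" using r a ec by (intro finsum_closed) auto
      have "a [^] m \<otimes> (e \<otimes> t) = \<ominus> (\<Oplus>i\<in>{..<m}. a [^] i \<otimes> (e \<otimes> r i))"
        using t(3) a etc S by (metis minus_equality m_closed nat_pow_closed)
      then have "a [^] m \<otimes> (e \<otimes> t) \<otimes> (v \<otimes> f) = (\<Oplus>i\<in>{..<m}. a [^] i \<otimes> (e \<otimes> r i)) \<otimes> (\<ominus> (v \<otimes> f))"
        using S v(1) fc by (simp add: l_minus r_minus)
      also have "\<dots> = (\<Oplus>i\<in>{..<m}. a [^] i \<otimes> (e \<otimes> r i) \<otimes> (\<ominus> (v \<otimes> f)))"
        using r a ec v(1) fc by (subst finsum_ldistr) auto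
      also have "\<dots> = (\<Oplus>i\<in>{..<m}. a [^] i \<otimes> Z i)"
        using r a ec v(1) fc by (intro finsum_cong') (auto simp: Z_def m_assoc r_minus)
      also have "a [^] m \<otimes> (e \<otimes> t) \<otimes> (v \<otimes> f) = a [^] m \<otimes> (f \<otimes> f)"
        using a etc v(1) fc by (simp add: f_def m_assoc)
      finally show ?thesis using idemD(2)[OF f(1)] by simp
    qed
    \<comment> \<open>A relation for \<open>g\<close> is compared with the normalised one multiplied
      by \<open>\<tau>\<close>; independence of the lower powers forces each
      \<open>Z i \<otimes> \<tau>\<close> into \<open>g R\<close>.\<close>
    have local: "\<exists>\<tau>\<in>carrier R. g \<otimes> \<tau> = \<tau> \<and> \<tau> \<noteq> \<zero> \<and> (\<forall>i<m. g \<otimes> (Z i \<otimes> \<tau>) = Z i \<otimes> \<tau>)"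
      if g: "g \<in> idempotents R" "f \<otimes> g = g" "g \<noteq> \<zero>" for g
    proof -
      have gc: "g \<in> carrier R" using g by auto
      have eg: "e \<otimes> g = g" using mult_eq_assoc[OF ef, of g] g ec fc gc by simp
      obtain r' t' where r': "\<And>i. i < m \<Longrightarrow> r' i \<in> carrier R" and t': "t' \<in> carrier R" "g \<otimes> t' \<noteq> \<zero>"
        "a [^] m \<otimes> (g \<otimes> t') \<oplus> (\<Oplus>i\<in>{..<m}. a [^] i \<otimes> (g \<otimes> r' i)) = \<zero>"
        using dep[OF gc eg g(3)] by blast
      define \<tau> where "\<tau> = g \<otimes> t'"
      have tc: "\<tau> \<in> carrier R" "g \<otimes> \<tau> = \<tau>"
        using gc t' mult_eq_assoc[OF idemD(2)[OF g(1)]] by (auto simp: \<tau>_def)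
      have ft: "f \<otimes> \<tau> = \<tau>" using mult_eq_assoc[OF g(2), of t'] fc gc t' by (simp add: \<tau>_def)
      have "a [^] m \<otimes> \<tau> = a [^] m \<otimes> f \<otimes> \<tau>" using a fc tc ft by (simp add: m_assoc)
      also have "\<dots> = (\<Oplus>i\<in>{..<m}. a [^] i \<otimes> (Z i \<otimes> \<tau>))"
        unfolding amf using a Z tc by (subst finsum_ldistr) (auto simp: m_assoc intro!: finsum_cong')
      finally have "(\<Oplus>i\<in>{..<m}. a [^] i \<otimes> (Z i \<otimes> \<tau>)) \<oplus> (\<Oplus>i\<in>{..<m}. a [^] i \<otimes> (g \<otimes> r' i)) = \<zero>"
        using t'(3) by (simp add: \<tau>_def)
      then have "(\<Oplus>i\<in>{..<m}. a [^] i \<otimes> (Z i \<otimes> \<tau>) \<oplus> a [^] i \<otimes> (g \<otimes> r' i)) = \<zero>"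
        using a Z(1) tc(1) gc r' by (subst finsum_addf) auto
      moreover have "(\<Oplus>i\<in>{..<m}. a [^] i \<otimes> (e \<otimes> (Z i \<otimes> \<tau> \<oplus> g \<otimes> r' i))) =
          (\<Oplus>i\<in>{..<m}. a [^] i \<otimes> (Z i \<otimes> \<tau>) \<oplus> a [^] i \<otimes> (g \<otimes> r' i))"
        using a Z tc(1) gc r' ec mult_eq_assoc[OF Z(2)] mult_eq_assoc[OF eg]
        by (intro finsum_cong') (auto simp: r_distr)
      ultimately have zero: "e \<otimes> (Z i \<otimes> \<tau> \<oplus> g \<otimes> r' i) = \<zero>" if "i < m" for i
        using that Z(1) tc(1) gc r' by (intro indep_powersD[OF e(4)]) auto
      have "g \<otimes> (Z i \<otimes> \<tau>) = Z i \<otimes> \<tau>" if i: "i < m" for i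
      proof -
        have "Z i \<otimes> \<tau> \<oplus> g \<otimes> r' i = \<zero>"
          using zero[OF i] Z[OF i] tc(1) gc r'[OF i] ec mult_eq_assoc[OF Z(2)[OF i]] mult_eq_assoc[OF eg]
          by (simp add: r_distr)
        then have "Z i \<otimes> \<tau> = \<ominus> (g \<otimes> r' i)" using Z[OF i] tc(1) gc r'[OF i] by (metis minus_equality m_closed)
        then show ?thesis using gc r'[OF i] mult_eq_assoc[OF idemD(2)[OF g(1)]] by (simp add: r_minus)
      qed
      then show ?thesis using tc t'(2) by (intro bexI[of _ \<tau>]) (auto simp: \<tau>_def)
    qed
    \<comment> \<open>Exhaustion: the vectors of \<open>g R\<close> that all \<open>Z i\<close> send
      into \<open>g R\<close> form a principal right ideal \<open>D R\<close>. Were it smaller than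
      \<open>g R\<close>, \<open>local\<close> applied to the complement \<open>h\<close> would give
      a further such vector.\<close>
    have inv: "g \<otimes> (Z i \<otimes> g) = Z i \<otimes> g" if g: "g \<in> idempotents R" "f \<otimes> g = g" and i: "i < m" for g i
    proof -
      have gc: "g \<in> carrier R" using g by auto
      have gg: "g \<otimes> g = g" using idemD g by auto
      define B where "B = insert (\<one> \<ominus> g) ((\<lambda>i. (\<one> \<ominus> g) \<otimes> Z i) ` {..<m})"
      have B: "B \<subseteq> carrier R" using gc Z(1) by (auto simp: B_def)
      then obtain D where D: "D \<in> idempotents R" "\<And>y. y \<in> carrier R \<Longrightarrow> D \<otimes> y = y \<longleftrightarrow> (\<forall>x\<in>B. x \<otimes> y = \<zero>)"
        using annihilator_idem[OF B] by metis
      have Dc: "D \<in> carrier R" using D by auto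
      have DB: "(\<one> \<ominus> g) \<otimes> D = \<zero>" "\<And>i. i < m \<Longrightarrow> (\<one> \<ominus> g) \<otimes> Z i \<otimes> D = \<zero>"
        using D(2)[OF Dc] idemD(2)[OF D(1)] by (auto simp: B_def)
      have gD: "g \<otimes> D = D" using DB(1) gc Dc by (simp add: l_minus_distr)
      define D' where "D' = D \<otimes> g"
      have D'c: "D' \<in> carrier R" using Dc gc by (simp add: D'_def)
      have "D \<otimes> g \<otimes> (D \<otimes> g) = D \<otimes> (g \<otimes> D) \<otimes> g" using Dc gc by (simp add: m_assoc)
      then have D': "D' \<in> idempotents R" using D'c gD idemD(2)[OF D(1)] by (intro idemI) (auto simp: D'_def)
      have gD': "g \<otimes> D' = D'" "D' \<otimes> g = D'"
        using mult_eq_assoc[OF gD] gc Dc gg by (simp_all add: D'_def m_assoc)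
      define h where "h = g \<ominus> D'"
      have h: "h \<in> idempotents R" unfolding h_def using idem_minus[OF g(1) D' gD'] .
      have hc: "h \<in> carrier R" using h by auto
      have gh: "g \<otimes> h = h" using gg gD' gc D'c by (simp add: h_def r_minus_distr)
      have fh: "f \<otimes> h = h" using mult_eq_assoc[OF g(2), of h] gh fc gc hc by simp
      have "h = \<zero>"
      proof (rule ccontr)
        assume "h \<noteq> \<zero>"
        then obtain \<tau> where tau: "\<tau> \<in> carrier R" "h \<otimes> \<tau> = \<tau>" "\<tau> \<noteq> \<zero>" "\<And>i. i < m \<Longrightarrow> h \<otimes> (Z i \<otimes> \<tau>) = Z i \<otimes> \<tau>"
          using local[OF h fh] by blast
        have gt: "g \<otimes> \<tau> = \<tau>" using mult_eq_assoc[OF gh, of \<tau>] tau gc hc by simp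
        have "g \<otimes> (Z i \<otimes> \<tau>) = Z i \<otimes> \<tau>" if "i < m" for i
          using mult_eq_assoc[OF gh, of "Z i \<otimes> \<tau>"] tau(1,4) that Z(1) gc hc by simp
        then have "D \<otimes> \<tau> = \<tau>" using D(2)[OF tau(1)] tau(1) gt gc Z(1) by (auto simp: B_def l_minus_distr m_assoc)
        then have "D' \<otimes> \<tau> = \<tau>" using gt Dc gc tau(1) by (simp add: D'_def m_assoc)
        then have "h \<otimes> \<tau> = \<zero>" using gt gc D'c tau(1) by (simp add: h_def l_minus_distr)
        then show False using tau by simp
      qed
      then have gDg: "g = D \<otimes> g" using gc D'c by (simp add: h_def D'_def)
      have "(\<one> \<ominus> g) \<otimes> (Z i \<otimes> g) = (\<one> \<ominus> g) \<otimes> Z i \<otimes> D \<otimes> g"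
        using gDg gc Dc Z(1)[OF i] by (simp add: m_assoc)
      also have "\<dots> = \<zero>" using DB(2)[OF i] gc by simp
      finally show ?thesis using gc Z(1)[OF i] by (simp add: l_minus_distr)
    qed
    have "\<exists>k. i < m \<longrightarrow> k \<in> ring_center R \<and> k \<otimes> f = Z i" for i
    proof (cases "i < m")
      case True
      then show ?thesis using center_choice[OF f Z(1)[OF True] Z(3)[OF True] inv[OF _ _ True]] by blast
    qed auto
    then have "\<forall>i. \<exists>k. i < m \<longrightarrow> k \<in> ring_center R \<and> k \<otimes> f = Z i" by blast
    from choice[OF this] obtain k
      where k: "\<And>i. i < m \<Longrightarrow> k i \<in> ring_center R" "\<And>i. i < m \<Longrightarrow> k i \<otimes> f = Z i" by blast
    \<comment> \<open>\<open>horner\<close> lists coefficients from the top, so the coefficient of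
      \<open>a [^] i\<close> sits at index \<open>m - 1 - i\<close>; the sign moves the
      \<open>Z i\<close> to the other side.\<close>
    define q where "q j = (if j < m then \<ominus> (k (m - 1 - j)) else \<zero>)" for j
    have q: "q j \<in> ring_center R" for j using k(1) by (auto simp: q_def uminus_center)
    have qc: "q j \<in> carrier R" for j using q center_closed by blast
    have kc: "k i \<in> carrier R" if "i < m" for i using k(1)[OF that] center_closed by blast
    have "horner a q m \<otimes> f = a [^] m \<otimes> f \<oplus> (\<Oplus>i\<in>{..<m}. q (m - 1 - i) \<otimes> a [^] i) \<otimes> f"
      unfolding horner_expand[of a q m, OF a q] using a qc fc by (simp add: l_distr finsum_closed Pi_def)
    also have "(\<Oplus>i\<in>{..<m}. q (m - 1 - i) \<otimes> a [^] i) \<otimes> f = (\<Oplus>i\<in>{..<m}. q (m - 1 - i) \<otimes> a [^] i \<otimes> f)"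
      using a qc fc by (subst finsum_ldistr) auto
    also have "\<dots> = (\<Oplus>i\<in>{..<m}. a [^] i \<otimes> Z i \<otimes> (\<ominus> \<one>))"
    proof (rule finsum_cong')
      fix i assume "i \<in> {..<m}"
      then have i: "i < m" by simp
      have "q (m - 1 - i) = \<ominus> (k i)" using i by (simp add: q_def)
      moreover have "k i \<otimes> a [^] i \<otimes> f = a [^] i \<otimes> Z i"
        using k(2)[OF i] center_left_commute[OF k(1)[OF i], of "a [^] i" f] a fc kc[OF i] by (simp add: m_assoc)
      ultimately show "q (m - 1 - i) \<otimes> a [^] i \<otimes> f = a [^] i \<otimes> Z i \<otimes> (\<ominus> \<one>)"
        using a fc kc[OF i] Z(1)[OF i] by (simp add: l_minus r_minus)
    qed (use a Z(1) in auto)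
    also have "\<dots> = \<ominus> (a [^] m \<otimes> f)"
      using a Z(1) fc by (subst finsum_ldistr[symmetric]) (auto simp: amf[symmetric] r_minus)
    finally have "horner a q m \<otimes> f = \<zero>" using a fc by (simp add: r_neg)
    then have "f = \<zero>" using minimal[of m q f, OF _ q eV[OF fc ef]] Suc.prems by simp
    then show False using f by simp
  qed
qed

end

section \<open>Splitting an idempotent along an algebraic element\<close>

context ring
begin

text \<open>Strong induction on \<open>l\<close>. Multiplying by \<open>N [^] (k - l)\<close> kills
  the terms of higher degree in \<open>N\<close> since
  \<open>N [^] Suc k \<otimes> x = \<zero>\<close>; those of lower degree vanish by induction; what
  is left is a relation between the independent powers of \<open>a\<close> on
  \<open>N [^] k \<otimes> x\<close>.\<close>

lemma indep_double_powers:
  assumes N: "N \<in> carrier R" "N \<otimes> a = a \<otimes> N" and a: "a \<in> carrier R" and x: "x \<in> carrier R"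
    and nil: "N [^] Suc k \<otimes> x = \<zero>"
    and ind: "indep_powers a d (N [^] k \<otimes> x)"
    and faithful: "\<And>r. r \<in> carrier R \<Longrightarrow> N [^] k \<otimes> x \<otimes> r = \<zero> \<Longrightarrow> x \<otimes> r = \<zero>"
    and r: "\<And>p. p \<in> {..<Suc k} \<times> {..<d} \<Longrightarrow> r p \<in> carrier R"
    and sum: "(\<Oplus>p\<in>{..<Suc k} \<times> {..<d}. N [^] fst p \<otimes> (a [^] snd p \<otimes> (x \<otimes> r p))) = \<zero>"
    and "l < Suc k" "i < d"
  shows "x \<otimes> r (l, i) = \<zero>"
  using \<open>l < Suc k\<close> \<open>i < d\<close>
proof (induction l arbitrary: i rule: less_induct)
  case (less l)
  let ?I = "{..<Suc k} \<times> {..<d}"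
  let ?B = "\<lambda>p. N [^] (k - l) \<otimes> (N [^] fst p \<otimes> (a [^] snd p \<otimes> (x \<otimes> r p)))"
  have Na: "N [^] m \<otimes> (a [^] n \<otimes> y) = a [^] n \<otimes> (N [^] m \<otimes> y)" if "y \<in> carrier R" for m n :: nat and y
    using commute_left[of "N [^] m" "a [^] n" y] commute_pow[of "N [^] m" a n] commute_pow[of a N m] N a that
    by simp
  have Bc: "?B p \<in> carrier R" if "p \<in> ?I" for p using that N a x r by simp
  have high: "N [^] m \<otimes> (x \<otimes> y) = \<zero>" if "Suc k \<le> m" "y \<in> carrier R" for m :: nat and y
  proof -
    have "N [^] m \<otimes> x = N [^] (m - Suc k) \<otimes> (N [^] Suc k \<otimes> x)"
      using N x that(1) nat_pow_mult[OF N(1), of "m - Suc k" "Suc k"] by (simp add: m_assoc[symmetric])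
    also have "\<dots> = \<zero>" unfolding nil using N by simp
    finally show ?thesis using mult_eq_assoc[of "N [^] m" x \<zero> y] N x that by simp
  qed
  have zero: "?B p = \<zero>" if p: "p \<in> ?I - (\<lambda>i. (l, i)) ` {..<d}" for p
  proof -
    obtain l' i' where p': "p = (l', i')" "l' < Suc k" "i' < d" "l' \<noteq> l" using p by (cases p) auto
    have rc: "r p \<in> carrier R" using r p by blast
    consider "l' < l" | "l < l'" using p'(4) by linarith
    then show ?thesis
    proof cases
      case 1
      then have "x \<otimes> r p = \<zero>" using less.IH[OF 1 p'(2,3)] p'(1) by simp
      then show ?thesis using N a by simp
    next
      case 2
      then have "Suc k \<le> k - l + l'" using less.prems by simp
      then have "N [^] (k - l + l') \<otimes> (x \<otimes> r p) = \<zero>" using high rc by blast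
      moreover have "?B p = a [^] i' \<otimes> (N [^] (k - l + l') \<otimes> (x \<otimes> r p))"
        using Na N a x rc mult_eq_assoc[OF nat_pow_mult[OF N(1), of "k - l" l']] by (simp add: p'(1))
      ultimately show ?thesis using a by simp
    qed
  qed
  have "N [^] (k - l) \<otimes> (\<Oplus>p\<in>?I. N [^] fst p \<otimes> (a [^] snd p \<otimes> (x \<otimes> r p))) = (\<Oplus>p\<in>?I. ?B p)"
    using N a x r by (intro finsum_rdistr) auto
  then have "\<zero> = (\<Oplus>p\<in>?I. ?B p)" unfolding sum using N by simp
  also have "\<dots> = (\<Oplus>p\<in>(\<lambda>i. (l, i)) ` {..<d}. ?B p)"
    using less.prems zero Bc by (intro add.finprod_mono_neutral_cong_right) auto
  also have "\<dots> = (\<Oplus>i\<in>{..<d}. ?B (l, i))"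
    using Bc less.prems by (intro finsum_reindex) (auto simp: inj_on_def)
  also have "\<dots> = (\<Oplus>i\<in>{..<d}. a [^] i \<otimes> (N [^] k \<otimes> x \<otimes> r (l, i)))"
  proof (rule finsum_cong')
    fix i assume i: "i \<in> {..<d}"
    then have rc: "r (l, i) \<in> carrier R" using r less.prems by auto
    have "N [^] (k - l) \<otimes> (N [^] l \<otimes> y) = N [^] k \<otimes> y" if "y \<in> carrier R" for y
      using nat_pow_mult[OF N(1), of "k - l" l] less.prems N that by (simp add: m_assoc[symmetric])
    then show "?B (l, i) = a [^] i \<otimes> (N [^] k \<otimes> x \<otimes> r (l, i))"
      using Na N a x rc by (simp add: m_assoc)
  qed (use r less.prems N a x in auto)
  finally have "(\<Oplus>i\<in>{..<d}. a [^] i \<otimes> (N [^] k \<otimes> x \<otimes> r (l, i))) = \<zero>" by simp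
  then have "N [^] k \<otimes> x \<otimes> r (l, i) = \<zero>"
    using r less.prems by (intro indep_powersD[OF ind, of "\<lambda>i. r (l, i)"]) auto
  then show ?case using faithful r less.prems by auto
qed

end

context nondiscrete_continuous_ring
begin

text \<open>Fitting's lemma: once the powers of \<open>N\<close> stabilise on \<open>h\<close>,
  \<open>E = N^j u^j h\<close> projects onto the part where \<open>N\<close> is invertible and
  commutes with \<open>a\<close>. Without proper subidempotents \<open>E\<close> is \<open>0\<close>
  or \<open>h\<close>, and the kernel vector \<open>y\<close> excludes \<open>h\<close>.\<close>

lemma nilpotent_of_no_idems:
  assumes a: "a \<in> carrier R" and h: "h \<in> idempotents R" "h \<noteq> \<zero>" "h \<otimes> a = a \<otimes> h"
    and p: "\<And>j. p j \<in> ring_center R" "horner a p n \<otimes> h = \<zero>"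
    and none: "\<And>f. f \<in> idempotents R \<Longrightarrow> h \<otimes> f = f \<Longrightarrow> f \<otimes> h = f \<Longrightarrow> f \<otimes> a = a \<otimes> f \<Longrightarrow> f = \<zero> \<or> f = h"
    and q: "\<And>j. q j \<in> ring_center R" and N: "N = horner a q d"
    and y: "y \<in> carrier R" "y \<noteq> \<zero>" "h \<otimes> y = y" "N \<otimes> y = \<zero>"
  shows "\<exists>j::nat. N [^] j \<otimes> h = \<zero>"
proof -
  have hc: "h \<in> carrier R" using h by auto
  have hh: "h \<otimes> h = h" using h by (auto dest: idemD)
  have Nc: "N \<in> carrier R" using a q N by simp
  have aN: "a \<otimes> N = N \<otimes> a" unfolding N by (rule horner_commute) (use a q in auto)
  have hN: "h \<otimes> N = N \<otimes> h" unfolding N by (rule horner_commute) (use a q h hc in auto)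
  obtain j0 u where u: "u \<in> carrier R" "\<And>x. x \<in> carrier R \<Longrightarrow> x \<otimes> N = N \<otimes> x \<Longrightarrow> x \<otimes> u = u \<otimes> x"
    and j0: "N [^] j0 \<otimes> h = N [^] Suc j0 \<otimes> (u \<otimes> h)"
    using power_absorbs[where p = p and q = q, OF a hc h(2) p q N] by metis
  have uN: "N \<otimes> u = u \<otimes> N" "a \<otimes> u = u \<otimes> a" "h \<otimes> u = u \<otimes> h" using u(2) Nc a hc aN hN by auto
  \<comment> \<open>The successor guarantees at least one factor \<open>N\<close> in
    \<open>X'\<close>, so that \<open>X'\<close> kills \<open>y\<close>.\<close>
  define j where "j = Suc j0"
  define X' where "X' = N [^] j"
  define U where "U = u [^] j"
  have c: "X' \<in> carrier R" "U \<in> carrier R" using Nc u by (auto simp: X'_def U_def)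
  have UN: "N \<otimes> (u [^] i) = u [^] i \<otimes> N" "h \<otimes> u [^] i = u [^] i \<otimes> h" "a \<otimes> u [^] i = u [^] i \<otimes> a" for i :: nat
    using commute_pow[OF Nc u(1) uN(1)] commute_pow[OF hc u(1) uN(3)] commute_pow[OF a u(1) uN(2)] by auto
  have step: "N [^] j \<otimes> h = N [^] Suc j \<otimes> (u \<otimes> h)"
  proof -
    have "N [^] j \<otimes> h = N \<otimes> (N [^] j0 \<otimes> h)" unfolding j_def by (rule pow_Suc_apply[OF Nc hc])
    also have "\<dots> = N \<otimes> (N [^] j \<otimes> (u \<otimes> h))" using j0 by (simp add: j_def)
    also have "\<dots> = N [^] Suc j \<otimes> (u \<otimes> h)" using pow_Suc_apply[OF Nc, of "u \<otimes> h" j] u(1) hc by simp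
    finally show ?thesis .
  qed
  have iter: "N [^] j \<otimes> h = N [^] i \<otimes> (u [^] i \<otimes> (N [^] j \<otimes> h))" for i :: nat
  proof (induction i)
    case (Suc i)
    have Nu: "N [^] j \<otimes> (u \<otimes> t) = u \<otimes> (N [^] j \<otimes> t)" if "t \<in> carrier R" for t
      using commute_left[of u "N [^] j" t] commute_pow[OF u(1) Nc uN(1)[symmetric], of j] u(1) Nc that by simp
    have "N [^] j \<otimes> h = N [^] i \<otimes> (u [^] i \<otimes> (N \<otimes> (N [^] j \<otimes> (u \<otimes> h))))"
      using Suc step pow_Suc_apply[OF Nc, of "u \<otimes> h" j] u(1) hc by simp
    also have "\<dots> = N [^] i \<otimes> (N \<otimes> (u [^] i \<otimes> (u \<otimes> (N [^] j \<otimes> h))))"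
      using commute_left[of N "u [^] i"] UN Nc u(1) hc Nu by simp
    also have "\<dots> = N [^] Suc i \<otimes> (u [^] Suc i \<otimes> (N [^] j \<otimes> h))"
      using Nc u(1) hc by (simp add: m_assoc)
    finally show ?case .
  qed (use Nc hc in simp)
  have XU: "X' \<otimes> U = U \<otimes> X'"
    using commute_pow[of "u [^] j" N j] UN(1)[of j] u(1) Nc by (simp add: X'_def U_def)
  have hX: "h \<otimes> X' = X' \<otimes> h" using commute_pow[OF hc Nc hN] by (simp add: X'_def)
  have hU: "h \<otimes> U = U \<otimes> h" using UN(2)[of j] by (simp add: U_def)
  have X: "X' \<otimes> (U \<otimes> (X' \<otimes> h)) = X' \<otimes> h" using iter[of j] by (simp add: X'_def U_def)
  define E where "E = X' \<otimes> (U \<otimes> h)"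
  have Ec: "E \<in> carrier R" using c hc by (simp add: E_def)
  have EX: "X' \<otimes> h = E \<otimes> (X' \<otimes> h)"
  proof -
    have "E \<otimes> (X' \<otimes> h) = X' \<otimes> (U \<otimes> (h \<otimes> (X' \<otimes> h)))" using c hc by (simp add: E_def m_assoc)
    also have "h \<otimes> (X' \<otimes> h) = X' \<otimes> h" using commute_left[OF hc c(1) hX hc] hh by simp
    finally show ?thesis using X by simp
  qed
  have "E \<otimes> E = E \<otimes> (X' \<otimes> h \<otimes> U)" using c hc hU by (simp add: E_def m_assoc)
  also have "\<dots> = E \<otimes> (X' \<otimes> h) \<otimes> U" using c hc Ec by (simp add: m_assoc)
  also have "\<dots> = E" unfolding EX[symmetric] using c hc hU by (simp add: E_def m_assoc)
  finally have E: "E \<in> idempotents R" using Ec by (intro idemI) auto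
  have "h \<otimes> E = E" "E \<otimes> h = E"
    using commute_left[OF hc c(1) hX] commute_left[OF hc c(2) hU] c hc hh by (simp_all add: E_def m_assoc)
  moreover have "a \<otimes> E = E \<otimes> a"
  proof -
    have "a \<otimes> X' = X' \<otimes> a" "a \<otimes> U = U \<otimes> a"
      using commute_pow[OF a Nc aN, of j] UN(3)[of j] by (auto simp: X'_def U_def)
    then show ?thesis
      unfolding E_def using a c hc h(3) by (intro commute_mult) auto
  qed
  ultimately have "E = \<zero> \<or> E = h" using none E by simp
  moreover have "E \<noteq> h"
  proof
    assume "E = h"
    then have "y = E \<otimes> y" using y by simp
    also have "\<dots> = U \<otimes> (X' \<otimes> y)"
      using c hc y commute_left[OF c(1,2) XU] by (simp add: E_def m_assoc)
    also have "X' \<otimes> y = N [^] j0 \<otimes> (N \<otimes> y)" using Nc y by (simp add: X'_def j_def m_assoc)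
    finally show False using y c Nc by simp
  qed
  ultimately have "X' \<otimes> h = \<zero>" using EX c hc by simp
  then show ?thesis by (auto simp: X'_def)
qed

text \<open>For the least degree \<open>d\<close> of a polynomial with a kernel, \<open>N = q(a)\<close> is nilpotent on \<open>h\<close>, and there is a
  vector \<open>x\<close> of small rank for which the elements \<open>N\<^sup>l a\<^sup>i x\<close> are independent. A functional \<open>u\<close> dual to
  the last of these is averaged, first over \<open>N\<close> and then over \<open>a\<close>, to a projection commuting with \<open>a\<close>.\<close>

lemma split_idem:
  assumes a: "a \<in> carrier R" and h: "h \<in> idempotents R" "h \<noteq> \<zero>" "h \<otimes> a = a \<otimes> h"
    and p: "\<And>j. p j \<in> ring_center R" "horner a p n \<otimes> h = \<zero>"
  shows "\<exists>f\<in>idempotents R. h \<otimes> f = f \<and> f \<otimes> h = f \<and> f \<otimes> a = a \<otimes> f \<and> f \<noteq> \<zero> \<and> f \<noteq> h"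
proof (rule ccontr)
  assume "\<not> ?thesis"
  then have none: "f = \<zero> \<or> f = h"
    if "f \<in> idempotents R" "h \<otimes> f = f" "f \<otimes> h = f" "f \<otimes> a = a \<otimes> f" for f
    using that by blast
  have hc: "h \<in> carrier R" using h by auto
  have hh: "h \<otimes> h = h" using h by (auto dest: idemD)
  define S where "S d \<longleftrightarrow> (\<exists>q y. (\<forall>j. q j \<in> ring_center R) \<and> y \<in> carrier R \<and> h \<otimes> y = y \<and> y \<noteq> \<zero> \<and>
    horner a q d \<otimes> y = \<zero>)" for d
  have "S n" using p h hc hh by (auto simp: S_def)
  \<comment> \<open>Minimality: on \<open>h R\<close> no monic polynomial in \<open>a\<close> of
    smaller degree has a kernel, as \<open>independent_powers_exist\<close> requires.\<close>
  define d where "d = (LEAST d. S d)"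
  have "S d" unfolding d_def using \<open>S n\<close> by (rule LeastI)
  have minimal: "\<not> S m" if "m < d" for m using not_less_Least[of m S] that by (simp add: d_def)
  obtain q y0 where q: "\<And>j. q j \<in> ring_center R" and y0: "y0 \<in> carrier R" "h \<otimes> y0 = y0" "y0 \<noteq> \<zero>" "horner a q d \<otimes> y0 = \<zero>"
    using \<open>S d\<close> unfolding S_def by blast
  define N where "N = horner a q d"
  have Nc: "N \<in> carrier R" using a q by (simp add: N_def)
  have aN: "a \<otimes> N = N \<otimes> a" unfolding N_def by (rule horner_commute) (use a q in auto)
  have hN: "h \<otimes> N = N \<otimes> h" unfolding N_def by (rule horner_commute) (use a q h hc in auto)
  have "d \<noteq> 0" using y0 by (cases d) auto
  have ex: "\<exists>j::nat. N [^] j \<otimes> h = \<zero>"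
    by (rule nilpotent_of_no_idems[where p = p and q = q, OF a h p none q N_def])
      (use y0 in \<open>auto simp: N_def\<close>)
  define K where "K = (LEAST j::nat. N [^] j \<otimes> h = \<zero>)"
  have K: "N [^] K \<otimes> h = \<zero>" "\<And>j. j < K \<Longrightarrow> N [^] j \<otimes> h \<noteq> \<zero>"
    unfolding K_def using LeastI_ex[OF ex] not_less_Least[of _ "\<lambda>j. N [^] j \<otimes> h = \<zero>"] by blast+
  have "K \<noteq> 0" using K(1) h hc by (cases K) auto
  then obtain k where k: "K = Suc k" by (cases K) auto
  have Nk: "N [^] k \<in> carrier R" using Nc by simp
  have hpow: "h \<otimes> a [^] i = a [^] i \<otimes> h" "h \<otimes> N [^] i = N [^] i \<otimes> h" for i :: nat
    using commute_pow[OF hc a h(3)] commute_pow[OF hc Nc hN] by auto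
  \<comment> \<open>The vector is sought in the image of the last non-zero power of
    \<open>N\<close>; a preimage under that power then carries the double family.\<close>
  define V where "V = {N [^] k \<otimes> (h \<otimes> s) | s. s \<in> carrier R}"
  have V: "V \<subseteq> carrier R" "\<And>v r. v \<in> V \<Longrightarrow> r \<in> carrier R \<Longrightarrow> v \<otimes> r \<in> V" "\<exists>v\<in>V. v \<noteq> \<zero>"
  proof -
    show "V \<subseteq> carrier R" using Nk hc by (auto simp: V_def)
    show "v \<otimes> r \<in> V" if v: "v \<in> V" and r: "r \<in> carrier R" for v r
    proof -
      obtain s where s: "s \<in> carrier R" "v = N [^] k \<otimes> (h \<otimes> s)" using v by (auto simp: V_def)
      then have "v \<otimes> r = N [^] k \<otimes> (h \<otimes> (s \<otimes> r))" using Nk hc r by (simp add: m_assoc)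
      then show ?thesis using s r by (auto simp: V_def)
    qed
    have "N [^] k \<otimes> (h \<otimes> \<one>) \<noteq> \<zero>" using K(2)[of k] k hc by simp
    then show "\<exists>v\<in>V. v \<noteq> \<zero>" by (auto simp: V_def)
  qed
  have hV: "h \<otimes> v = v" if v: "v \<in> V" for v
  proof -
    obtain s where s: "s \<in> carrier R" "v = N [^] k \<otimes> (h \<otimes> s)" using v by (auto simp: V_def)
    then show ?thesis using commute_left[OF hc Nk hpow(2)] mult_eq_assoc[OF hh] hc by simp
  qed
  have "\<exists>y\<in>V. y \<noteq> \<zero> \<and> indep_powers a d y"
  proof (rule independent_powers_exist[OF a V _ order_refl])
    fix m q' y assume "m < d" and q': "\<And>j. q' j \<in> ring_center R" and y: "y \<in> V" "horner a q' m \<otimes> y = \<zero>"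
    then show "y = \<zero>" using minimal[OF \<open>m < d\<close>] q' hV[OF y(1)] V(1) unfolding S_def by blast
  qed
  then obtain y1 where y1: "y1 \<in> V" "y1 \<noteq> \<zero>" "indep_powers a d y1" by blast
  have y1c: "y1 \<in> carrier R" using y1 V by auto
  obtain w1 where w1: "w1 \<in> carrier R" "y1 \<otimes> w1 \<otimes> y1 = y1" "y1 \<otimes> w1 \<in> idempotents R"
    using quasi_inverse'[OF y1c] by metis
  have ne: "y1 \<otimes> w1 \<noteq> \<zero>" using w1 y1 y1c by auto
  \<comment> \<open>\<open>Y\<close> will be a double average of \<open>u\<close> with
    \<open>K\<close> and then \<open>d\<close> summands, so \<open>rk Y \<le> d K rk y\<close>; the
    bound keeps \<open>Y\<close> different from \<open>h\<close>.\<close>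
  have "0 < rk h / (real d * real K)" using rk_pos[OF hc h(2)] \<open>d \<noteq> 0\<close> \<open>K \<noteq> 0\<close> by simp
  then obtain y where y: "y \<in> idempotents R" "y1 \<otimes> w1 \<otimes> y = y" "y \<noteq> \<zero>" "rk y < rk h / (real d * real K)"
    using small_idem[OF w1(3) ne] by metis
  have yc: "y \<in> carrier R" using y by auto
  have yy: "y = y1 \<otimes> (w1 \<otimes> y)" using y(2) y1c w1 yc by (simp add: m_assoc)
  have yV: "y \<in> V" using V(2)[OF y1(1), of "w1 \<otimes> y"] yy w1 yc by simp
  have yind: "indep_powers a d y" using indep_powers_mult[OF y1(3) a y1c, of "w1 \<otimes> y"] yy w1 yc by simp
  obtain s where s: "s \<in> carrier R" "y = N [^] k \<otimes> (h \<otimes> s)" using yV by (auto simp: V_def)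
  \<comment> \<open>The extra factor \<open>y\<close> gives \<open>x\<close> the same right
    annihilator as its image \<open>y\<close>, and rank at most \<open>rk y\<close>.\<close>
  define x where "x = h \<otimes> s \<otimes> y"
  have xc: "x \<in> carrier R" using hc s yc by (simp add: x_def)
  have Nx: "N [^] k \<otimes> x = y"
    using mult_eq_assoc[of "N [^] k" "h \<otimes> s" y y] s Nk hc yc idemD(2)[OF y(1)] by (simp add: x_def)
  have hx: "h \<otimes> x = x" using mult_eq_assoc[OF hh, of "s \<otimes> y"] hc s yc by (simp add: x_def m_assoc)
  have "x \<noteq> \<zero>" using Nx y Nk by auto
  have nil: "N [^] Suc k \<otimes> (h \<otimes> t) = \<zero>" if "t \<in> carrier R" for t
    using mult_eq_assoc[of "N [^] Suc k" h \<zero> t] K(1) k Nc hc that by simp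
  have nilx: "N [^] Suc k \<otimes> x = \<zero>" using nil[OF xc] hx by simp
  have faithful: "x \<otimes> r = \<zero>" if "r \<in> carrier R" "y \<otimes> r = \<zero>" for r
    using that hc s yc by (simp add: x_def m_assoc)
  define I where "I = {..<Suc k} \<times> {..<d}"
  define top where "top = (k, d - 1)"
  define B where "B p = N [^] fst p \<otimes> (a [^] snd p \<otimes> x)" for p :: "nat \<times> nat"
  have Bc: "B p \<in> carrier R" for p using Nc a xc by (simp add: B_def)
  have I: "finite I" "top \<in> I" using \<open>d \<noteq> 0\<close> by (auto simp: I_def top_def)
  have hB: "h \<otimes> B p = B p" for p
    using commute_left[OF hc _ hpow(2)] commute_left[OF hc _ hpow(1)] Nc a xc hx by (simp add: B_def)
  obtain g r where g: "g \<in> idempotents R" "\<And>p. p \<in> I - {top} \<Longrightarrow> g \<otimes> B p = B p"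
    "\<And>p. p \<in> I - {top} \<Longrightarrow> r p \<in> carrier R" "g = (\<Oplus>p\<in>I - {top}. B p \<otimes> r p)"
    using finite_sum_idem[of "I - {top}" B] I Bc by (auto simp: Pi_iff)
  have gc: "g \<in> carrier R" using g by auto
  \<comment> \<open>\<open>T\<close> is the top vector modulo the span \<open>g R\<close> of the
    others; by independence \<open>T t = 0\<close> forces \<open>x t = 0\<close>, so
    \<open>x\<close> can be recovered from \<open>T\<close>.\<close>
  define T where "T = (\<one> \<ominus> g) \<otimes> B top"
  have Tc: "T \<in> carrier R" using gc Bc by (simp add: T_def)
  have T_faithful: "x \<otimes> t = \<zero>" if t: "t \<in> carrier R" "T \<otimes> t = \<zero>" for t
  proof -
    let ?b = "B top \<otimes> t"
    have bc: "?b \<in> carrier R" using Bc t by simp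
    have "T \<otimes> t = ?b \<ominus> g \<otimes> ?b" using gc Bc t by (simp add: T_def l_minus_distr m_assoc)
    then have gb: "?b = g \<otimes> ?b" using t(2) bc gc eq_iff_minus_zero[of ?b "g \<otimes> ?b"] by simp
    define r' where "r' p = (if p = top then \<ominus> t else r p \<otimes> ?b)" for p
    have r'c: "r' p \<in> carrier R" if "p \<in> I" for p using g(3) t bc that by (auto simp: r'_def)
    have "(\<Oplus>p\<in>I. B p \<otimes> r' p) = B top \<otimes> r' top \<oplus> (\<Oplus>p\<in>I - {top}. B p \<otimes> r' p)"
    proof -
      have "I = insert top (I - {top})" using I by auto
      then have "(\<Oplus>p\<in>I. B p \<otimes> r' p) = (\<Oplus>p\<in>insert top (I - {top}). B p \<otimes> r' p)" by simp
      also have "\<dots> = B top \<otimes> r' top \<oplus> (\<Oplus>p\<in>I - {top}. B p \<otimes> r' p)"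
        using I Bc r'c by (subst finsum_insert) auto
      finally show ?thesis .
    qed
    also have "(\<Oplus>p\<in>I - {top}. B p \<otimes> r' p) = (\<Oplus>p\<in>I - {top}. B p \<otimes> r p \<otimes> ?b)"
      using Bc g(3) bc by (intro finsum_cong') (auto simp: r'_def m_assoc)
    also have "\<dots> = g \<otimes> ?b"
      unfolding g(4) using Bc g(3) bc I by (subst finsum_ldistr) auto
    also have "B top \<otimes> r' top = \<ominus> ?b" using Bc t by (simp add: r'_def r_minus)
    finally have zero: "(\<Oplus>p\<in>I. B p \<otimes> r' p) = \<zero>" using gb bc by (simp add: l_neg)
    have "(\<Oplus>p\<in>I. N [^] fst p \<otimes> (a [^] snd p \<otimes> (x \<otimes> r' p))) = (\<Oplus>p\<in>I. B p \<otimes> r' p)"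
      using Nc a xc r'c by (intro finsum_cong') (auto simp: B_def m_assoc)
    then have "x \<otimes> r' (k, d - 1) = \<zero>"
      using zero r'c yind faithful \<open>d \<noteq> 0\<close> unfolding I_def
      by (intro indep_double_powers[where r = r' and d = d and k = k, OF Nc aN[symmetric] a xc nilx])
        (simp_all add: Nx)
    then have "\<ominus> (x \<otimes> t) = \<zero>" using xc t by (simp add: r'_def top_def r_minus)
    then show ?thesis using xc t by (metis m_closed minus_minus minus_zero)
  qed
  obtain w where w: "w \<in> carrier R" "T \<otimes> w \<otimes> T = T" using quasi_inverse'[OF Tc] by metis
  have "T \<otimes> (\<one> \<ominus> w \<otimes> T) = \<zero>" using Tc w by (simp add: r_minus_distr m_assoc)
  then have "x \<otimes> (\<one> \<ominus> w \<otimes> T) = \<zero>" using T_faithful[of "\<one> \<ominus> w \<otimes> T"] Tc w(1) by simp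
  then have xwT: "x \<otimes> (w \<otimes> T) = x" using xc Tc w(1) by (simp add: r_minus_distr)
  \<comment> \<open>The dual functional: \<open>u\<close> sends \<open>B top\<close> to
    \<open>x\<close> and kills the other \<open>B p\<close>. Extracting the top coefficient in this
    way is the Frobenius form.\<close>
  define u where "u = x \<otimes> (w \<otimes> ((\<one> \<ominus> g) \<otimes> h))"
  have uc: "u \<in> carrier R" using xc w gc hc by (simp add: u_def)
  have hu: "h \<otimes> u = u" using mult_eq_assoc[OF hx] hc xc w gc by (simp add: u_def)
  have uh: "u \<otimes> h = u" using hc xc w gc hh by (simp add: u_def m_assoc)
  have uB: "u \<otimes> B p = (if p = top then x else \<zero>)" if p: "p \<in> I" for p
  proof -
    have "u \<otimes> B p = x \<otimes> (w \<otimes> ((\<one> \<ominus> g) \<otimes> B p))" using xc w gc hc Bc hB by (simp add: u_def m_assoc)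
    moreover have "(\<one> \<ominus> g) \<otimes> B p = \<zero>" if "p \<noteq> top" using g(2)[of p] p that Bc gc by (simp add: l_minus_distr)
    ultimately show ?thesis using xwT xc w by (auto simp: T_def)
  qed
  \<comment> \<open>With zero coefficients \<open>horner\<close> gives powers, so \<open>v\<close>
    is the sum of \<open>N^i u N^j\<close> over \<open>i + j = K - 1\<close>, and its commutator
    with \<open>N\<close> is \<open>N^K u - u N^K = 0\<close>.\<close>
  define v where "v = casimir N (\<lambda>_. \<zero>) u K"
  have vc: "v \<in> carrier R" using Nc uc by (simp add: v_def)
  have Nv: "N \<otimes> v = v \<otimes> N"
  proof -
    have Kc: "N [^] K \<in> carrier R" using Nc by simp
    have "N [^] K \<otimes> u = N [^] K \<otimes> (h \<otimes> u)" using hu by simp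
    also have "\<dots> = \<zero>" using nil[OF uc] k by simp
    finally have 1: "N [^] K \<otimes> u = \<zero>" .
    have "u \<otimes> N [^] K = u \<otimes> h \<otimes> N [^] K" using uh by simp
    also have "\<dots> = u \<otimes> (N [^] K \<otimes> h)" using uc hc Kc hpow(2)[of K] by (simp add: m_assoc)
    finally have 2: "u \<otimes> N [^] K = \<zero>" using K uc by simp
    have "N \<otimes> v \<ominus> v \<otimes> N = \<zero>"
      unfolding v_def using casimir_commute[of N "\<lambda>_. \<zero>" u K] Nc uc horner_zero[OF Nc] 1 2 by simp
    then show ?thesis using Nc vc by simp
  qed
  \<comment> \<open>The second average: its commutator with \<open>a\<close> is that of
    \<open>N = q(a)\<close> with \<open>v\<close>, which is zero.\<close>
  define Y where "Y = casimir a q v d"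
  have Yc: "Y \<in> carrier R" using a q vc by (simp add: Y_def)
  have aY: "a \<otimes> Y = Y \<otimes> a"
  proof -
    have "a \<otimes> Y \<ominus> Y \<otimes> a = N \<otimes> v \<ominus> v \<otimes> N"
      unfolding Y_def N_def by (rule casimir_commute[of a q v d, OF a q vc])
    then have "a \<otimes> Y \<ominus> Y \<otimes> a = \<zero>" using Nv Nc vc by simp
    then show ?thesis using a Yc by simp
  qed
  have YN: "Y \<otimes> N = N \<otimes> Y" unfolding N_def by (rule horner_commute) (use a q Yc aY in auto)
  have low: "casimir N (\<lambda>_. \<zero>) u m \<otimes> (a [^] i \<otimes> x) = \<zero>" if "m \<le> k" "i < d" for m i
    using that
  proof (induction m)
    case (Suc m)
    have "u \<otimes> B (m, i) = \<zero>" using uB[of "(m, i)"] Suc.prems by (auto simp: I_def top_def)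
    then have "u \<otimes> N [^] m \<otimes> (a [^] i \<otimes> x) = \<zero>" using uc Nc a xc by (simp add: B_def m_assoc)
    then show ?case using Suc Nc uc a xc horner_zero[OF Nc] by (simp add: l_distr m_assoc)
  qed (use a xc in simp)
  have vx: "v \<otimes> (a [^] i \<otimes> x) = (if i = d - 1 then x else \<zero>)" if i: "i < d" for i
  proof -
    have "u \<otimes> N [^] k \<otimes> (a [^] i \<otimes> x) = (if i = d - 1 then x else \<zero>)"
      using uB[of "(k, i)"] i uc Nc a xc by (auto simp: I_def top_def B_def m_assoc)
    moreover have "v = N \<otimes> casimir N (\<lambda>_. \<zero>) u k \<oplus> u \<otimes> N [^] k"
      using horner_zero[OF Nc] by (simp add: v_def k)
    ultimately show ?thesis
      using low[OF order_refl i] Nc uc a xc by (simp add: l_distr m_assoc)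
  qed
  have lowY: "casimir a q v m \<otimes> x = \<zero>" if "m \<le> d - 1" for m
    using that
  proof (induction m)
    case (Suc m)
    have "v \<otimes> (horner a q m \<otimes> x) = v \<otimes> (a [^] m \<otimes> x)"
      by (rule horner_apply) (use a q xc vc vx Suc.prems in auto)
    also have "\<dots> = \<zero>" using vx[of m] Suc.prems by auto
    finally show ?case using Suc a q vc xc by (simp add: l_distr m_assoc)
  qed (use xc in simp)
  \<comment> \<open>Of the summands of \<open>Y\<close> only the last one, \<open>v\<close> times a
    monic polynomial of degree \<open>d - 1\<close> in \<open>a\<close>, acts non-trivially on
    \<open>x\<close>, and \<open>v\<close> picks out its leading term.\<close>
  have Yx: "Y \<otimes> x = x"
  proof -
    obtain d' where d': "d = Suc d'" using \<open>d \<noteq> 0\<close> by (cases d) auto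
    have "v \<otimes> (horner a q d' \<otimes> x) = v \<otimes> (a [^] d' \<otimes> x)"
      by (rule horner_apply) (use a q xc vc vx d' in auto)
    also have "\<dots> = x" using vx[of d'] d' by simp
    finally show ?thesis using lowY[of d'] d' a q vc xc by (simp add: Y_def l_distr m_assoc)
  qed
  \<comment> \<open>\<open>u\<close> factors through \<open>x\<close>, so \<open>Y\<close> fixes
    \<open>u\<close>; commuting with \<open>N\<close> and \<open>a\<close>, it then fixes
    \<open>v\<close> and finally itself.\<close>
  have Yu: "Y \<otimes> u = u" using mult_eq_assoc[OF Yx] Yc xc w gc hc by (simp add: u_def)
  have Yv: "Y \<otimes> v = v" unfolding v_def by (rule casimir_left) (use Nc uc Yc YN Yu in auto)
  have "Y \<otimes> Y = Y"
    using casimir_left[of a q v Y d, OF a q vc Yc aY[symmetric] Yv] by (simp add: Y_def[symmetric])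
  then have Y: "Y \<in> idempotents R" using Yc by (intro idemI)
  have hv: "h \<otimes> v = v" "v \<otimes> h = v" unfolding v_def
    by (rule casimir_left casimir_right; use Nc uc hc hN hu uh in auto)+
  have "h \<otimes> Y = Y" "Y \<otimes> h = Y" unfolding Y_def
    by (rule casimir_left casimir_right; use a q vc hc h(3) hv in auto)+
  then have "Y = \<zero> \<or> Y = h" using none Y aY by simp
  moreover have "Y \<noteq> \<zero>" using Yx \<open>x \<noteq> \<zero>\<close> xc by auto
  moreover have "rk Y < rk h"
  proof -
    have "rk u \<le> rk x" unfolding u_def by (rule rk_mult_left) (use xc w gc hc in auto)
    also have "rk x \<le> rk y" unfolding x_def by (rule rk_mult_right) (use hc s yc in auto)
    finally have uy: "rk u \<le> rk y" .
    have "rk v \<le> real K * rk u" unfolding v_def by (rule casimir_rk) (use Nc uc in auto)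
    also have "\<dots> \<le> real K * rk y" using uy by (simp add: mult_left_mono)
    finally have vy: "rk v \<le> real K * rk y" .
    have "rk Y \<le> real d * rk v" unfolding Y_def by (rule casimir_rk[of a q v d, OF a q vc])
    also have "\<dots> \<le> real d * (real K * rk y)" using vy by (simp add: mult_left_mono)
    also have "\<dots> < rk h" using y(4) \<open>d \<noteq> 0\<close> \<open>K \<noteq> 0\<close> by (simp add: field_simps)
    finally show ?thesis .
  qed
  ultimately show False by auto
qed

end

section \<open>Algebraic elements of a corner\<close>

context ring
begin

lemma corner_carrier:
  assumes "e \<in> idempotents R"
  shows "carrier (corner_ring R e) = {y \<in> carrier R. e \<otimes> y = y \<and> y \<otimes> e = y}"
proof (intro equalityI subsetI)
  fix y assume "y \<in> carrier (corner_ring R e)"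
  then obtain x where "x \<in> carrier R" "y = e \<otimes> x \<otimes> e" by (auto simp: corner_ring_def)
  then show "y \<in> {y \<in> carrier R. e \<otimes> y = y \<and> y \<otimes> e = y}"
    using mult_eq_assoc[OF idemD(2)[OF assms]] idemD[OF assms] by (simp add: m_assoc)
next
  fix y assume "y \<in> {y \<in> carrier R. e \<otimes> y = y \<and> y \<otimes> e = y}"
  then have "y \<in> carrier R" "y = e \<otimes> y \<otimes> e" by auto
  then show "y \<in> carrier (corner_ring R e)" unfolding corner_ring_def by force
qed

lemma corner_simps [simp]:
  "x \<otimes>\<^bsub>corner_ring R e\<^esub> y = x \<otimes> y" "x \<oplus>\<^bsub>corner_ring R e\<^esub> y = x \<oplus> y"
  "\<one>\<^bsub>corner_ring R e\<^esub> = e" "\<zero>\<^bsub>corner_ring R e\<^esub> = \<zero>"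
  by (simp_all add: corner_ring_def)

lemma corner_ring_ring:
  assumes e: "e \<in> idempotents R"
  shows "ring (corner_ring R e)"
proof (rule ringI)
  have ec: "e \<in> carrier R" "e \<otimes> e = e" using e idemD by auto
  show "abelian_group (corner_ring R e)"
  proof (rule abelian_groupI)
    fix x assume "x \<in> carrier (corner_ring R e)"
    then show "\<exists>y\<in>carrier (corner_ring R e). y \<oplus>\<^bsub>corner_ring R e\<^esub> x = \<zero>\<^bsub>corner_ring R e\<^esub>"
      using ec by (intro bexI[of _ "\<ominus> x"]) (auto simp: corner_carrier[OF e] l_neg l_minus r_minus)
  next
    fix x y assume "x \<in> carrier (corner_ring R e)" "y \<in> carrier (corner_ring R e)"
    then show "x \<oplus>\<^bsub>corner_ring R e\<^esub> y = y \<oplus>\<^bsub>corner_ring R e\<^esub> x"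
      using a_comm by (auto simp: corner_carrier[OF e])
  qed (use ec in \<open>auto simp: corner_carrier[OF e] l_distr r_distr a_assoc\<close>)
  show "monoid (corner_ring R e)"
    using ec mult_eq_assoc[of e]
    by (intro monoidI) (auto simp: corner_carrier[OF e] m_assoc)
qed (use e in \<open>auto simp: corner_carrier l_distr r_distr\<close>)

lemma horner_cong: "(\<And>j. j < n \<Longrightarrow> p j = q j) \<Longrightarrow> horner a p n = horner a q n"
  by (induction n) auto

text \<open>On \<open>e R\<close>, multiplication by \<open>a\<close> and by its component
  \<open>b = a e\<close> agree, so a relation found in a corner holds for \<open>a\<close> below
  \<open>e\<close>.\<close>

lemma horner_restrict:
  assumes a: "a \<in> carrier R" and p: "\<And>j. p j \<in> ring_center R"
    and e: "e \<in> carrier R" "a \<otimes> e = e \<otimes> a" "b = a \<otimes> e" "e \<otimes> e = e" and h: "h \<in> carrier R" "e \<otimes> h = h"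
  shows "horner a p n \<otimes> h = horner b p n \<otimes> h"
proof (induction n)
  case (Suc n)
  have bc: "b \<in> carrier R" using e a by simp
  have eb: "e \<otimes> b = b \<otimes> e" unfolding e(3) using a e(1,4) mult_eq_assoc[OF e(4)] e(2)[symmetric] by (metis m_assoc)
  have H: "e \<otimes> horner b p n = horner b p n \<otimes> e" by (rule horner_commute) (use bc p e eb in auto)
  have pc: "p n \<in> carrier R" using p center_closed by blast
  have eHb: "e \<otimes> (horner b p n \<otimes> h) = horner b p n \<otimes> h"
    using mult_eq_assoc[OF H, of h] bc p e(1) h by (simp add: m_assoc)
  have "a \<otimes> (horner b p n \<otimes> h) = a \<otimes> (e \<otimes> (horner b p n \<otimes> h))" using eHb by simp
  also have "\<dots> = b \<otimes> (horner b p n \<otimes> h)" using e(3) a e(1) bc p h by (simp add: m_assoc)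
  finally show ?case using Suc a bc p pc h by (simp add: l_distr m_assoc)
qed (use h in simp)

end

text \<open>The coefficients live in the centre of the corner and are lifted to the centre of
  \<open>R\<close> by \<open>center_lift\<close>; dividing by the leading one makes the polynomial
  monic, as \<open>horner\<close> requires.\<close>

lemma (in nondiscrete_continuous_ring) algebraic_corner:
  assumes e: "e \<in> idempotents R" "e \<noteq> \<zero>" and b: "b \<in> algebraic_elems (corner_ring R e)"
  shows "b \<in> carrier R \<and> e \<otimes> b = b \<and> b \<otimes> e = b \<and> (\<exists>p n. (\<forall>j. p j \<in> ring_center R) \<and> horner b p n \<otimes> e = \<zero>)"
proof -
  let ?S = "corner_ring R e"
  interpret S: ring ?S using corner_ring_ring[OF e(1)] .
  have ec: "e \<in> carrier R" "e \<otimes> e = e" using e idemD by auto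
  have Sc: "carrier ?S = {y \<in> carrier R. e \<otimes> y = y \<and> y \<otimes> e = y}" using corner_carrier[OF e(1)] .
  obtain P where bS: "b \<in> carrier ?S" and P: "P \<in> carrier (univ_poly ?S (ring_center ?S))"
    "P \<noteq> \<zero>\<^bsub>univ_poly ?S (ring_center ?S)\<^esub>" "S.eval P b = \<zero>"
    using b by (auto simp: algebraic_elems_def)
  have bc: "b \<in> carrier R" "e \<otimes> b = b" "b \<otimes> e = b" using bS Sc by auto
  have poly: "set P \<subseteq> ring_center ?S" "P \<noteq> []" "hd P \<noteq> \<zero>"
    using P(1,2) by (auto simp: univ_poly_def polynomial_def)
  have lift: "\<exists>k\<in>ring_center R. k \<otimes> e = c" if c: "c \<in> ring_center ?S" for c
  proof -
    have cc: "c \<in> carrier R" "e \<otimes> c = c" "c \<otimes> e = c" using c Sc by (auto simp: ring_center_def)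
    have "c \<otimes> (e \<otimes> r \<otimes> e) = (e \<otimes> r \<otimes> e) \<otimes> c" if "r \<in> carrier R" for r
      using c that by (auto simp: ring_center_def corner_ring_def)
    then show ?thesis using center_lift[OF e cc] by metis
  qed
  obtain c0 cs where P': "P = c0 # cs" using poly(2) by (cases P) auto
  obtain k0 where k0: "k0 \<in> ring_center R" "k0 \<otimes> e = c0" using lift[of c0] poly(1) P' by auto
  have "k0 \<noteq> \<zero>" using k0 poly(3) P' ec by auto
  then obtain k' where k': "k' \<in> ring_center R" "k' \<otimes> k0 = \<one>" "k0 \<otimes> k' = \<one>" using center_inverse k0(1) by metis
  have kc: "k0 \<in> carrier R" "k' \<in> carrier R" using k0 k' center_closed by auto
  \<comment> \<open>Induction from the end of the list matches Horner's scheme: the coefficient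
    appended last is added after one more multiplication by \<open>b\<close>.\<close>
  have "\<exists>q. (\<forall>j. q j \<in> ring_center R) \<and> S.eval (c0 # cs) b = k0 \<otimes> (horner b q (length cs) \<otimes> e)"
    if "set (c0 # cs) \<subseteq> ring_center ?S" for cs
    using that
  proof (induction cs rule: rev_induct)
    case Nil
    have "c0 \<in> carrier ?S" using Nil by (auto simp: ring_center_def)
    then show ?case using k0 ec Sc by (intro exI[of _ "\<lambda>_. \<zero>"]) auto
  next
    case (snoc c cs)
    obtain q where q: "\<And>j. q j \<in> ring_center R" "S.eval (c0 # cs) b = k0 \<otimes> (horner b q (length cs) \<otimes> e)"
      using snoc by auto
    obtain k where k: "k \<in> ring_center R" "k \<otimes> e = c" using lift[of c] snoc.prems by auto
    have kkc: "k \<in> carrier R" using k center_closed by auto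
    let ?m = "length cs"
    have Hc: "horner b q ?m \<in> carrier R" using bc q by simp
    have "c0 \<in> carrier ?S" "set cs \<subseteq> carrier ?S" "c \<in> carrier ?S"
      using snoc.prems by (auto simp: ring_center_def)
    then have "S.eval ((c0 # cs) @ [c]) b = S.eval (c0 # cs) b \<otimes> b \<oplus> c"
      using S.eval_append_aux[of "c0 # cs" c b] bS by simp
    also have "\<dots> = k0 \<otimes> (horner b q ?m \<otimes> e) \<otimes> b \<oplus> k \<otimes> e" using q(2) k(2) by simp
    also have "\<dots> = k0 \<otimes> ((b \<otimes> horner b q ?m \<oplus> k' \<otimes> k) \<otimes> e)"
    proof -
      have "horner b q ?m \<otimes> b = b \<otimes> horner b q ?m"
        by (rule horner_commute[symmetric]) (use bc q in auto)
      then have "k0 \<otimes> (horner b q ?m \<otimes> e) \<otimes> b = k0 \<otimes> (b \<otimes> horner b q ?m \<otimes> e)"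
        using kc Hc ec bc
        by (metis (no_types, lifting) m_assoc m_closed)
      moreover have "k0 \<otimes> (k' \<otimes> k \<otimes> e) = k \<otimes> e"
        using mult_eq_assoc[OF k'(3)] kc kkc ec by (simp add: m_assoc)
      ultimately show ?thesis using kc kkc Hc ec bc by (simp add: l_distr r_distr)
    qed
    finally have eval: "S.eval (c0 # (cs @ [c])) b = k0 \<otimes> ((b \<otimes> horner b q ?m \<oplus> k' \<otimes> k) \<otimes> e)" by simp
    define q' where "q' = q(?m := k' \<otimes> k)"
    have "q' j \<in> ring_center R" for j
      using q(1) k'(1) k(1) subringE(6)[OF subring_center] by (simp add: q'_def)
    moreover have "horner b q' ?m = horner b q ?m" by (rule horner_cong) (simp add: q'_def)
    ultimately have "\<forall>j. q' j \<in> ring_center R"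
      "horner b q' (length (cs @ [c])) = b \<otimes> horner b q ?m \<oplus> k' \<otimes> k"
      by (simp_all only: length_append_singleton horner.simps) (simp_all add: q'_def)
    then show ?case using eval by metis
  qed
  then obtain q where q: "\<And>j. q j \<in> ring_center R" "S.eval (c0 # cs) b = k0 \<otimes> (horner b q (length cs) \<otimes> e)"
    using poly(1) P' by blast
  let ?H = "horner b q (length cs) \<otimes> e"
  have "?H \<in> carrier R" using bc q ec by simp
  then have "?H = k' \<otimes> (k0 \<otimes> ?H)" using mult_eq_assoc[OF k'(2)] kc by simp
  also have "k0 \<otimes> ?H = \<zero>" using P(3) unfolding P' q(2) .
  also have "k' \<otimes> \<zero> = \<zero>" using kc by simp
  finally show ?thesis using bc q(1) by blast
qed

section \<open>Maximal chains of commuting idempotents\<close>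

context nondiscrete_continuous_ring
begin

definition idem_le :: "'a \<Rightarrow> 'a \<Rightarrow> bool" where
  "idem_le e f \<longleftrightarrow> f \<otimes> e = e \<and> e \<otimes> f = e"

definition commuting_idems :: "'a set \<Rightarrow> 'a set" where
  "commuting_idems W = {e \<in> idempotents R. \<forall>x\<in>W. x \<otimes> e = e \<otimes> x}"

definition max_chain :: "'a set \<Rightarrow> 'a set \<Rightarrow> bool" where
  "max_chain W C \<longleftrightarrow> C \<subseteq> commuting_idems W \<and> (\<forall>c\<in>C. \<forall>c'\<in>C. idem_le c c' \<or> idem_le c' c) \<and>
     (\<forall>x\<in>commuting_idems W. (\<forall>c\<in>C. idem_le c x \<or> idem_le x c) \<longrightarrow> x \<in> C)"

lemma idem_le_trans:
  assumes "idem_le e f" "idem_le f g" "e \<in> carrier R" "f \<in> carrier R" "g \<in> carrier R"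
  shows "idem_le e g"
proof -
  have le: "f \<otimes> e = e" "e \<otimes> f = e" "g \<otimes> f = f" "f \<otimes> g = f" using assms(1,2) by (auto simp: idem_le_def)
  have "g \<otimes> (f \<otimes> e) = f \<otimes> e" "e \<otimes> (f \<otimes> g) = e \<otimes> g"
    using assms(3-5) mult_eq_assoc[OF le(3)] mult_eq_assoc[OF le(2)] by blast+
  then show ?thesis unfolding le idem_le_def by simp
qed

lemma idem_le_rk:
  assumes "idem_le e f" "e \<in> idempotents R" "f \<in> idempotents R"
  shows "rk e \<le> rk f" "rk e = rk f \<Longrightarrow> e = f" "rk (f \<ominus> e) = rk f - rk e" "f \<ominus> e \<in> idempotents R"
  using assms rk_idem_less[of f e] rk_idem_minus[of f e] idem_minus[of f e] unfolding idem_le_def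
  by fastforce+

lemma max_chain_exists: "\<exists>C. max_chain W C"
proof -
  interpret P: pred_on "commuting_idems W" idem_le .
  obtain C where C: "P.maxchain C" using P.Hausdorff by blast
  have idem: "idem_le c c" if "c \<in> commuting_idems W" for c
    using that idemD by (auto simp: commuting_idems_def idem_le_def)
  have sub: "C \<subseteq> commuting_idems W" and tot: "idem_le c c' \<or> idem_le c' c" if "c \<in> C" "c' \<in> C" for c c'
    using C idem that unfolding P.maxchain_def P.chain_def by blast+
  have CW: "C \<subseteq> commuting_idems W" using C unfolding P.maxchain_def P.chain_def by blast
  have "x \<in> C" if x: "x \<in> commuting_idems W" "\<forall>c\<in>C. idem_le c x \<or> idem_le x c" for x
  proof (rule ccontr)
    assume "x \<notin> C"
    have "P.chain (insert x C)" using CW tot x idem unfolding P.chain_def by blast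
    then show False using C \<open>x \<notin> C\<close> unfolding P.maxchain_def by blast
  qed
  then show ?thesis using CW tot unfolding max_chain_def by blast
qed

lemma compl_commuting: "e \<in> commuting_idems W \<Longrightarrow> W \<subseteq> carrier R \<Longrightarrow> \<one> \<ominus> e \<in> commuting_idems W"
  using idem_compl by (auto simp: commuting_idems_def l_minus_distr r_minus_distr subset_iff)

lemma compl_compl: "e \<in> carrier R \<Longrightarrow> \<one> \<ominus> (\<one> \<ominus> e) = e"
  using one_closed by algebra

lemma compl_le:
  assumes "idem_le e f" "e \<in> idempotents R" "f \<in> idempotents R"
  shows "idem_le (\<one> \<ominus> f) (\<one> \<ominus> e)"
proof -
  have c: "e \<in> carrier R" "f \<in> carrier R" using assms by auto
  have "\<one> \<ominus> e \<ominus> (f \<ominus> e) = \<one> \<ominus> f" using c one_closed by algebra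
  then show ?thesis using assms(1) c by (simp add: idem_le_def l_minus_distr r_minus_distr)
qed

text \<open>Complementation reverses the order, so statements on infima follow from those on
  suprema.\<close>

lemma max_chain_compl:
  assumes C: "max_chain W C" and W: "W \<subseteq> carrier R"
  shows "max_chain W ((\<lambda>c. \<one> \<ominus> c) ` C)"
proof -
  have CW: "C \<subseteq> commuting_idems W" and tot: "\<And>c c'. c \<in> C \<Longrightarrow> c' \<in> C \<Longrightarrow> idem_le c c' \<or> idem_le c' c"
    and max: "\<And>x. x \<in> commuting_idems W \<Longrightarrow> (\<And>c. c \<in> C \<Longrightarrow> idem_le c x \<or> idem_le x c) \<Longrightarrow> x \<in> C"
    using C unfolding max_chain_def by blast+
  have Ci: "c \<in> idempotents R" if "c \<in> C" for c using CW that by (auto simp: commuting_idems_def)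
  have "x \<in> (\<lambda>c. \<one> \<ominus> c) ` C"
    if x: "x \<in> commuting_idems W" "\<forall>c\<in>(\<lambda>c. \<one> \<ominus> c) ` C. idem_le c x \<or> idem_le x c" for x
  proof -
    have xi: "x \<in> idempotents R" using x by (auto simp: commuting_idems_def)
    have "\<one> \<ominus> x \<in> C"
    proof (rule max)
      show "\<one> \<ominus> x \<in> commuting_idems W" using compl_commuting x(1) W by blast
      fix c assume c: "c \<in> C"
      then have "idem_le (\<one> \<ominus> c) x \<or> idem_le x (\<one> \<ominus> c)" using x(2) by blast
      then have "idem_le (\<one> \<ominus> x) (\<one> \<ominus> (\<one> \<ominus> c)) \<or> idem_le (\<one> \<ominus> (\<one> \<ominus> c)) (\<one> \<ominus> x)"
        using compl_le xi idem_compl[OF Ci[OF c]] by blast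
      then show "idem_le c (\<one> \<ominus> x) \<or> idem_le (\<one> \<ominus> x) c" using compl_compl[of c] Ci[OF c] by auto
    qed
    moreover have "x = \<one> \<ominus> (\<one> \<ominus> x)" using compl_compl[of x] xi by auto
    ultimately show ?thesis by blast
  qed
  moreover have "(\<lambda>c. \<one> \<ominus> c) ` C \<subseteq> commuting_idems W" using CW compl_commuting W by blast
  moreover have "\<forall>c\<in>(\<lambda>c. \<one> \<ominus> c) ` C. \<forall>c'\<in>(\<lambda>c. \<one> \<ominus> c) ` C. idem_le c c' \<or> idem_le c' c"
  proof safe
    fix c c' assume "c \<in> C" "c' \<in> C" and no: "\<not> idem_le (\<one> \<ominus> c') (\<one> \<ominus> c)"
    then show "idem_le (\<one> \<ominus> c) (\<one> \<ominus> c')" using tot compl_le[OF _ Ci Ci] by blast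
  qed
  ultimately show ?thesis unfolding max_chain_def by blast
qed

lemma max_chain_zero:
  assumes C: "max_chain W C" and W: "W \<subseteq> carrier R"
  shows "\<zero> \<in> C"
proof -
  have "\<zero> \<in> commuting_idems W" using W by (auto simp: commuting_idems_def)
  moreover have "idem_le \<zero> c" if "c \<in> C" for c
    using C that by (auto simp: max_chain_def commuting_idems_def idem_le_def)
  ultimately show ?thesis using C unfolding max_chain_def by blast
qed

text \<open>If the supremum \<open>\<alpha>\<close> of the ranks up to \<open>t\<close> were not
  attained, an increasing sequence in the chain with ranks tending to \<open>\<alpha>\<close> would
  have a limit \<open>G\<close>. It is comparable with the whole chain, so maximality puts it in
  \<open>C\<close>; continuity of the rank gives it rank at most \<open>\<alpha>\<close>, yet it
  lies above the whole sequence.\<close>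

lemma max_chain_sup:
  assumes C: "max_chain W C" and W: "W \<subseteq> carrier R" and t: "0 \<le> t"
  shows "\<exists>g\<in>C. rk g \<le> t \<and> (\<forall>c\<in>C. rk c \<le> t \<longrightarrow> rk c \<le> rk g)"
proof (rule ccontr)
  assume none: "\<not> ?thesis"
  have CW: "C \<subseteq> commuting_idems W" and tot: "\<And>c c'. c \<in> C \<Longrightarrow> c' \<in> C \<Longrightarrow> idem_le c c' \<or> idem_le c' c"
    and max: "\<And>x. x \<in> commuting_idems W \<Longrightarrow> (\<And>c. c \<in> C \<Longrightarrow> idem_le c x \<or> idem_le x c) \<Longrightarrow> x \<in> C"
    using C unfolding max_chain_def by blast+
  have Ci: "c \<in> idempotents R" if "c \<in> C" for c using CW that by (auto simp: commuting_idems_def)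
  have le: "idem_le c c'" if "c \<in> C" "c' \<in> C" "rk c < rk c'" for c c'
    using tot[OF that(1,2)] idem_le_rk(1)[of c' c] that Ci by fastforce
  define L where "L = {c \<in> C. rk c \<le> t}"
  define \<alpha> where "\<alpha> = Sup (rk ` L)"
  have L0: "\<zero> \<in> L" using max_chain_zero[OF C W] t by (simp add: L_def)
  have bdd: "bdd_above (rk ` L)" by (auto simp: L_def intro: bdd_aboveI[of _ t])
  have below: "rk c < \<alpha>" if c: "c \<in> L" for c
  proof -
    obtain c' where "c' \<in> L" "rk c < rk c'" using none c by (force simp: L_def)
    then show ?thesis using cSup_upper[OF _ bdd, of "rk c'"] by (auto simp: \<alpha>_def)
  qed
  have approx: "\<exists>c\<in>L. s < rk c" if s: "s < \<alpha>" for s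
    using s less_cSup_iff[OF _ bdd, of s] L0 by (auto simp: \<alpha>_def)
  have "\<exists>g. \<forall>n. (g n \<in> L \<and> \<alpha> - 1 / (real n + 1) < rk (g n)) \<and> rk (g n) < rk (g (Suc n))"
  proof (rule dependent_nat_choice)
    show "\<exists>x. x \<in> L \<and> \<alpha> - 1 / (real 0 + 1) < rk x" using approx[of "\<alpha> - 1"] by auto
    fix x n assume "x \<in> L \<and> \<alpha> - 1 / (real n + 1) < rk x"
    then have "max (rk x) (\<alpha> - 1 / (real (Suc n) + 1)) < \<alpha>" using below by auto
    from approx[OF this] show "\<exists>y. (y \<in> L \<and> \<alpha> - 1 / (real (Suc n) + 1) < rk y) \<and> rk x < rk y" by auto
  qed
  then obtain g where g: "\<And>n. g n \<in> L" "\<And>n. \<alpha> - 1 / (real n + 1) < rk (g n)" "\<And>n. rk (g n) < rk (g (Suc n))"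
    by blast
  have gC: "g n \<in> C" "g n \<in> idempotents R" "g n \<in> carrier R" for n using g(1)[of n] Ci by (auto simp: L_def)
  interpret nondiscrete_increasing_idems R rk g
    by unfold_locales (use gC le[OF gC(1) gC(1) g(3)] in \<open>auto simp: idem_le_def\<close>)
  obtain G where G: "is_limit G" using limit_exists by blast
  have Gi: "G \<in> idempotents R" "\<And>n. G \<otimes> g n = g n" "\<And>n. g n \<otimes> G = g n"
    and G0: "\<And>x. x \<in> carrier R \<Longrightarrow> (\<And>n. x \<otimes> g n = \<zero>) \<Longrightarrow> x \<otimes> G = \<zero>"
      "\<And>x. x \<in> carrier R \<Longrightarrow> (\<And>n. g n \<otimes> x = \<zero>) \<Longrightarrow> G \<otimes> x = \<zero>"
    using G by (auto simp: is_limit_def)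
  have Gc: "G \<in> carrier R" using Gi by auto
  have gG: "idem_le (g n) G" for n using Gi by (simp add: idem_le_def)
  have rkG: "rk G \<le> \<alpha>"
  proof (rule field_le_epsilon)
    fix \<epsilon> :: real assume "0 < \<epsilon>"
    then obtain N where "rk G - rk (g N) < \<epsilon>" using rk_limit[OF G] by blast
    then show "rk G \<le> \<alpha> + \<epsilon>" using below[OF g(1)[of N]] by linarith
  qed
  have "\<alpha> \<le> t" unfolding \<alpha>_def using L0 by (intro cSup_least) (auto simp: L_def)
  have "G \<in> C"
  proof (rule max)
    have "x \<otimes> G = G \<otimes> x" if x: "x \<in> W" for x
    proof (rule limit_commute[OF G])
      show "x \<otimes> g n = g n \<otimes> x" for n using gC(1)[of n] CW x by (auto simp: commuting_idems_def)
    qed (use x W in auto)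
    then show "G \<in> commuting_idems W" using Gi(1) by (auto simp: commuting_idems_def)
    fix c assume c: "c \<in> C"
    then have cc: "c \<in> carrier R" using Ci by auto
    show "idem_le c G \<or> idem_le G c"
    proof (cases "rk c < \<alpha>")
      case True
      obtain n where "1 / (real n + 1) < \<alpha> - rk c"
        using reals_Archimedean[of "\<alpha> - rk c"] True by (auto simp: inverse_eq_divide add.commute)
      then have "rk c < rk (g n)" using g(2)[of n] by linarith
      then have "idem_le c (g n)" using le c gC(1) by blast
      then show ?thesis using idem_le_trans[OF _ gG cc gC(3) Gc] by blast
    next
      case False
      \<comment> \<open>Such a \<open>c\<close> lies above all \<open>g n\<close>, and the
        annihilator clauses of the limit turn this into \<open>idem_le G c\<close>.\<close>
      have "idem_le (g n) c" for n
        using le[OF gC(1) c] below[OF g(1)[of n]] False by simp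
      then have gc: "c \<otimes> g n = g n" "g n \<otimes> c = g n" for n by (auto simp: idem_le_def)
      have "(\<one> \<ominus> c) \<otimes> G = \<zero>" by (rule G0(1)) (use cc gC gc in \<open>auto simp: l_minus_distr\<close>)
      moreover have "G \<otimes> (\<one> \<ominus> c) = \<zero>" by (rule G0(2)) (use cc gC gc in \<open>auto simp: r_minus_distr\<close>)
      ultimately show ?thesis using cc Gc by (simp add: idem_le_def l_minus_distr r_minus_distr)
    qed
  qed
  then have "G \<in> L" using rkG \<open>\<alpha> \<le> t\<close> by (simp add: L_def)
  then have "rk G < \<alpha>" by (rule below)
  then obtain c where c: "c \<in> L" "rk G < rk c" using approx by blast
  have "rk c < \<alpha>" using below c by blast
  then obtain n where "1 / (real n + 1) < \<alpha> - rk c"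
    using reals_Archimedean[of "\<alpha> - rk c"] by (auto simp: inverse_eq_divide add.commute)
  then have "rk c < rk (g n)" using g(2)[of n] by linarith
  moreover have "rk (g n) \<le> rk G" using idem_le_rk(1)[OF gG] gC Gi by blast
  ultimately show False using c by linarith
qed

lemma max_chain_inf:
  assumes C: "max_chain W C" and W: "W \<subseteq> carrier R" and t: "t \<le> 1"
  shows "\<exists>g\<in>C. t \<le> rk g \<and> (\<forall>c\<in>C. t \<le> rk c \<longrightarrow> rk g \<le> rk c)"
proof -
  have Ci: "c \<in> idempotents R" if "c \<in> C" for c
    using C that by (auto simp: max_chain_def commuting_idems_def)
  have rk: "rk (\<one> \<ominus> c) = 1 - rk c" if "c \<in> C" for c
    using rk_idem_minus[of \<one> c] Ci[OF that] rk_one by auto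
  obtain g where "g \<in> (\<lambda>c. \<one> \<ominus> c) ` C" "rk g \<le> 1 - t"
    "\<forall>c\<in>(\<lambda>c. \<one> \<ominus> c) ` C. rk c \<le> 1 - t \<longrightarrow> rk c \<le> rk g"
    using max_chain_sup[OF max_chain_compl[OF C W] W, of "1 - t"] t by auto
  then show ?thesis using rk by (force simp: ball_simps)
qed

text \<open>Around an omitted rank \<open>t\<close> the chain has a gap between consecutive members
  \<open>l\<close> and \<open>u\<close>. For a proper piece \<open>f\<close> of
  \<open>u - l\<close>, the idempotent \<open>l + f\<close> is comparable with the whole chain, but
  its rank is strictly inside the gap.\<close>

lemma max_chain_rk_surj:
  assumes C: "max_chain W C" and W: "W \<subseteq> carrier R" and t: "0 \<le> t" "t \<le> 1"
    and split: "\<And>h. h \<in> commuting_idems W \<Longrightarrow> h \<noteq> \<zero> \<Longrightarrow>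
      \<exists>f\<in>commuting_idems W. idem_le f h \<and> f \<noteq> \<zero> \<and> f \<noteq> h"
  shows "\<exists>g\<in>C. rk g = t"
proof (rule ccontr)
  assume none: "\<not> ?thesis"
  have CW: "C \<subseteq> commuting_idems W" and tot: "\<And>c c'. c \<in> C \<Longrightarrow> c' \<in> C \<Longrightarrow> idem_le c c' \<or> idem_le c' c"
    and max: "\<And>x. x \<in> commuting_idems W \<Longrightarrow> (\<And>c. c \<in> C \<Longrightarrow> idem_le c x \<or> idem_le x c) \<Longrightarrow> x \<in> C"
    using C unfolding max_chain_def by blast+
  have Ci: "c \<in> idempotents R" if "c \<in> C" for c using CW that by (auto simp: commuting_idems_def)
  have le: "idem_le c c'" if "c \<in> C" "c' \<in> C" "rk c \<le> rk c'" for c c'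
  proof (rule ccontr)
    assume no: "\<not> ?thesis"
    then have le: "idem_le c' c" using tot that by blast
    then have "c = c'" using idem_le_rk(1,2)[of c' c] that Ci by fastforce
    then show False using no le by simp
  qed
  obtain l where l: "l \<in> C" "rk l \<le> t" "\<And>c. c \<in> C \<Longrightarrow> rk c \<le> t \<Longrightarrow> rk c \<le> rk l"
    using max_chain_sup[OF C W t(1)] by blast
  obtain u where u: "u \<in> C" "t \<le> rk u" "\<And>c. c \<in> C \<Longrightarrow> t \<le> rk c \<Longrightarrow> rk u \<le> rk c"
    using max_chain_inf[OF C W t(2)] by blast
  have lt: "rk l < t" "t < rk u" using none l u by force+
  have lu: "idem_le l u" using le l u lt by simp
  have i: "l \<in> idempotents R" "u \<in> idempotents R" using l u Ci by auto
  have c: "l \<in> carrier R" "u \<in> carrier R" using i by auto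
  define h where "h = u \<ominus> l"
  have hi: "h \<in> idempotents R" "rk h = rk u - rk l" using idem_le_rk(3,4)[OF lu i] by (auto simp: h_def)
  have hc: "h \<in> carrier R" using hi by auto
  have "h \<in> commuting_idems W"
  proof -
    have "y \<otimes> h = h \<otimes> y" if y: "y \<in> W" for y
    proof -
      have "y \<otimes> u = u \<otimes> y" "y \<otimes> l = l \<otimes> y" using l(1) u(1) CW y by (auto simp: commuting_idems_def)
      then show ?thesis using c y W by (auto simp: h_def l_minus_distr r_minus_distr subset_iff)
    qed
    then show ?thesis using hi(1) by (auto simp: commuting_idems_def)
  qed
  moreover have "h \<noteq> \<zero>" using hi lt by auto
  ultimately obtain f where f: "f \<in> commuting_idems W" "idem_le f h" "f \<noteq> \<zero>" "f \<noteq> h" using split by blast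
  have fi: "f \<in> idempotents R" using f by (auto simp: commuting_idems_def)
  have fc: "f \<in> carrier R" using fi by auto
  have hf: "h \<otimes> f = f" "f \<otimes> h = f" using f by (auto simp: idem_le_def)
  have lh: "l \<otimes> h = \<zero>" "h \<otimes> l = \<zero>" "u \<otimes> h = h" "h \<otimes> u = h"
    using lu c idemD(2)[OF i(1)] idemD(2)[OF i(2)]
    by (simp_all add: h_def idem_le_def l_minus_distr r_minus_distr)
  have lf: "l \<otimes> f = \<zero>" "f \<otimes> l = \<zero>" "u \<otimes> f = f" "f \<otimes> u = f"
  proof -
    show "l \<otimes> f = \<zero>" using mult_eq_assoc[OF lh(1), of f] hf c hc fc by simp
    show "u \<otimes> f = f" using mult_eq_assoc[OF lh(3), of f] hf c hc fc by simp
    show "f \<otimes> l = \<zero>" using mult_eq_assoc[OF hf(2), of l] lh c hc fc by simp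
    show "f \<otimes> u = f" using mult_eq_assoc[OF hf(2), of u] lh hf c hc fc by simp
  qed
  define x where "x = l \<oplus> f"
  have xi: "x \<in> idempotents R" unfolding x_def using idem_plus[OF i(1) fi lf(1,2)] .
  have xc: "x \<in> carrier R" using xi by auto
  have "x \<in> commuting_idems W"
  proof -
    have "y \<otimes> x = x \<otimes> y" if y: "y \<in> W" for y
    proof -
      have "y \<otimes> f = f \<otimes> y" "y \<otimes> l = l \<otimes> y" using l(1) f(1) CW y by (auto simp: commuting_idems_def)
      then show ?thesis using c fc y W by (auto simp: x_def l_distr r_distr subset_iff)
    qed
    then show ?thesis using xi by (auto simp: commuting_idems_def)
  qed
  moreover have lx: "idem_le l x" using lf c fc idemD(2)[OF i(1)] by (simp add: idem_le_def x_def l_distr r_distr)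
  moreover have xu: "idem_le x u" using lf lu c fc by (simp add: idem_le_def x_def l_distr r_distr)
  ultimately have "x \<in> C"
  proof (intro max)
    fix c' assume c': "c' \<in> C"
    have c'c: "c' \<in> carrier R" using Ci c' by auto
    show "idem_le c' x \<or> idem_le x c'"
    proof (cases "rk c' \<le> t")
      case True
      then have "idem_le c' l" using le[OF c' l(1)] l(3)[OF c'] by blast
      then show ?thesis using idem_le_trans[OF _ lx c'c c(1) xc] by blast
    next
      case False
      then have "idem_le u c'" using le[OF u(1) c'] u(3)[OF c'] by simp
      then show ?thesis using idem_le_trans[OF xu _ xc c(2) c'c] by blast
    qed
  qed
  moreover have "rk x = rk l + rk f" unfolding x_def using rk_idem_plus[OF i(1) fi lf(1,2)] .
  moreover have "0 < rk f" using rk_pos fc f by blast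
  moreover have "rk f < rk h" using rk_idem_less[OF hi(1) fi hf] f(4) by blast
  ultimately show False using l(3)[of x] u(3)[of x] hi(2) by fastforce
qed

text \<open>Members of the chain with equal rank coincide, so any choice of one member per rank is
  monotone.\<close>

lemma idempotent_path:
  assumes W: "W \<subseteq> carrier R"
    and split: "\<And>h. h \<in> commuting_idems W \<Longrightarrow> h \<noteq> \<zero> \<Longrightarrow>
      \<exists>f\<in>commuting_idems W. idem_le f h \<and> f \<noteq> \<zero> \<and> f \<noteq> h"
  obtains G where "\<And>t. t \<in> {0..1} \<Longrightarrow> G t \<in> commuting_idems W" "\<And>t. t \<in> {0..1} \<Longrightarrow> rk (G t) = t"
    "\<And>s t. s \<in> {0..1} \<Longrightarrow> t \<in> {0..1} \<Longrightarrow> s \<le> t \<Longrightarrow> idem_le (G s) (G t)"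
proof -
  obtain C where C: "max_chain W C" using max_chain_exists by blast
  have "\<forall>t. \<exists>g. t \<in> {0..1} \<longrightarrow> g \<in> C \<and> rk g = t" using max_chain_rk_surj[OF C W _ _ split] by auto
  then obtain G where G: "\<And>t. t \<in> {0..1} \<Longrightarrow> G t \<in> C" "\<And>t. t \<in> {0..1} \<Longrightarrow> rk (G t) = t"
    using choice[of "\<lambda>t g. t \<in> {0..1} \<longrightarrow> g \<in> C \<and> rk g = t"] by blast
  have CW: "C \<subseteq> commuting_idems W" and tot: "\<And>c c'. c \<in> C \<Longrightarrow> c' \<in> C \<Longrightarrow> idem_le c c' \<or> idem_le c' c"
    using C unfolding max_chain_def by blast+
  have Ci: "c \<in> idempotents R" if "c \<in> C" for c using CW that by (auto simp: commuting_idems_def)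
  have "idem_le (G s) (G t)" if st: "s \<in> {0..1}" "t \<in> {0..1}" "s \<le> t" for s t
  proof (rule ccontr)
    assume no: "\<not> ?thesis"
    then have ts: "idem_le (G t) (G s)" using tot G(1) st by blast
    then have "G t = G s" using idem_le_rk(1,2)[OF ts] G st Ci by fastforce
    then show False using no ts by simp
  qed
  then show thesis using that G CW by blast
qed

end

section \<open>Geodesics to locally algebraic units\<close>

text \<open>If non-zero elements had rank at least \<open>\<epsilon>\<close>, balls of that radius
  would be singletons.\<close>

lemma (in rank_ring) small_elements:
  assumes top: "rank_topology R rk \<noteq> discrete_topology (carrier R)" and "0 < \<epsilon>"
  shows "\<exists>x\<in>carrier R. x \<noteq> \<zero> \<and> rk x < \<epsilon>"
proof (rule ccontr)
  assume none: "\<not> ?thesis"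
  interpret M: Metric_space "carrier R" "rank_dist R rk" by (rule rank_dist_metric)
  have "openin M.mtopology {x}" if x: "x \<in> carrier R" for x
  proof -
    have "M.mball x \<epsilon> = {x}"
    proof (intro equalityI subsetI)
      fix y assume "y \<in> M.mball x \<epsilon>"
      then have y: "y \<in> carrier R" "rk (x \<ominus> y) < \<epsilon>" using x by (auto simp: M.mball_def rank_dist_def)
      then have "x \<ominus> y = \<zero>" using none x by (metis minus_closed)
      then show "y \<in> {x}" using x y by simp
    qed (use x \<open>0 < \<epsilon>\<close> in \<open>auto simp: M.mball_def rank_dist_def\<close>)
    then show ?thesis using M.openin_mball[of x \<epsilon>] by simp
  qed
  then have "discrete_topology (carrier R) = M.mtopology"
    by (subst discrete_topology_unique) auto
  then show False using top by (simp add: rank_topology_def)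
qed

context nondiscrete_continuous_ring
begin

text \<open>Multiplication by a fixed element does not increase the rank, so it passes to the limit,
  and every partial sum containing \<open>e\<close> already has component \<open>b e\<close>. By the
  last claim, when \<open>a\<close> is a unit no non-zero \<open>h\<close> is annihilated by all of
  \<open>E\<close>.\<close>

lemma locally_algebraic_component:
  assumes E: "E \<subseteq> idempotents R - {\<zero>}" and orth: "pairwise (orthogonal_elems R) E"
    and b: "\<And>e. e \<in> E \<Longrightarrow> b e \<in> carrier R \<and> e \<otimes> b e = b e \<and> b e \<otimes> e = b e"
    and a: "a \<in> carrier R"
    and lim: "limitin (rank_topology R rk) (\<lambda>F. \<Oplus>e\<in>F. b e) a (finite_subsets_at_top E)"
  shows "e \<in> E \<Longrightarrow> e \<otimes> a = b e" "e \<in> E \<Longrightarrow> a \<otimes> e = b e"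
    "h \<in> carrier R \<Longrightarrow> (\<And>e. e \<in> E \<Longrightarrow> e \<otimes> h = \<zero>) \<Longrightarrow> a \<otimes> h = \<zero>"
proof -
  interpret M: Metric_space "carrier R" "rank_dist R rk" by (rule rank_dist_metric)
  have Ei: "e \<in> idempotents R" if "e \<in> E" for e using E that by auto
  have Ec: "e \<in> carrier R" if "e \<in> E" for e using Ei[OF that] by auto
  have sum_closed: "(\<Oplus>e\<in>Y. b e) \<in> carrier R" if "Y \<subseteq> E" for Y
    using b that by (intro finsum_closed) auto
  have approx: "\<exists>Y. finite Y \<and> Z \<subseteq> Y \<and> Y \<subseteq> E \<and> rk ((\<Oplus>e\<in>Y. b e) \<ominus> a) < \<epsilon>"
    if "0 < \<epsilon>" "finite Z" "Z \<subseteq> E" for Z \<epsilon>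
  proof -
    have "\<forall>\<^sub>F F in finite_subsets_at_top E. (\<Oplus>e\<in>F. b e) \<in> carrier R \<and> rank_dist R rk (\<Oplus>e\<in>F. b e) a < \<epsilon>"
      using conjunct2[OF lim[unfolded rank_topology_def M.limitin_metric]] that(1) by simp
    then obtain X0 where X0: "finite X0" "X0 \<subseteq> E"
      "\<And>Y. finite Y \<Longrightarrow> X0 \<subseteq> Y \<Longrightarrow> Y \<subseteq> E \<Longrightarrow> rank_dist R rk (\<Oplus>e\<in>Y. b e) a < \<epsilon>"
      unfolding eventually_finite_subsets_at_top by meson
    have "rank_dist R rk (\<Oplus>e\<in>X0 \<union> Z. b e) a < \<epsilon>" using X0 that by (intro X0(3)) auto
    moreover have "(\<Oplus>e\<in>X0 \<union> Z. b e) \<in> carrier R" using X0 that by (intro sum_closed) auto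
    ultimately show ?thesis using X0 that a by (intro exI[of _ "X0 \<union> Z"]) (auto simp: rank_dist_def)
  qed
  have zero: "e' \<otimes> b e = \<zero>" "b e \<otimes> e' = \<zero>" if "e \<in> E" "e' \<in> E" "e \<noteq> e'" for e e'
  proof -
    have o: "e' \<otimes> e = \<zero>" "e \<otimes> e' = \<zero>"
      using orth that unfolding pairwise_def orthogonal_elems_def by auto
    show "e' \<otimes> b e = \<zero>" using mult_eq_assoc[OF o(1), of "b e"] b[OF that(1)] Ec that by simp
    show "b e \<otimes> e' = \<zero>"
      using m_assoc[of "b e" e e'] o(2) b[OF that(1)] Ec that by simp
  qed
  have left: "e \<otimes> (\<Oplus>e'\<in>Y. b e') = b e" and right: "(\<Oplus>e'\<in>Y. b e') \<otimes> e = b e"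
    if Y: "finite Y" "Y \<subseteq> E" "e \<in> Y" for e Y
  proof -
    have eE: "e \<in> E" using Y by auto
    have bY: "b \<in> Y \<rightarrow> carrier R" using b Y by auto
    have "e \<otimes> (\<Oplus>e'\<in>Y. b e') = (\<Oplus>e'\<in>Y. e \<otimes> b e')" using Y bY Ec eE by (intro finsum_rdistr) auto
    also have "\<dots> = (\<Oplus>e'\<in>Y. if e = e' then b e' else \<zero>)"
      using b zero Y eE by (intro finsum_cong') (auto simp: subset_iff)
    also have "\<dots> = b e" using Y bY by (intro finsum_singleton) auto
    finally show "e \<otimes> (\<Oplus>e'\<in>Y. b e') = b e" .
    have "(\<Oplus>e'\<in>Y. b e') \<otimes> e = (\<Oplus>e'\<in>Y. b e' \<otimes> e)" using Y bY Ec eE by (intro finsum_ldistr) auto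
    also have "\<dots> = (\<Oplus>e'\<in>Y. if e = e' then b e' else \<zero>)"
      using b zero Y eE by (intro finsum_cong') (auto simp: subset_iff)
    also have "\<dots> = b e" using Y bY by (intro finsum_singleton) auto
    finally show "(\<Oplus>e'\<in>Y. b e') \<otimes> e = b e" .
  qed
  have small: "x = y" if "x \<in> carrier R" "y \<in> carrier R" "\<And>\<epsilon>. 0 < \<epsilon> \<Longrightarrow> rk (x \<ominus> y) < \<epsilon>" for x y
  proof -
    have "rk (x \<ominus> y) = 0" using that(3)[of "rk (x \<ominus> y)"] rk_nonneg[of "x \<ominus> y"] that(1,2) by force
    then show ?thesis using rk_eq_zero_iff that(1,2) by simp
  qed
  show "e \<otimes> a = b e" if e: "e \<in> E" for e
  proof (rule small[symmetric])
    fix \<epsilon> :: real assume "0 < \<epsilon>"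
    then obtain Y where Y: "finite Y" "{e} \<subseteq> Y" "Y \<subseteq> E" "rk ((\<Oplus>e\<in>Y. b e) \<ominus> a) < \<epsilon>"
      using approx[of \<epsilon> "{e}"] e by auto
    note S = sum_closed[OF Y(3)]
    have "b e \<ominus> e \<otimes> a = e \<otimes> ((\<Oplus>e\<in>Y. b e) \<ominus> a)"
      using left[OF Y(1,3), of e] Y(2) S a Ec[OF e] by (simp add: r_minus_distr)
    then show "rk (b e \<ominus> e \<otimes> a) < \<epsilon>"
      using rk_mult_right[OF Ec[OF e], of "(\<Oplus>e\<in>Y. b e) \<ominus> a"] S a Y(4) by simp
  qed (use b e Ec a in auto)
  show "a \<otimes> e = b e" if e: "e \<in> E" for e
  proof (rule small[symmetric])
    fix \<epsilon> :: real assume "0 < \<epsilon>"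
    then obtain Y where Y: "finite Y" "{e} \<subseteq> Y" "Y \<subseteq> E" "rk ((\<Oplus>e\<in>Y. b e) \<ominus> a) < \<epsilon>"
      using approx[of \<epsilon> "{e}"] e by auto
    note S = sum_closed[OF Y(3)]
    have "b e \<ominus> a \<otimes> e = ((\<Oplus>e\<in>Y. b e) \<ominus> a) \<otimes> e"
      using right[OF Y(1,3), of e] Y(2) S a Ec[OF e] by (simp add: l_minus_distr)
    then show "rk (b e \<ominus> a \<otimes> e) < \<epsilon>"
      using rk_mult_left[of "(\<Oplus>e\<in>Y. b e) \<ominus> a" e] S a Y(4) Ec[OF e] by simp
  qed (use b e Ec a in auto)
  show "a \<otimes> h = \<zero>" if h: "h \<in> carrier R" "\<And>e. e \<in> E \<Longrightarrow> e \<otimes> h = \<zero>" for h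
  proof (rule small[symmetric])
    fix \<epsilon> :: real assume "0 < \<epsilon>"
    then obtain Y where Y: "finite Y" "Y \<subseteq> E" "rk ((\<Oplus>e\<in>Y. b e) \<ominus> a) < \<epsilon>"
      using approx[of \<epsilon> "{}"] by auto
    note S = sum_closed[OF Y(2)]
    have bh: "b e \<otimes> h = \<zero>" if "e \<in> Y" for e
    proof -
      have eE: "e \<in> E" using Y that by auto
      show ?thesis using m_assoc[of "b e" e h] b[OF eE] Ec[OF eE] h(1) h(2)[OF eE] by simp
    qed
    have "(\<Oplus>e\<in>Y. b e) \<otimes> h = (\<Oplus>e\<in>Y. b e \<otimes> h)" using Y b h(1) by (intro finsum_ldistr) auto
    also have "\<dots> = (\<Oplus>e\<in>Y. \<zero>)" using bh by (intro finsum_cong') auto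
    finally have "(\<Oplus>e\<in>Y. b e) \<otimes> h = \<zero>" by simp
    then have "\<zero> \<ominus> a \<otimes> h = ((\<Oplus>e\<in>Y. b e) \<ominus> a) \<otimes> h" using S a h(1) by (simp add: l_minus_distr)
    then show "rk (\<zero> \<ominus> a \<otimes> h) < \<epsilon>"
      using rk_mult_left[of "(\<Oplus>e\<in>Y. b e) \<ominus> a" h] S a Y(3) h(1) by simp
  qed (use a h in auto)
qed

text \<open>Since \<open>a\<close> is a unit, some \<open>e\<close> in \<open>E\<close> does not
  kill \<open>h\<close>. If \<open>h\<close> is not below \<open>e\<close>, then \<open>e h\<close>
  is already a proper piece; otherwise \<open>a\<close> acts on \<open>h\<close> as the algebraic
  component \<open>b e\<close> and \<open>split_idem\<close> applies.\<close>

lemma locally_algebraic_split: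
  assumes E: "E \<subseteq> idempotents R - {\<zero>}" and orth: "pairwise (orthogonal_elems R) E"
    and b: "\<And>e. e \<in> E \<Longrightarrow> b e \<in> algebraic_elems (corner_ring R e)"
    and a: "a \<in> Units R"
    and lim: "limitin (rank_topology R rk) (\<lambda>F. \<Oplus>e\<in>F. b e) a (finite_subsets_at_top E)"
    and h: "h \<in> commuting_idems (insert a E)" "h \<noteq> \<zero>"
  shows "\<exists>f\<in>commuting_idems (insert a E). idem_le f h \<and> f \<noteq> \<zero> \<and> f \<noteq> h"
proof -
  have ac: "a \<in> carrier R" using a by (rule Units_closed)
  have Ei: "e \<in> idempotents R" "e \<noteq> \<zero>" if "e \<in> E" for e using E that by auto
  have Ec: "e \<in> carrier R" if "e \<in> E" for e using Ei[OF that] by auto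
  have b': "b e \<in> carrier R \<and> e \<otimes> b e = b e \<and> b e \<otimes> e = b e" if "e \<in> E" for e
    using algebraic_corner[OF Ei[OF that] b[OF that]] by blast
  have comp: "e \<otimes> a = b e" "a \<otimes> e = b e" if "e \<in> E" for e
    by (rule locally_algebraic_component(1,2)[OF E orth _ ac lim that], rule b', assumption)+
  have ortho: "e' \<otimes> e = \<zero>" if "e \<in> E" "e' \<in> E" "e \<noteq> e'" for e e'
    using orth that unfolding pairwise_def orthogonal_elems_def by auto
  have hi: "h \<in> idempotents R" "h \<otimes> a = a \<otimes> h" and he: "\<And>e. e \<in> E \<Longrightarrow> h \<otimes> e = e \<otimes> h"
    using h(1) by (auto simp: commuting_idems_def)
  have hc: "h \<in> carrier R" and hh: "h \<otimes> h = h" using hi idemD by auto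
  have "\<exists>e\<in>E. e \<otimes> h \<noteq> \<zero>"
  proof (rule ccontr)
    assume "\<not> ?thesis"
    then have "a \<otimes> h = \<zero>"
      by (intro locally_algebraic_component(3)[OF E orth _ ac lim hc]) (use b' in auto)
    then have "inv a \<otimes> (a \<otimes> h) = \<zero>" using a by simp
    then show False using h(2) mult_eq_assoc[OF Units_l_inv[OF a], of h] a ac hc by simp
  qed
  then obtain e where e: "e \<in> E" "e \<otimes> h \<noteq> \<zero>" by blast
  have ec: "e \<in> carrier R" "e \<otimes> e = e" using Ei[OF e(1)] idemD by auto
  \<comment> \<open>Below \<open>e\<close>, commuting with the rest of \<open>E\<close> is automatic
    by orthogonality.\<close>
  have commE: "f \<in> commuting_idems (insert a E)"
    if f: "f \<in> idempotents R" "f \<otimes> a = a \<otimes> f" "e \<otimes> f = f" "f \<otimes> e = f" for f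
  proof -
    have fc: "f \<in> carrier R" using f by auto
    have "e' \<otimes> f = f \<otimes> e'" if e': "e' \<in> E" for e'
    proof (cases "e' = e")
      case False
      have "e' \<otimes> f = \<zero>"
        using mult_eq_assoc[OF ortho[OF e(1) e'], of f] False f(3) ec(1) Ec[OF e'] fc by simp
      moreover have "f \<otimes> e' = \<zero>"
        using m_assoc[OF fc ec(1) Ec[OF e']] f(4) ortho[OF e' e(1)] False fc by simp
      ultimately show ?thesis by simp
    qed (use f in simp)
    then show ?thesis using f(1,2) by (simp add: commuting_idems_def)
  qed
  show ?thesis
  proof (cases "e \<otimes> h = h")
    case False
    let ?f = "e \<otimes> h"
    have eh: "e \<otimes> (h \<otimes> t) = h \<otimes> (e \<otimes> t)" if "t \<in> carrier R" for t
      using commute_left[OF ec(1) hc] he[OF e(1)] that by simp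
    have "?f \<otimes> ?f = e \<otimes> (h \<otimes> (e \<otimes> h))" using ec hc by (simp add: m_assoc)
    also have "\<dots> = e \<otimes> (e \<otimes> (h \<otimes> h))" using commute_left[OF hc ec(1) he[OF e(1)] hc] by simp
    also have "\<dots> = ?f" using hh mult_eq_assoc[OF ec(2)] ec hc by simp
    finally have fi: "?f \<in> idempotents R" using ec hc by (intro idemI) auto
    have fh: "?f \<otimes> h = ?f" "h \<otimes> ?f = ?f"
      using ec hc hh commute_left[OF hc ec(1) he[OF e(1)] hc] by (simp_all add: m_assoc)
    have "?f \<in> commuting_idems (insert a E)"
    proof (rule commE[OF fi])
      show "e \<otimes> ?f = ?f" using mult_eq_assoc[OF ec(2)] ec hc by simp
      show "?f \<otimes> e = ?f" using he[OF e(1)] mult_eq_assoc[OF ec(2)] ec hc by (simp add: m_assoc)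
      have "a \<otimes> e = e \<otimes> a" using comp(1,2)[OF e(1)] by simp
      then show "?f \<otimes> a = a \<otimes> ?f"
        using commute_mult[OF ac ec(1) hc] hi(2) by simp
    qed
    then show ?thesis using False e(2) fh by (intro bexI[of _ ?f]) (auto simp: idem_le_def)
  next
    case True
    obtain p n where p: "\<And>j. p j \<in> ring_center R" "horner (b e) p n \<otimes> e = \<zero>"
      using algebraic_corner[OF Ei[OF e(1)] b[OF e(1)]] by blast
    have bc: "b e \<in> carrier R" using b' e(1) by blast
    have "horner a p n \<otimes> h = horner (b e) p n \<otimes> h"
      by (rule horner_restrict[OF ac p(1) ec(1) _ _ ec(2) hc True]) (use comp[OF e(1)] in auto)
    also have "\<dots> = horner (b e) p n \<otimes> e \<otimes> h"
      using True bc p(1) ec hc by (simp add: m_assoc)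
    also have "\<dots> = \<zero>" using p(2) hc by simp
    finally obtain f where f: "f \<in> idempotents R" "h \<otimes> f = f" "f \<otimes> h = f" "f \<otimes> a = a \<otimes> f" "f \<noteq> \<zero>" "f \<noteq> h"
      using split_idem[where p = p, OF ac hi(1) h(2) hi(2) p(1)] by blast
    have fc: "f \<in> carrier R" using f by auto
    have "h \<otimes> e = h" using True he[OF e(1)] by simp
    then have "e \<otimes> f = f" "f \<otimes> e = f"
      using mult_eq_assoc[OF True, of f] m_assoc[OF fc hc ec(1)] f(2,3) ec hc fc by auto
    then show ?thesis using commE f by (intro bexI[of _ f]) (auto simp: idem_le_def)
  qed
qed

text \<open>Along a path of idempotents \<open>g t\<close> commuting with \<open>a\<close>, the rank of \<open>(a - 1) (g t - g s)\<close> is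
  additive, so \<open>a (g t) + (1 - g t)\<close> becomes a geodesic after reparametrising by that rank.\<close>

lemma geodesic_of_idempotent_path:
  assumes a: "a \<in> Units R"
    and G: "\<And>t. t \<in> {0..1} \<Longrightarrow> G t \<in> idempotents R" "\<And>t. t \<in> {0..1} \<Longrightarrow> a \<otimes> G t = G t \<otimes> a"
      "\<And>t. t \<in> {0..1} \<Longrightarrow> rk (G t) = t"
      "\<And>s t. s \<in> {0..1} \<Longrightarrow> t \<in> {0..1} \<Longrightarrow> s \<le> t \<Longrightarrow> idem_le (G s) (G t)"
  shows "\<exists>\<gamma>. geodesic (Units R) (rank_dist R rk) \<one> a \<gamma>"
proof -
  have ac: "a \<in> carrier R" using a by (rule Units_closed)
  define c where "c = a \<ominus> \<one>"
  have cc: "c \<in> carrier R" using ac by (simp add: c_def)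
  have Gc: "G t \<in> carrier R" if "t \<in> {0..1}" for t using G(1)[OF that] by auto
  have cG: "c \<otimes> G t = G t \<otimes> c" if "t \<in> {0..1}" for t
    using G(2)[OF that] Gc[OF that] ac by (simp add: c_def l_minus_distr r_minus_distr)
  \<comment> \<open>\<open>\<phi> t\<close> is the distance from \<open>\<one>\<close> to
    \<open>a \<otimes> G t \<oplus> (\<one> \<ominus> G t)\<close>, the new parameter of the
    path.\<close>
  define \<phi> where "\<phi> t = rk (c \<otimes> G t)" for t
  have diff: "rk (c \<otimes> (G t \<ominus> G s)) = \<phi> t - \<phi> s" "\<phi> t - \<phi> s \<le> t - s" "\<phi> s \<le> \<phi> t"
    if st: "s \<in> {0..1}" "t \<in> {0..1}" "s \<le> t" for s t
  proof -
    note c' = Gc[OF st(1)] Gc[OF st(2)] cc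
    have le: "G t \<otimes> G s = G s" "G s \<otimes> G t = G s" using G(4)[OF st] by (auto simp: idem_le_def)
    have "G s \<otimes> (c \<otimes> G t) = c \<otimes> G t \<otimes> G s"
      using mult_eq_assoc[OF cG[OF st(1), symmetric], of "G t"] c' le by (simp add: m_assoc)
    then have "\<phi> t = rk (c \<otimes> G t \<otimes> G s) + rk (c \<otimes> G t \<otimes> (\<one> \<ominus> G s))"
      unfolding \<phi>_def using rk_split[OF G(1)[OF st(1)], of "c \<otimes> G t"] c' by simp
    moreover have "c \<otimes> G t \<otimes> G s = c \<otimes> G s" "c \<otimes> G t \<otimes> (\<one> \<ominus> G s) = c \<otimes> (G t \<ominus> G s)"
      using c' le by (simp_all add: m_assoc r_minus_distr)
    ultimately show eq: "rk (c \<otimes> (G t \<ominus> G s)) = \<phi> t - \<phi> s" by (simp add: \<phi>_def)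
    have "rk (c \<otimes> (G t \<ominus> G s)) \<le> rk (G t \<ominus> G s)" using rk_mult_right c' by simp
    also have "\<dots> = t - s" using idem_le_rk(3)[OF G(4)[OF st] G(1)[OF st(1)] G(1)[OF st(2)]] G(3) st by simp
    finally show "\<phi> t - \<phi> s \<le> t - s" using eq by simp
    show "\<phi> s \<le> \<phi> t" using eq rk_nonneg[of "c \<otimes> (G t \<ominus> G s)"] c' by simp
  qed
  have lip: "\<bar>\<phi> t - \<phi> s\<bar> \<le> \<bar>t - s\<bar>" if "s \<in> {0..1}" "t \<in> {0..1}" for s t
    using diff(2,3)[of s t] diff(2,3)[of t s] that by (cases "s \<le> t") auto
  have cont: "continuous_on {0..1} \<phi>"
    unfolding continuous_on_iff dist_real_def
  proof (intro ballI allI impI)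
    fix s \<epsilon> :: real assume "s \<in> {0..1}" "0 < \<epsilon>"
    then show "\<exists>\<delta>>0. \<forall>t\<in>{0..1}. \<bar>t - s\<bar> < \<delta> \<longrightarrow> \<bar>\<phi> t - \<phi> s\<bar> < \<epsilon>"
      using lip by (intro exI[of _ \<epsilon>]) force
  qed
  define r where "r = rk c"
  have G0: "G 0 = \<zero>" using rk_eq_zero_iff[OF Gc[of 0]] G(3)[of 0] by simp
  have G1: "G 1 = \<one>"
  proof -
    have "rk (\<one> \<ominus> G 1) = 0" using rk_idem_minus[of \<one> "G 1"] G(1)[of 1] G(3)[of 1] rk_one Gc[of 1] by simp
    then have "\<one> \<ominus> G 1 = \<zero>" using rk_eq_zero_iff[of "\<one> \<ominus> G 1"] Gc[of 1] by simp
    then show ?thesis using Gc[of 1] by simp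
  qed
  have phi01: "\<phi> 0 = 0" "\<phi> 1 = r" using G0 G1 cc by (simp_all add: \<phi>_def r_def)
  \<comment> \<open>\<open>\<phi>\<close> may be constant on intervals, so \<open>\<tau>\<close> is
    merely some right inverse of it and need not be monotone.\<close>
  have "\<exists>t. t \<in> {0..1} \<and> \<phi> t = s" if "s \<in> {0..r}" for s
    using IVT'[of \<phi> 0 s 1] that phi01 cont by auto
  then obtain \<tau> where tau: "\<And>s. s \<in> {0..r} \<Longrightarrow> \<tau> s \<in> {0..1}" "\<And>s. s \<in> {0..r} \<Longrightarrow> \<phi> (\<tau> s) = s" by metis
  define \<gamma> where "\<gamma> s = a \<otimes> G (\<tau> s) \<oplus> (\<one> \<ominus> G (\<tau> s))" for s
  have gc: "\<gamma> s \<in> carrier R" if "s \<in> {0..r}" for s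
    using Gc[OF tau(1)[OF that]] ac by (simp add: \<gamma>_def)
  have g1: "\<gamma> s \<ominus> \<one> = c \<otimes> G (\<tau> s)" if "s \<in> {0..r}" for s
    using Gc[OF tau(1)[OF that]] ac l_one[OF Gc[OF tau(1)[OF that]]] one_closed
    unfolding \<gamma>_def c_def by algebra
  have unit: "\<gamma> s \<in> Units R" if s: "s \<in> {0..r}" for s
  proof -
    let ?g = "G (\<tau> s)"
    have gi: "?g \<in> idempotents R" "a \<otimes> ?g = ?g \<otimes> a" using G(1,2) tau(1)[OF s] by auto
    have g: "?g \<in> carrier R" "?g \<otimes> ?g = ?g" using gi idemD by auto
    define i where "i = inv a"
    have ic: "i \<in> carrier R" "i \<otimes> a = \<one>" "a \<otimes> i = \<one>" using a by (auto simp: i_def)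
    have "i \<otimes> ?g = i \<otimes> (?g \<otimes> a) \<otimes> i" using ic g ac by (simp add: m_assoc)
    also have "\<dots> = i \<otimes> (a \<otimes> ?g) \<otimes> i" using gi by simp
    also have "\<dots> = ?g \<otimes> i" using mult_eq_assoc[OF ic(2)] ic g ac by simp
    finally have ig: "i \<otimes> ?g = ?g \<otimes> i" .
    \<comment> \<open>Elements of this form multiply like \<open>x\<close> and \<open>y\<close> on
      the range of \<open>?g\<close> and trivially on the complement, so \<open>inv a\<close>
      provides the inverse.\<close>
    have prod: "(x \<otimes> ?g \<oplus> (\<one> \<ominus> ?g)) \<otimes> (y \<otimes> ?g \<oplus> (\<one> \<ominus> ?g)) = \<one>"
      if x: "x \<in> carrier R" and y: "y \<in> carrier R" "y \<otimes> ?g = ?g \<otimes> y" and xy: "x \<otimes> y = \<one>" for x y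
    proof -
      have "x \<otimes> ?g \<otimes> (y \<otimes> ?g) = x \<otimes> (?g \<otimes> (?g \<otimes> y))" using x y g by (simp add: m_assoc)
      also have "\<dots> = x \<otimes> (?g \<otimes> y)" using mult_eq_assoc[OF g(2)] g(1) y(1) by simp
      also have "\<dots> = x \<otimes> (y \<otimes> ?g)" using y(2) by simp
      also have "\<dots> = ?g" using mult_eq_assoc[OF xy] x y(1) g(1) by simp
      finally have 1: "x \<otimes> ?g \<otimes> (y \<otimes> ?g) = ?g" .
      have gy: "?g \<otimes> (y \<otimes> ?g) = y \<otimes> ?g" using y(2) mult_eq_assoc[OF g(2)] g(1) y(1) by simp
      have 2: "x \<otimes> ?g \<otimes> (\<one> \<ominus> ?g) = \<zero>" "(\<one> \<ominus> ?g) \<otimes> (y \<otimes> ?g) = \<zero>" "(\<one> \<ominus> ?g) \<otimes> (\<one> \<ominus> ?g) = \<one> \<ominus> ?g"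
        using x y(1) g gy by (simp_all add: r_minus_distr l_minus_distr m_assoc)
      have "?g \<oplus> (\<one> \<ominus> ?g) = \<one>" using g(1) one_closed by algebra
      then show ?thesis using 1 2 x y(1) g(1) by (simp add: l_distr[of _ "\<one> \<ominus> ?g"] r_distr)
    qed
    show ?thesis
      unfolding \<gamma>_def Units_def
      using prod[OF ac ic(1) ig ic(3)] prod[OF ic(1) ac gi(2) ic(2)] ac ic(1) g(1)
      by (intro CollectI conjI bexI[of _ "i \<otimes> ?g \<oplus> (\<one> \<ominus> ?g)"]) auto
  qed
  have dist_le: "rk (\<gamma> t \<ominus> \<gamma> s) = t - s" if st: "s \<in> {0..r}" "t \<in> {0..r}" "s \<le> t" for s t
  proof (cases "\<tau> s \<le> \<tau> t")
    case True
    note c' = Gc[OF tau(1)[OF st(1)]] Gc[OF tau(1)[OF st(2)]] cc gc[OF st(1)] gc[OF st(2)]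
    have "\<gamma> t \<ominus> \<gamma> s = (\<gamma> t \<ominus> \<one>) \<ominus> (\<gamma> s \<ominus> \<one>)" using c' one_closed by algebra
    also have "\<dots> = c \<otimes> (G (\<tau> t) \<ominus> G (\<tau> s))" using g1 st c' by (simp add: r_minus_distr)
    finally show ?thesis using diff(1)[OF tau(1)[OF st(1)] tau(1)[OF st(2)] True] tau(2) st by simp
  next
    case False
    \<comment> \<open>Where \<open>\<tau>\<close> reverses the order, monotonicity of
      \<open>\<phi>\<close> forces the two parameters to be equal.\<close>
    then have "\<phi> (\<tau> t) \<le> \<phi> (\<tau> s)" using diff(3)[OF tau(1)[OF st(2)] tau(1)[OF st(1)]] by simp
    then have "s = t" using tau(2) st by simp
    then show ?thesis using gc[OF st(1)] by simp
  qed
  have isom: "rank_dist R rk (\<gamma> s) (\<gamma> t) = \<bar>s - t\<bar>" if st: "s \<in> {0..r}" "t \<in> {0..r}" for s t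
    using dist_le[of s t] dist_le[of t s] gc[OF st(1)] gc[OF st(2)] st rk_minus_commute[of "\<gamma> s" "\<gamma> t"]
    by (cases "s \<le> t") (auto simp: rank_dist_def)
  have r0: "0 \<le> r" using rk_nonneg cc by (simp add: r_def)
  have d: "rank_dist R rk \<one> a = r"
    using rk_minus_commute[of a \<one>] ac by (simp add: rank_dist_def r_def c_def)
  have "rk (\<gamma> 0 \<ominus> \<one>) = 0" using g1[of 0] tau(2)[of 0] r0 by (simp add: \<phi>_def)
  then have start: "\<gamma> 0 = \<one>" using rk_eq_zero_iff[of "\<gamma> 0 \<ominus> \<one>"] gc[of 0] r0 by simp
  \<comment> \<open>\<open>\<tau> r\<close> may differ from \<open>1\<close>, but
    \<open>\<phi>\<close> takes the same value at both, so \<open>c\<close> kills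
    \<open>G 1 \<ominus> G (\<tau> r)\<close>.\<close>
  have "rk (a \<ominus> \<gamma> r) = 0"
  proof -
    have t: "\<tau> r \<in> {0..1}" "\<phi> (\<tau> r) = r" using tau r0 by auto
    note c' = Gc[OF t(1)] gc[of r] ac
    have "a \<ominus> \<gamma> r = c \<ominus> (\<gamma> r \<ominus> \<one>)" unfolding c_def using c' r0 one_closed by (simp, algebra)
    also have "\<dots> = c \<otimes> (G 1 \<ominus> G (\<tau> r))" using g1[of r] r0 cc c' G1 by (simp add: r_minus_distr)
    finally show ?thesis using diff(1)[OF t(1), of 1] t phi01 by simp
  qed
  then have "\<gamma> r = a" using rk_eq_zero_iff[of "a \<ominus> \<gamma> r"] gc[of r] ac r0 by simp
  then have "geodesic (Units R) (rank_dist R rk) \<one> a \<gamma>"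
    unfolding geodesic_def d using unit isom start by auto
  then show ?thesis by blast
qed

end

theorem lemma5p14:
  fixes R :: "('a, 'm) ring_scheme" and rk :: "'a \<Rightarrow> real" and a :: 'a
  assumes "irreducible_ring R"
    and "continuous_ring R"
    and "rank_function R rk"
    and "rank_topology R rk \<noteq> discrete_topology (carrier R)"
    and "a \<in> carrier (units_of R)"
    and "locally_algebraic R rk a"
  shows "a \<in> geodesic_elems (units_of R) (rank_dist R rk)"
proof -
  have reg: "regular_ring R" using assms(2) by (simp add: continuous_ring_def)
  interpret ring R using reg by (simp add: regular_ring_def)
  interpret von_neumann_regular R
    using reg by unfold_locales (auto simp: regular_ring_def)
  interpret rank_ring R rk by unfold_locales (rule assms(3))
  interpret nondiscrete_continuous_ring R rk
    using assms(1,2) small_elements[OF assms(4)] by unfold_locales auto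
  obtain E b where E: "E \<subseteq> idempotents R - {\<zero>\<^bsub>R\<^esub>}" "pairwise (orthogonal_elems R) E"
    "\<And>e. e \<in> E \<Longrightarrow> b e \<in> algebraic_elems (corner_ring R e)"
    "limitin (rank_topology R rk) (\<lambda>F. \<Oplus>\<^bsub>R\<^esub>e\<in>F. b e) a (finite_subsets_at_top E)"
    using assms(6) by (auto simp: locally_algebraic_def)
  have a: "a \<in> Units R" using assms(5) by (simp add: units_of_def)
  have W: "insert a E \<subseteq> carrier R" using E(1) Units_closed[OF a] by auto
  obtain G where G: "\<And>t. t \<in> {0..1} \<Longrightarrow> G t \<in> commuting_idems (insert a E)"
    "\<And>t. t \<in> {0..1} \<Longrightarrow> rk (G t) = t"
    "\<And>s t. s \<in> {0..1} \<Longrightarrow> t \<in> {0..1} \<Longrightarrow> s \<le> t \<Longrightarrow> idem_le (G s) (G t)"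
    using idempotent_path[OF W locally_algebraic_split[OF E(1,2,3) a E(4)]] by blast
  have "\<exists>\<gamma>. geodesic (Units R) (rank_dist R rk) \<one>\<^bsub>R\<^esub> a \<gamma>"
    by (rule geodesic_of_idempotent_path[OF a _ _ G(2,3)]) (use G(1) in \<open>auto simp: commuting_idems_def\<close>)
  then show ?thesis using a by (simp add: geodesic_elems_def units_of_def)
qed

end
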